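(* Let $T>0$, $\theta\in(-1,0]$ and $M>0$. Let $v^0,w^0\in\dot H^0$ with $\|v^0\|_{\dot H^0}+\|w^0\|_{\dot H^0}\le M$, and let $v,w\in C([0,T];\dot H^0)$ be the solutions on $[0,T]$ (in the sense described in the context) of the system $$\partial_t v_k=\tfrac12 ik\sum_{k_1+k_2=k}e^{3ikk_1k_2t}v_{k_1}v_{k_2},\qquad k\in\mathbb{Z}_0,$$ with $v(0)=v^0$, $w(0)=w^0$. Then $$\|v-w\|_{L_\infty([0,T];\dot H^\theta)}\le C'\,C_M^{\,T}\,\|v^0-w^0\|_{\dot H^\theta},$$ where $C'$ and $C_M$ depend only on $M$ and $\theta$.
   Context: Write $\mathbb{Z}_0=\mathbb{Z}\setminus\{0\}$. For $s\in\mathbb{R}$, $\dot H^s$ denotes the Hilbert space of sequences $v=(v_k)_{k\in\mathbb{Z}_0}$ of complex numbers with $v_{-k}=\overline{v_k}$ and $\|v\|_{\dot H^s}^2=\sum_{k\in\mathbb{Z}_0}|k|^{2s}|v_k|^2<\infty$ (so $\dot H^0\subset\dot H^\theta$ for $\theta\le 0$). The system above is the periodic KdV equation written for $v_k(t)=e^{ik^3t}u_k(t)$, $u_k$ the Fourier coefficients of the KdV solution $u$; sums are over $k_1,k_2\in\mathbb{Z}_0$. A function $v$ is a solution on $[0,T]$ with $v(0)=v^0$ if $v\in L_\infty([0,T];\dot H^0)$ and for every $k\in\mathbb{Z}_0$ and $t\in[0,T]$, $$v_k(t)-v^0_k=\tfrac12 ik\int_0^t\sum_{k_1+k_2=k}e^{3ikk_1k_2\tau}v_{k_1}(\tau)v_{k_2}(\tau)\,d\tau.$$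 For every $v^0\in\dot H^0$ such a solution in $C([0,T];\dot H^0)$ exists and is unique. *)

theory Defs
  imports "HOL-Analysis.Analysis"
begin

text \<open>Sequences indexed by Z_0 are modelled as functions int => complex; the
  (meaningless) value at index 0 is normalised to 0.\<close>

type_synonym seq = "int \<Rightarrow> complex"

definition Z0 :: "int set" where "Z0 = {k. k \<noteq> 0}"

definition hnorm2 :: "real \<Rightarrow> seq \<Rightarrow> real" where
  "hnorm2 sg v = infsum (\<lambda>k. ((real_of_int \<bar>k\<bar>) powr (2 * sg)) * ((cmod (v k)) ^ 2)) Z0"

definition hnorm :: "real \<Rightarrow> seq \<Rightarrow> real" where
  "hnorm sg v = sqrt (hnorm2 sg v)"

definition in_Hdot :: "real \<Rightarrow> seq \<Rightarrow> bool" where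
  "in_Hdot sg v \<longleftrightarrow> v 0 = 0 \<and> (\<forall>k. v (-k) = cnj (v k)) \<and>
     (\<lambda>k. ((real_of_int \<bar>k\<bar>) powr (2 * sg)) * ((cmod (v k)) ^ 2)) summable_on Z0"

definition kdv_rhs :: "seq \<Rightarrow> int \<Rightarrow> real \<Rightarrow> complex" where
  "kdv_rhs v k \<tau> = (\<Sum>\<^sub>\<infinity>k1\<in>{k1. k1 \<noteq> 0 \<and> k1 \<noteq> k}.
      exp (\<i> * of_real (3 * real_of_int k * real_of_int k1 * real_of_int (k - k1) * \<tau>))
      * v k1 * v (k - k1))"

definition is_solution :: "real \<Rightarrow> seq \<Rightarrow> (real \<Rightarrow> seq) \<Rightarrow> bool" where
  "is_solution T v0 v \<longleftrightarrow>
     (\<forall>t\<in>{0..T}. in_Hdot 0 (v t)) \<and>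
     (\<exists>B. \<forall>t\<in>{0..T}. hnorm 0 (v t) \<le> B) \<and>
     (\<forall>t\<in>{0..T}. ((\<lambda>\<tau>. hnorm 0 (v \<tau> - v t)) \<longlongrightarrow> 0) (at t within {0..T})) \<and>
     (\<forall>k\<in>Z0. \<forall>t\<in>{0..T}.
        (\<lambda>\<tau>. kdv_rhs (v \<tau>) k \<tau>) integrable_on {0..t} \<and>
        v t k - v0 k = (1/2) * \<i> * of_int k * integral {0..t} (\<lambda>\<tau>. kdv_rhs (v \<tau>) k \<tau>))"

end

theory Submission
  imports Defs
begin

text \<open>
  In the variables \<open>u k = exp (- \<i> k^3 t) * v k\<close> the oscillating factors disappear, and the difference
  \<open>z\<close> of two solutions solves the linear equation \<open>z' k = - \<i> k^3 z k + (\<i> k / 2) (y * z) k\<close>, where \<open>y\<close> is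
  their sum.

  Galerkin truncations of this equation are \<open>L^2\<close>-stable in both time directions.  The energy flux is a cubic sum over
  \<open>a + b + c = 0\<close>, on which \<open>a^3 + b^3 + c^3 = 3 a b c\<close> never vanishes; dividing by this phase turns the
  flux into the derivative of a small correction plus quartic sums, and the nonresonant part of these,
  where \<open>3 (a + b) (a + c) (a + d)\<close> is large, is removed by a second normal form.  The flux of the
  low modes of a single solution is treated in the same way and shows that the \<open>L^2\<close> norm does not grow,
  so all constants depend only on \<open>M\<close>.

  The form \<open>\<Sum>k. x k * p (- k) / k\<close> is constant along pairs of solutions, so by duality \<open>L^2\<close>
  stability backward in time is stability in \<open>H^(-1)\<close> forward in time.  Interpolation covers the
  exponents in between.

  Started from the truncated initial difference, the Galerkin solutions converge to \<open>z\<close> in \<open>L^2\<close>, because the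
  truncation error is driven by the tails of \<open>v\<close> and \<open>w\<close>, which are uniformly small in time.
\<close>

section \<open>Trilinear kernels\<close>

text \<open>The energy flux loses one derivative, and only l2 norms are available. Dividing by 3abc
  recovers the derivative, but the resulting quartic sums carry a single inverse frequency, and such
  sums are not bounded by l2 norms: one summation is tamed, too many free ones remain. This forces
  the second normal form. Its phase has three factors; each is taken to the power -3/4, which is
  square summable, and the remaining power -1/4 of the phase becomes a small factor, weakened to
  \<open>L powr (-1/8)\<close> so that the cubic step can share it.

  All sums run over a finite frame of frequencies up to N, although the solutions have infinitely
  many. Truncating a convolution makes an error that is small at each frequency but does not decay,
  so it can be summed only if some factor lives on finitely many low modes. Hence the order of
  limits: the low cutoff n is fixed, N tends to infinity, and only then n grows.

  \<open>L\<close> balances the correction against the remainder: large in the stability estimate,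
  where the corrected energy must stay comparable to the energy, and 1 in the mass estimate, where
  the tails supply the smallness.\<close>

definition rho :: "int \<Rightarrow> real" where
  "rho j = (if j = 0 then 0 else real_of_int \<bar>j\<bar> powr (-3/4))"

text \<open>The term at \<open>n = 0\<close> is \<open>0 powr (-3/2) = 0\<close>.\<close>

definition R0 :: real where
  "R0 = 2 * (\<Sum>n. real n powr (-3/2)) + 1"

lemma rho_nonneg [simp]: "0 \<le> rho j"
  by (simp add: rho_def)

lemma rho_minus [simp]: "rho (- j) = rho j"
  by (simp add: rho_def)

lemma R0_ge_1: "1 \<le> R0"
  unfolding R0_def by (simp add: suminf_nonneg summable_real_powr_iff)

text \<open>Absolute value is injective on the nonnegative and on the negative integers, whence the
  factor 2 in \<open>R0\<close>. The summand 1 makes \<open>R0\<close> at least 1, so that its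
  powers may be raised freely.\<close>

lemma sum_rho_sq:
  assumes "finite A"
  shows "(\<Sum>j\<in>A. (rho j)\<^sup>2) \<le> R0"
proof -
  define f where "f n = real n powr (-3/2)" for n :: nat
  have summ: "summable f" unfolding f_def by (simp add: summable_real_powr_iff)
  have fn: "0 \<le> f n" for n by (simp add: f_def)
  have rf: "(rho j)\<^sup>2 = f (nat \<bar>j\<bar>)" for j
    by (auto simp: rho_def f_def power2_eq_square powr_add[symmetric])
  have half: "(\<Sum>j\<in>B. (rho j)\<^sup>2) \<le> suminf f" if "finite B" "inj_on (\<lambda>j. nat \<bar>j\<bar>) B" for B
  proof -
    have "(\<Sum>j\<in>B. (rho j)\<^sup>2) = sum f ((\<lambda>j. nat \<bar>j\<bar>) ` B)"
      using that by (simp add: rf sum.reindex)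
    also have "\<dots> \<le> suminf f"
      using that(1) by (intro sum_le_suminf summ) (auto simp: fn)
    finally show ?thesis .
  qed
  have "(\<Sum>j\<in>A. (rho j)\<^sup>2) = (\<Sum>j\<in>A \<inter> {0..}. (rho j)\<^sup>2) + (\<Sum>j\<in>A \<inter> {..<0}. (rho j)\<^sup>2)"
    using assms by (subst sum.union_disjoint[symmetric]) (auto intro!: sum.cong)
  also have "\<dots> \<le> suminf f + suminf f"
    by (intro add_mono half) (use assms in \<open>auto simp: inj_on_def\<close>)
  also have "\<dots> \<le> R0" by (simp add: R0_def f_def[abs_def])
  finally show ?thesis .
qed

lemma sum_rho_sq_shift:
  assumes "finite A"
  shows "(\<Sum>j\<in>A. (rho (c + j))\<^sup>2) \<le> R0"
proof -
  have "(\<Sum>j\<in>A. (rho (c + j))\<^sup>2) = (\<Sum>j\<in>(+) c ` A. (rho j)\<^sup>2)"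
    by (simp add: sum.reindex)
  also have "\<dots> \<le> R0" by (intro sum_rho_sq) (use assms in auto)
  finally show ?thesis .
qed

lemma sum_mult_le_L2_set: "(\<Sum>i\<in>A. f i * g i) \<le> L2_set f A * L2_set g A"
proof -
  have "(\<Sum>i\<in>A. f i * g i) \<le> (\<Sum>i\<in>A. \<bar>f i\<bar> * \<bar>g i\<bar>)"
    by (intro sum_mono) (metis abs_ge_self abs_mult)
  also have "\<dots> \<le> L2_set f A * L2_set g A" by (rule L2_set_mult_ineq)
  finally show ?thesis .
qed

lemma L2_set_le_if_sum_le:
  assumes "(\<Sum>i\<in>A. (f i)\<^sup>2) \<le> c\<^sup>2" "0 \<le> c"
  shows "L2_set f A \<le> c"
  unfolding L2_set_def using assms by (simp add: real_le_lsqrt)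

lemma L2_set_power2: "(L2_set f A)\<^sup>2 = (\<Sum>i\<in>A. (f i)\<^sup>2)"
  unfolding L2_set_def by (simp add: sum_nonneg)

lemma sum_triple:
  "(\<Sum>(a,b,c)\<in>A\<times>B\<times>C. F a b c) = (\<Sum>a\<in>A. \<Sum>b\<in>B. \<Sum>c\<in>C. F a b c)"
  by (simp add: sum.cartesian_product)

text \<open>Cauchy-Schwarz on the triple sum, with \<open>\<alpha>\<close> grouped with
  \<open>f\<close> and \<open>g\<close>, and \<open>\<beta>\<close> grouped with \<open>h\<close>.
  Each squared group is then summed first over the variables on which only the kernel depends:
  \<open>k3\<close> for \<open>\<alpha>\<close>, the pair \<open>k1\<close>, \<open>k2\<close> for
  \<open>\<beta>\<close>.\<close>

lemma trilinear_kernel_bound: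
  fixes f g h :: "int \<Rightarrow> real" and \<alpha> \<beta> :: "int \<Rightarrow> int \<Rightarrow> int \<Rightarrow> real"
  assumes fin: "finite A"
    and a: "\<And>k1 k2. (\<Sum>k3\<in>A. (\<alpha> k1 k2 k3)\<^sup>2) \<le> R0"
    and b: "\<And>k3. (\<Sum>k1\<in>A. \<Sum>k2\<in>A. (\<beta> k1 k2 k3)\<^sup>2) \<le> R0\<^sup>2"
  shows "(\<Sum>(k1,k2,k3)\<in>A\<times>A\<times>A. \<alpha> k1 k2 k3 * \<beta> k1 k2 k3 * (f k1 * g k2 * h k3))
      \<le> R0\<^sup>2 * (L2_set f A * L2_set g A * L2_set h A)"
proof -
  let ?X = "A \<times> A \<times> A"
  have R: "1 \<le> R0" by (rule R0_ge_1)
  have "(\<Sum>(k1,k2,k3)\<in>?X. \<alpha> k1 k2 k3 * \<beta> k1 k2 k3 * (f k1 * g k2 * h k3))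
     = (\<Sum>q\<in>?X. (case q of (k1,k2,k3) \<Rightarrow> \<alpha> k1 k2 k3 * (f k1 * g k2)) * (case q of (k1,k2,k3) \<Rightarrow> \<beta> k1 k2 k3 * h k3))"
    by (intro sum.cong) auto
  also have "\<dots> \<le> L2_set (\<lambda>(k1,k2,k3). \<alpha> k1 k2 k3 * (f k1 * g k2)) ?X * L2_set (\<lambda>(k1,k2,k3). \<beta> k1 k2 k3 * h k3) ?X"
    by (rule sum_mult_le_L2_set)
  also have "\<dots> \<le> (R0 * (L2_set f A * L2_set g A)) * (R0 * L2_set h A)"
  proof (intro mult_mono L2_set_le_if_sum_le)
    have "(\<Sum>q\<in>?X. (case q of (k1,k2,k3) \<Rightarrow> \<alpha> k1 k2 k3 * (f k1 * g k2))\<^sup>2)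
        = (\<Sum>k1\<in>A. \<Sum>k2\<in>A. (f k1)\<^sup>2 * (g k2)\<^sup>2 * (\<Sum>k3\<in>A. (\<alpha> k1 k2 k3)\<^sup>2))"
      by (simp add: sum_triple[symmetric] sum_distrib_left)
        (auto intro!: sum.cong simp: power_mult_distrib)
    also have "\<dots> \<le> (\<Sum>k1\<in>A. \<Sum>k2\<in>A. (f k1)\<^sup>2 * (g k2)\<^sup>2 * R0)"
      by (intro sum_mono mult_left_mono a) auto
    also have "\<dots> = (\<Sum>k1\<in>A. (f k1)\<^sup>2) * (\<Sum>k2\<in>A. (g k2)\<^sup>2) * R0"
      by (simp add: sum_product flip: sum_distrib_right)
    also have "\<dots> = R0 * (L2_set f A * L2_set g A)\<^sup>2"
      by (simp add: power_mult_distrib L2_set_power2)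
    also have "\<dots> \<le> R0\<^sup>2 * (L2_set f A * L2_set g A)\<^sup>2"
      using R by (intro mult_right_mono) (auto simp: power2_eq_square)
    finally show "(\<Sum>q\<in>?X. (case q of (k1,k2,k3) \<Rightarrow> \<alpha> k1 k2 k3 * (f k1 * g k2))\<^sup>2) \<le> (R0 * (L2_set f A * L2_set g A))\<^sup>2"
      by (simp add: power_mult_distrib)
    have "(\<Sum>q\<in>?X. (case q of (k1,k2,k3) \<Rightarrow> \<beta> k1 k2 k3 * h k3)\<^sup>2)
        = (\<Sum>k1\<in>A. \<Sum>k2\<in>A. \<Sum>k3\<in>A. (h k3)\<^sup>2 * (\<beta> k1 k2 k3)\<^sup>2)"
      by (simp add: sum_triple[symmetric]) (auto intro!: sum.cong simp: power_mult_distrib)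
    also have "\<dots> = (\<Sum>k1\<in>A. \<Sum>k3\<in>A. \<Sum>k2\<in>A. (h k3)\<^sup>2 * (\<beta> k1 k2 k3)\<^sup>2)"
      by (intro sum.cong refl sum.swap)
    also have "\<dots> = (\<Sum>k3\<in>A. (h k3)\<^sup>2 * (\<Sum>k1\<in>A. \<Sum>k2\<in>A. (\<beta> k1 k2 k3)\<^sup>2))"
      by (subst sum.swap) (simp add: sum_distrib_left)
    also have "\<dots> \<le> (\<Sum>k3\<in>A. (h k3)\<^sup>2 * R0\<^sup>2)"
      by (intro sum_mono mult_left_mono b) auto
    also have "\<dots> = (R0 * L2_set h A)\<^sup>2"
      by (simp add: power_mult_distrib L2_set_power2 sum_distrib_left mult_ac)
    finally show "(\<Sum>q\<in>?X. (case q of (k1,k2,k3) \<Rightarrow> \<beta> k1 k2 k3 * h k3)\<^sup>2) \<le> (R0 * L2_set h A)\<^sup>2" .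
  qed (use R in auto)
  finally show ?thesis by (simp add: power2_eq_square mult_ac)
qed

text \<open>Iterated summation: the sum over \<open>k1\<close> is bounded uniformly in
  \<open>k2\<close>, after which \<open>k2\<close> is summed. It supplies the hypothesis on
  \<open>\<beta>\<close> in the trilinear bound.\<close>

lemma sum_rho_rho:
  assumes "finite A"
    and "\<And>k2. (\<Sum>k1\<in>A. (u k1 k2)\<^sup>2) \<le> R0" "(\<Sum>k2\<in>A. (w k2)\<^sup>2) \<le> R0"
  shows "(\<Sum>k1\<in>A. \<Sum>k2\<in>A. (u k1 k2 * w k2)\<^sup>2) \<le> R0\<^sup>2"
proof -
  have "(\<Sum>k1\<in>A. \<Sum>k2\<in>A. (u k1 k2 * w k2)\<^sup>2) = (\<Sum>k2\<in>A. (w k2)\<^sup>2 * (\<Sum>k1\<in>A. (u k1 k2)\<^sup>2))"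
    by (subst sum.swap) (simp add: power_mult_distrib sum_distrib_left mult_ac)
  also have "\<dots> \<le> (\<Sum>k2\<in>A. (w k2)\<^sup>2 * R0)"
    by (intro sum_mono mult_left_mono assms) auto
  also have "\<dots> = (\<Sum>k2\<in>A. (w k2)\<^sup>2) * R0" by (simp add: sum_distrib_right)
  also have "\<dots> \<le> R0 * R0" using R0_ge_1 assms by (intro mult_right_mono) auto
  finally show ?thesis by (simp add: power2_eq_square)
qed

text \<open>The three arguments of \<open>rho\<close> are the factors of the quartic phase when the
  fourth frequency is minus the sum of the other three, so this kernel dominates the inverse of the
  phase.\<close>

lemma kernel_pairwise_sums:
  assumes "finite A"
  shows "(\<Sum>(k1,k2,k3)\<in>A\<times>A\<times>A. rho (k1+k2) * rho (k1+k3) * rho (k2+k3) * (f k1 * g k2 * h k3))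
      \<le> R0\<^sup>2 * (L2_set f A * L2_set g A * L2_set h A)"
proof -
  have "(\<Sum>k1\<in>A. \<Sum>k2\<in>A. (rho (k1+k2) * rho (k2+k3))\<^sup>2) \<le> R0\<^sup>2" for k3
  proof (intro sum_rho_rho assms)
    show "(\<Sum>k1\<in>A. (rho (k1 + k2))\<^sup>2) \<le> R0" for k2
      using sum_rho_sq_shift[OF assms, of k2] by (simp add: add.commute)
    show "(\<Sum>k2\<in>A. (rho (k2 + k3))\<^sup>2) \<le> R0"
      using sum_rho_sq_shift[OF assms, of k3] by (simp add: add.commute)
  qed
  from trilinear_kernel_bound[OF assms, where \<alpha> = "\<lambda>k1 k2 k3. rho (k1+k3)" and \<beta> = "\<lambda>k1 k2 k3. rho (k1+k2) * rho (k2+k3)", OF _ this]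
  show ?thesis using sum_rho_sq_shift[OF assms] by (simp add: mult_ac)
qed

text \<open>This kernel arises when a derivative cancels one factor of the phase and an inverse
  frequency takes its place, as in \<open>derivative_weight_le\<close>.\<close>

lemma kernel_star:
  assumes "finite A"
  shows "(\<Sum>(k1,k2,k3)\<in>A\<times>A\<times>A. rho k1 * rho (k1+k2) * rho (k1+k3) * (f k1 * g k2 * h k3))
      \<le> R0\<^sup>2 * (L2_set f A * L2_set g A * L2_set h A)"
proof -
  have "(\<Sum>k2\<in>A. \<Sum>k1\<in>A. (rho (k1+k2) * rho k1)\<^sup>2) \<le> R0\<^sup>2"
    using sum_rho_sq_shift[OF assms] sum_rho_sq[OF assms] by (intro sum_rho_rho assms) simp_all
  then have "(\<Sum>k1\<in>A. \<Sum>k2\<in>A. (rho k1 * rho (k1+k2))\<^sup>2) \<le> R0\<^sup>2"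
    by (subst sum.swap) (simp add: mult.commute)
  from trilinear_kernel_bound[OF assms, where \<alpha> = "\<lambda>k1 k2 k3. rho (k1+k3)" and \<beta> = "\<lambda>k1 k2 k3. rho k1 * rho (k1+k2)", OF _ this]
  have "(\<Sum>(k1,k2,k3)\<in>A\<times>A\<times>A. rho (k1+k3) * (rho k1 * rho (k1+k2)) * (f k1 * g k2 * h k3))
      \<le> R0\<^sup>2 * (L2_set f A * L2_set g A * L2_set h A)"
    using sum_rho_sq_shift[OF assms] by simp
  then show ?thesis by (simp only: mult_ac)
qed

section \<open>Resonant quartic sums\<close>

definition zero_triples :: "int set \<Rightarrow> (int \<times> int \<times> int) set" where
  "zero_triples A = {(a,b,c). a \<in> A \<and> b \<in> A \<and> c \<in> A \<and> a + b + c = 0}"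

definition zero_quads :: "int set \<Rightarrow> (int \<times> int \<times> int \<times> int) set" where
  "zero_quads A = {(a,b,c,d). a \<in> A \<and> b \<in> A \<and> c \<in> A \<and> d \<in> A \<and> a + b + c + d = 0}"

text \<open>The frequency with which a quartic monomial oscillates under the linear flow.\<close>

definition Psi :: "int \<times> int \<times> int \<times> int \<Rightarrow> int" where
  "Psi = (\<lambda>(a,b,c,d). a^3 + b^3 + c^3 + d^3)"

definition inv_abs :: "int \<Rightarrow> real" where
  "inv_abs k = 1 / real_of_int \<bar>k\<bar>"

text \<open>The size of the quartic multipliers left by the cubic step, whose coefficients 1/b and
  k/(b c) with k = - b - c are controlled by inverse frequencies. The sum over all four is
  symmetric, so quadruples may be permuted.\<close>

definition wt :: "int \<times> int \<times> int \<times> int \<Rightarrow> real" where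
  "wt = (\<lambda>(a,b,c,d). inv_abs a + inv_abs b + inv_abs c + inv_abs d)"

lemma inv_abs_nonneg [simp]: "0 \<le> inv_abs k" by (simp add: inv_abs_def)

lemma inv_abs_le_1: "k \<noteq> 0 \<Longrightarrow> inv_abs k \<le> 1"
  by (simp add: inv_abs_def)

lemma wt_nonneg [simp]: "0 \<le> wt q"
  by (simp add: wt_def split: prod.split)

lemma rho_le_1: "rho j \<le> 1"
proof (cases "j = 0")
  case False
  then have "real_of_int \<bar>j\<bar> powr (-3/4) \<le> real_of_int \<bar>j\<bar> powr 0"
    by (intro powr_mono) auto
  with False show ?thesis by (simp add: rho_def)
qed (simp add: rho_def)

lemma inv_abs_le_rho: "inv_abs j \<le> rho j"
proof (cases "j = 0")
  case False
  then have "real_of_int \<bar>j\<bar> powr (-1) \<le> real_of_int \<bar>j\<bar> powr (-3/4)"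
    by (intro powr_mono) auto
  with False show ?thesis by (simp add: rho_def inv_abs_def powr_minus_divide)
qed (simp add: rho_def inv_abs_def)

text \<open>The two forms agree because a + d = - (b + c). The first singles out one variable; the
  second involves three free variables only and shows which pairs cancel at a resonance.\<close>

lemma Psi_factor:
  assumes "a + b + c + d = 0"
  shows "Psi (a,b,c,d) = 3 * ((a+b) * (a+c) * (a+d))"
    and "Psi (a,b,c,d) = - (3 * ((a+b) * (a+c) * (b+c)))"
proof -
  have d: "d = - a - b - c" using assms by simp
  show "Psi (a,b,c,d) = 3 * ((a+b) * (a+c) * (a+d))"
    unfolding Psi_def d by (simp add: power3_eq_cube algebra_simps)
  show "Psi (a,b,c,d) = - (3 * ((a+b) * (a+c) * (b+c)))"
    unfolding Psi_def d by (simp add: power3_eq_cube algebra_simps)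
qed

text \<open>The exponent -1 is split into -1/4 and -3/4: the first part pays for the gain in
  \<open>L\<close>, the second produces the three weights. The gain is weakened from -1/4 to -1/8 to
  agree with \<open>cubic_weight_le\<close>.\<close>

lemma inverse_le_rho3:
  fixes x y z :: int
  assumes "x \<noteq> 0" "y \<noteq> 0" "z \<noteq> 0" "1 \<le> L" "L \<le> real_of_int \<bar>3 * (x * y * z)\<bar>"
  shows "1 / real_of_int \<bar>3 * (x * y * z)\<bar> \<le> L powr (-1/8) * (rho x * rho y * rho z)"
proof -
  define w where "w = real_of_int \<bar>x * y * z\<bar>"
  have w1: "1 \<le> w" using assms unfolding w_def of_int_1_le_iff by (simp add: int_one_le_iff_zero_less)
  have w3: "real_of_int \<bar>3 * (x * y * z)\<bar> = 3 * w" by (simp add: w_def abs_mult)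
  have "1 / (3 * w) = (3 * w) powr (-1)" using w1 by (simp add: powr_minus_divide)
  also have "\<dots> = (3 * w) powr (-1/4) * (3 * w) powr (-3/4)" by (simp add: powr_add[symmetric])
  also have "\<dots> \<le> L powr (-1/8) * w powr (-3/4)"
  proof (intro mult_mono)
    have "(3 * w) powr (-1/4) \<le> L powr (-1/4)"
      using assms w3 by (intro powr_mono2') auto
    also have "\<dots> \<le> L powr (-1/8)" using assms by (intro powr_mono) auto
    finally show "(3 * w) powr (-1/4) \<le> L powr (-1/8)" .
    show "(3 * w) powr (-3/4) \<le> w powr (-3/4)" using w1 by (intro powr_mono2') auto
  qed auto
  also have "w powr (-3/4) = rho x * rho y * rho z"
    using assms by (simp add: w_def rho_def abs_mult powr_mult)
  finally show ?thesis unfolding w3 .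
qed

lemma finite_zero_quads: "finite A \<Longrightarrow> finite (zero_quads A)"
  by (rule finite_subset[of _ "A\<times>A\<times>A\<times>A"]) (auto simp: zero_quads_def)

lemma finite_zero_triples: "finite A \<Longrightarrow> finite (zero_triples A)"
  by (rule finite_subset[of _ "A\<times>A\<times>A"]) (auto simp: zero_triples_def)

lemma sum_zero_quads_le:
  assumes "finite A" "\<And>a b c. 0 \<le> F a b c"
  shows "(\<Sum>(a,b,c,d)\<in>zero_quads A. F a b c) \<le> (\<Sum>(a,b,c)\<in>A\<times>A\<times>A. (F a b c :: real))"
proof -
  have "(\<Sum>(a,b,c,d)\<in>zero_quads A. F a b c) = (\<Sum>(a,b,c)\<in>(\<lambda>(a,b,c,d). (a,b,c)) ` zero_quads A. F a b c)"
    by (subst sum.reindex) (auto simp: inj_on_def zero_quads_def case_prod_unfold)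
  also have "\<dots> \<le> (\<Sum>(a,b,c)\<in>A\<times>A\<times>A. F a b c)"
    using assms by (intro sum_mono2) (auto simp: zero_quads_def)
  finally show ?thesis .
qed

lemma sum_zero_triples_le:
  assumes "finite A" "\<And>a b. 0 \<le> F a b"
  shows "(\<Sum>(a,b,c)\<in>zero_triples A. F a b) \<le> (\<Sum>a\<in>A. \<Sum>b\<in>A. (F a b :: real))"
proof -
  have "(\<Sum>(a,b,c)\<in>zero_triples A. F a b) = (\<Sum>(a,b)\<in>(\<lambda>(a,b,c). (a,b)) ` zero_triples A. F a b)"
    by (subst sum.reindex) (auto simp: inj_on_def zero_triples_def case_prod_unfold)
  also have "\<dots> \<le> (\<Sum>(a,b)\<in>A\<times>A. F a b)"
    using assms by (intro sum_mono2) (auto simp: zero_triples_def)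
  also have "\<dots> = (\<Sum>a\<in>A. \<Sum>b\<in>A. F a b)" by (simp add: sum.cartesian_product)
  finally show ?thesis .
qed

lemma L2_set_ge_elem: "finite A \<Longrightarrow> k \<in> A \<Longrightarrow> f k \<le> L2_set f A"
proof -
  assume "finite A" "k \<in> A"
  then have "L2_set f {k} \<le> L2_set f A"
    unfolding L2_set_def by (intro real_sqrt_le_mono sum_mono2) auto
  then show ?thesis by simp
qed

lemma L2_set_reflect:
  assumes "uminus ` A = (A :: int set)"
  shows "L2_set (\<lambda>k. f (- k)) A = L2_set f A"
proof -
  have "(\<Sum>k\<in>A. (f (- k))\<^sup>2) = (\<Sum>k\<in>uminus ` A. (f k)\<^sup>2)" by (simp add: sum.reindex)
  then show ?thesis by (simp add: L2_set_def assms)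
qed

lemma pair_reflect_le:
  assumes "uminus ` A = (A :: int set)"
  shows "(\<Sum>a\<in>A. f a * g (- a)) \<le> L2_set f A * L2_set g A"
  using sum_mult_le_L2_set[of f "\<lambda>a. g (- a)" A] L2_set_reflect[OF assms] by simp

section \<open>Quartic sums over a finite symmetric set of frequencies, sorted by the size of the
  phase\<close>

locale freq_set =
  fixes A :: "int set"
  assumes finite_A: "finite A" and zero_A: "0 \<notin> A" and sym_A: "uminus ` A = A"
begin

lemma uminus_A: "a \<in> A \<Longrightarrow> - a \<in> A"
  using sym_A by blast

context
  fixes f g h u :: "int \<Rightarrow> real"
  assumes nn: "\<And>k. 0 \<le> f k" "\<And>k. 0 \<le> g k" "\<And>k. 0 \<le> h k" "\<And>k. 0 \<le> u k"
begin

text \<open>If a + b = 0 then also c + d = 0, so the sum is a product of two bilinear pairings, each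
  bounded by Cauchy-Schwarz without any weight.\<close>

lemma resonant_12:
  "(\<Sum>(a,b,c,d)\<in>{q\<in>zero_quads A. fst q + fst (snd q) = 0}. f a * g b * h c * u d)
     \<le> L2_set f A * L2_set g A * L2_set h A * L2_set u A"
proof -
  have "(\<Sum>(a,b,c,d)\<in>{q\<in>zero_quads A. fst q + fst (snd q) = 0}. f a * g b * h c * u d)
      = (\<Sum>(a,c)\<in>A\<times>A. (f a * g (- a)) * (h c * u (- c)))"
    by (rule sum.reindex_bij_witness[of _ "\<lambda>(a,c). (a,-a,c,-c)" "\<lambda>(a,b,c,d). (a,c)"])
      (auto simp: zero_quads_def uminus_A add_eq_0_iff2 mult.assoc add_eq_0_iff)
  also have "\<dots> = (\<Sum>a\<in>A. f a * g (- a)) * (\<Sum>c\<in>A. h c * u (- c))"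
    by (simp add: sum_product sum.cartesian_product)
  also have "\<dots> \<le> (L2_set f A * L2_set g A) * (L2_set h A * L2_set u A)"
    by (intro mult_mono pair_reflect_le sym_A sum_nonneg) (simp_all add: nn)
  finally show ?thesis by (simp add: mult_ac)
qed

end

lemma resonant_13:
  assumes nn: "\<And>k. 0 \<le> f k" "\<And>k. 0 \<le> g k" "\<And>k. 0 \<le> h k" "\<And>k. 0 \<le> u k"
  shows "(\<Sum>(a,b,c,d)\<in>{q\<in>zero_quads A. fst q + fst (snd (snd q)) = 0}. f a * g b * h c * u d)
     \<le> L2_set f A * L2_set g A * L2_set h A * L2_set u A"
proof -
  have "(\<Sum>(a,b,c,d)\<in>{q\<in>zero_quads A. fst q + fst (snd (snd q)) = 0}. f a * g b * h c * u d)
    = (\<Sum>(a,b,c,d)\<in>{q\<in>zero_quads A. fst q + fst (snd q) = 0}. f a * h b * g c * u d)"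
    by (rule sum.reindex_bij_witness[of _ "\<lambda>(a,b,c,d). (a,c,b,d)" "\<lambda>(a,b,c,d). (a,c,b,d)"])
      (auto simp: zero_quads_def)
  also have "\<dots> \<le> L2_set f A * L2_set h A * L2_set g A * L2_set u A"
    by (rule resonant_12) (auto simp: nn)
  finally show ?thesis by (simp add: mult_ac)
qed

lemma resonant_23:
  assumes nn: "\<And>k. 0 \<le> f k" "\<And>k. 0 \<le> g k" "\<And>k. 0 \<le> h k" "\<And>k. 0 \<le> u k"
  shows "(\<Sum>(a,b,c,d)\<in>{q\<in>zero_quads A. fst (snd q) + fst (snd (snd q)) = 0}. f a * g b * h c * u d)
     \<le> L2_set f A * L2_set g A * L2_set h A * L2_set u A"
proof -
  have "(\<Sum>(a,b,c,d)\<in>{q\<in>zero_quads A. fst (snd q) + fst (snd (snd q)) = 0}. f a * g b * h c * u d)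
    = (\<Sum>(a,b,c,d)\<in>{q\<in>zero_quads A. fst q + fst (snd q) = 0}. h a * g b * f c * u d)"
    by (rule sum.reindex_bij_witness[of _ "\<lambda>(a,b,c,d). (c,b,a,d)" "\<lambda>(a,b,c,d). (c,b,a,d)"])
      (auto simp: zero_quads_def)
  also have "\<dots> \<le> L2_set h A * L2_set g A * L2_set f A * L2_set u A"
    by (rule resonant_12) (auto simp: nn)
  finally show ?thesis by (simp add: mult_ac)
qed

text \<open>A vanishing phase forces a + b, a + c or b + c to vanish, so three decoupled sets cover
  the resonances. Overlaps do no harm since all terms are nonnegative.\<close>

lemma resonant_sum:
  assumes nn: "\<And>k. 0 \<le> f k" "\<And>k. 0 \<le> g k" "\<And>k. 0 \<le> h k" "\<And>k. 0 \<le> u k"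
  shows "(\<Sum>(a,b,c,d)\<in>{q\<in>zero_quads A. Psi q = 0}. f a * g b * h c * u d)
     \<le> 3 * (L2_set f A * L2_set g A * L2_set h A * L2_set u A)"
proof -
  let ?F = "\<lambda>(a,b,c,d). f a * g b * h c * u d"
  let ?X = "{q\<in>zero_quads A. fst q + fst (snd q) = 0}"
  let ?Y = "{q\<in>zero_quads A. fst q + fst (snd (snd q)) = 0}"
  let ?W = "{q\<in>zero_quads A. fst (snd q) + fst (snd (snd q)) = 0}"
  have fin: "finite (zero_quads A)" by (rule finite_zero_quads[OF finite_A])
  have F0: "0 \<le> ?F q" for q by (auto simp: nn split: prod.split)
  have "sum ?F {q\<in>zero_quads A. Psi q = 0} \<le> sum ?F (?X \<union> ?Y \<union> ?W)"
    using fin F0 by (intro sum_mono2) (auto simp: zero_quads_def Psi_factor(2))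
  also have "\<dots> \<le> sum ?F ?X + sum ?F ?Y + sum ?F ?W"
  proof -
    have un: "sum ?F (U \<union> V) \<le> sum ?F U + sum ?F V" if "finite U" "finite V" for U V
      using sum.union_inter[OF that, of ?F] sum_nonneg[of "U \<inter> V" ?F] F0 by (smt (verit))
    have "sum ?F (?X \<union> ?Y \<union> ?W) \<le> sum ?F (?X \<union> ?Y) + sum ?F ?W"
      using fin by (intro un) auto
    moreover have "sum ?F (?X \<union> ?Y) \<le> sum ?F ?X + sum ?F ?Y"
      using fin by (intro un) auto
    ultimately show ?thesis by linarith
  qed
  also have "\<dots> \<le> 3 * (L2_set f A * L2_set g A * L2_set h A * L2_set u A)"
    using resonant_12[of f g h u, OF nn] resonant_13[of f g h u, OF nn] resonant_23[of f g h u, OF nn] by linarith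
  finally show ?thesis .
qed

lemma inverse_Psi_le:
  assumes "(a,b,c,d) \<in> zero_quads A" "Psi (a,b,c,d) \<noteq> 0" "1 \<le> L" "L \<le> real_of_int \<bar>Psi (a,b,c,d)\<bar>"
  shows "1 / real_of_int \<bar>Psi (a,b,c,d)\<bar> \<le> L powr (-1/8) * (rho (a+b) * rho (a+c) * rho (b+c))"
proof -
  have s: "a + b + c + d = 0" using assms by (auto simp: zero_quads_def)
  have P: "\<bar>Psi (a,b,c,d)\<bar> = \<bar>3 * ((a+b) * (a+c) * (b+c))\<bar>"
    unfolding Psi_factor(2)[OF s] by simp
  have "(a+b) \<noteq> 0" "(a+c) \<noteq> 0" "(b+c) \<noteq> 0" using assms(2) Psi_factor(2)[OF s] by auto
  from inverse_le_rho3[OF this assms(3)] assms(4) show ?thesis unfolding P by blast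
qed

lemma Psi_ge_1: "Psi q \<noteq> 0 \<Longrightarrow> 1 \<le> real_of_int \<bar>Psi q\<bar>"
  by linarith

lemma pairwise_quads_sum:
  assumes nn: "\<And>k. 0 \<le> f k" "\<And>k. 0 \<le> g k" "\<And>k. 0 \<le> h k"
  shows "(\<Sum>(a,b,c,d)\<in>zero_quads A. rho (a+b) * rho (a+c) * rho (b+c) * (f a * g b * h c))
     \<le> R0\<^sup>2 * (L2_set f A * L2_set g A * L2_set h A)"
  by (rule order_trans[OF sum_zero_quads_le kernel_pairwise_sums])
    (auto simp: finite_A nn)

lemma star_quads_sum:
  assumes nn: "\<And>k. 0 \<le> f k" "\<And>k. 0 \<le> g k" "\<And>k. 0 \<le> h k"
  shows "(\<Sum>(a,b,c,d)\<in>zero_quads A. rho a * rho (a+b) * rho (a+c) * (f a * g b * h c))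
     \<le> R0\<^sup>2 * (L2_set f A * L2_set g A * L2_set h A)"
  by (rule order_trans[OF sum_zero_quads_le kernel_star])
    (auto simp: finite_A nn)

text \<open>The fourth frequency is determined by the others, so its factor is replaced by its
  maximum, which the l2 norm dominates.\<close>

lemma pairwise_quads_sum4:
  assumes nn: "\<And>k. 0 \<le> f k" "\<And>k. 0 \<le> g k" "\<And>k. 0 \<le> h k" "\<And>k. 0 \<le> u k"
  shows "(\<Sum>(a,b,c,d)\<in>zero_quads A. rho (a+b) * rho (a+c) * rho (b+c) * (f a * g b * h c * u d))
     \<le> R0\<^sup>2 * (L2_set f A * L2_set g A * L2_set h A * L2_set u A)"
proof -
  have "(\<Sum>(a,b,c,d)\<in>zero_quads A. rho (a+b) * rho (a+c) * rho (b+c) * (f a * g b * h c * u d))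
    \<le> (\<Sum>(a,b,c,d)\<in>zero_quads A. rho (a+b) * rho (a+c) * rho (b+c) * (f a * g b * h c * L2_set u A))"
    by (intro sum_mono) (auto simp: zero_quads_def nn intro!: mult_left_mono L2_set_ge_elem finite_A)
  also have "\<dots> = (\<Sum>(a,b,c,d)\<in>zero_quads A. rho (a+b) * rho (a+c) * rho (b+c) * (f a * g b * h c)) * L2_set u A"
    by (simp add: sum_distrib_right case_prod_unfold mult.assoc)
  also have "\<dots> \<le> R0\<^sup>2 * (L2_set f A * L2_set g A * L2_set h A) * L2_set u A"
    by (intro mult_right_mono pairwise_quads_sum nn) auto
  finally show ?thesis by (simp add: mult_ac)
qed

text \<open>Where the phase is nonzero and at most \<open>L\<close>, 1 is at most L / |Psi|. This
  brings in the summable kernel at the price of a factor \<open>L\<close>, in place of a count of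
  nearly resonant quadruples.\<close>

lemma low_Psi_sum:
  assumes nn: "\<And>k. 0 \<le> f k" "\<And>k. 0 \<le> g k" "\<And>k. 0 \<le> h k" "\<And>k. 0 \<le> u k" and L: "1 \<le> L"
  shows "(\<Sum>(a,b,c,d)\<in>{q\<in>zero_quads A. Psi q \<noteq> 0 \<and> real_of_int \<bar>Psi q\<bar> \<le> L}. f a * g b * h c * u d)
     \<le> L * R0\<^sup>2 * (L2_set f A * L2_set g A * L2_set h A * L2_set u A)"
proof -
  have fin: "finite (zero_quads A)" by (rule finite_zero_quads[OF finite_A])
  have "(\<Sum>(a,b,c,d)\<in>{q\<in>zero_quads A. Psi q \<noteq> 0 \<and> real_of_int \<bar>Psi q\<bar> \<le> L}. f a * g b * h c * u d)
     \<le> (\<Sum>(a,b,c,d)\<in>{q\<in>zero_quads A. Psi q \<noteq> 0 \<and> real_of_int \<bar>Psi q\<bar> \<le> L}. L * (rho (a+b) * rho (a+c) * rho (b+c) * (f a * g b * h c * u d)))"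
  proof (intro sum_mono, clarify)
    fix a b c d assume q: "(a,b,c,d) \<in> zero_quads A" and P: "Psi (a,b,c,d) \<noteq> 0" "real_of_int \<bar>Psi (a,b,c,d)\<bar> \<le> L"
    have "1 \<le> L * (1 / real_of_int \<bar>Psi (a,b,c,d)\<bar>)" using P by (simp add: field_simps)
    also have "\<dots> \<le> L * (1 powr (-1/8) * (rho (a+b) * rho (a+c) * rho (b+c)))"
      using L P Psi_ge_1[OF P(1)] q by (intro mult_left_mono inverse_Psi_le) auto
    finally have "1 \<le> L * (rho (a+b) * rho (a+c) * rho (b+c))" by simp
    then have "1 * (f a * g b * h c * u d) \<le> L * (rho (a+b) * rho (a+c) * rho (b+c)) * (f a * g b * h c * u d)"
      by (intro mult_right_mono) (auto simp: nn)
    then show "f a * g b * h c * u d \<le> L * (rho (a+b) * rho (a+c) * rho (b+c) * (f a * g b * h c * u d))"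
      by (simp add: mult_ac)
  qed
  also have "\<dots> \<le> (\<Sum>(a,b,c,d)\<in>zero_quads A. L * (rho (a+b) * rho (a+c) * rho (b+c) * (f a * g b * h c * u d)))"
    using fin L by (intro sum_mono2) (auto simp: nn)
  also have "\<dots> = L * (\<Sum>(a,b,c,d)\<in>zero_quads A. rho (a+b) * rho (a+c) * rho (b+c) * (f a * g b * h c * u d))"
    by (simp add: sum_distrib_left case_prod_unfold)
  also have "\<dots> \<le> L * (R0\<^sup>2 * (L2_set f A * L2_set g A * L2_set h A * L2_set u A))"
    using L by (intro mult_left_mono pairwise_quads_sum4 nn) auto
  finally show ?thesis by (simp add: mult_ac)
qed

lemma high_Psi_sum:
  assumes nn: "\<And>k. 0 \<le> f k" "\<And>k. 0 \<le> g k" "\<And>k. 0 \<le> h k" "\<And>k. 0 \<le> u k" and L: "1 \<le> L"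
  shows "(\<Sum>(a,b,c,d)\<in>{q\<in>zero_quads A. L < real_of_int \<bar>Psi q\<bar>}. f a * g b * h c * u d / real_of_int \<bar>Psi (a,b,c,d)\<bar>)
     \<le> L powr (-1/8) * R0\<^sup>2 * (L2_set f A * L2_set g A * L2_set h A * L2_set u A)"
proof -
  have fin: "finite (zero_quads A)" by (rule finite_zero_quads[OF finite_A])
  let ?l = "L powr (-1/8)"
  have "(\<Sum>(a,b,c,d)\<in>{q\<in>zero_quads A. L < real_of_int \<bar>Psi q\<bar>}. f a * g b * h c * u d / real_of_int \<bar>Psi (a,b,c,d)\<bar>)
     \<le> (\<Sum>(a,b,c,d)\<in>{q\<in>zero_quads A. L < real_of_int \<bar>Psi q\<bar>}. ?l * (rho (a+b) * rho (a+c) * rho (b+c) * (f a * g b * h c * u d)))"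
  proof (intro sum_mono, clarify)
    fix a b c d assume q: "(a,b,c,d) \<in> zero_quads A" and P: "L < real_of_int \<bar>Psi (a,b,c,d)\<bar>"
    have "1 / real_of_int \<bar>Psi (a,b,c,d)\<bar> \<le> ?l * (rho (a+b) * rho (a+c) * rho (b+c))"
      using L P q by (intro inverse_Psi_le) auto
    then have "(1 / real_of_int \<bar>Psi (a,b,c,d)\<bar>) * (f a * g b * h c * u d) \<le> ?l * (rho (a+b) * rho (a+c) * rho (b+c)) * (f a * g b * h c * u d)"
      by (intro mult_right_mono) (auto simp: nn)
    then show "f a * g b * h c * u d / real_of_int \<bar>Psi (a,b,c,d)\<bar> \<le> ?l * (rho (a+b) * rho (a+c) * rho (b+c) * (f a * g b * h c * u d))"
      by (simp add: mult_ac)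
  qed
  also have "\<dots> \<le> (\<Sum>(a,b,c,d)\<in>zero_quads A. ?l * (rho (a+b) * rho (a+c) * rho (b+c) * (f a * g b * h c * u d)))"
    using fin L by (intro sum_mono2) (auto simp: nn)
  also have "\<dots> = ?l * (\<Sum>(a,b,c,d)\<in>zero_quads A. rho (a+b) * rho (a+c) * rho (b+c) * (f a * g b * h c * u d))"
    by (simp add: sum_distrib_left case_prod_unfold)
  also have "\<dots> \<le> ?l * (R0\<^sup>2 * (L2_set f A * L2_set g A * L2_set h A * L2_set u A))"
    using L by (intro mult_left_mono pairwise_quads_sum4 nn) auto
  finally show ?thesis by (simp add: mult_ac)
qed

text \<open>Differentiating a quartic term in time costs a factor |d|. Against an inverse frequency
  1/|x| one uses |d| <= |x| + |x + d|: the first part cancels 1/|x|, the second cancels the factor x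
  + d of the phase and leaves the star kernel at x. The inverse of d itself cancels |d| outright.
  Hence one star kernel for each of a, b, c and four copies of the pairwise kernel.\<close>

lemma derivative_weight_le:
  assumes q: "(a,b,c,d) \<in> zero_quads A" and P: "Psi (a,b,c,d) \<noteq> 0"
  shows "wt (a,b,c,d) * real_of_int \<bar>d\<bar> / real_of_int \<bar>Psi (a,b,c,d)\<bar>
     \<le> 4 * (rho (a+b) * rho (a+c) * rho (b+c)) + rho a * rho (a+b) * rho (a+c)
        + rho b * rho (b+a) * rho (b+c) + rho c * rho (c+a) * rho (c+b)"
proof -
  have s: "a + b + c + d = 0" and nz: "a \<noteq> 0" "b \<noteq> 0" "c \<noteq> 0" "d \<noteq> 0"
    using q zero_A by (auto simp: zero_quads_def)
  let ?P = "real_of_int \<bar>Psi (a,b,c,d)\<bar>"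
  have pw: "1 / ?P \<le> rho (a+b) * rho (a+c) * rho (b+c)"
    using inverse_Psi_le[OF q P, of 1] Psi_ge_1[OF P] by simp
  have P0: "0 < ?P" using P by simp
  have star: "inv_abs x * real_of_int \<bar>d\<bar> / ?P \<le> 1 / ?P + rho x * rho (x+y) * rho (x+z)"
    if "x \<noteq> 0" and s': "x + y + z + d = 0" and Pe: "Psi (a,b,c,d) = 3 * ((x+y) * (x+z) * (x+d))" for x y z
  proof -
    have nz': "x + y \<noteq> 0" "x + z \<noteq> 0" "x + d \<noteq> 0" using P Pe by auto
    have "real_of_int \<bar>d\<bar> \<le> real_of_int \<bar>x\<bar> + real_of_int \<bar>x+d\<bar>" by linarith
    then have "inv_abs x * real_of_int \<bar>d\<bar> \<le> inv_abs x * (real_of_int \<bar>x\<bar> + real_of_int \<bar>x+d\<bar>)"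
      by (intro mult_left_mono) auto
    also have "\<dots> = 1 + inv_abs x * real_of_int \<bar>x+d\<bar>" using that by (simp add: inv_abs_def field_simps)
    finally have "inv_abs x * real_of_int \<bar>d\<bar> / ?P \<le> 1 / ?P + inv_abs x * real_of_int \<bar>x+d\<bar> / ?P"
      using P0 by (simp add: divide_right_mono add_divide_distrib[symmetric])
    moreover have "inv_abs x * real_of_int \<bar>x+d\<bar> / ?P \<le> inv_abs x * inv_abs (x+y) * inv_abs (x+z)"
    proof -
      have "?P = 3 * (real_of_int \<bar>x+y\<bar> * real_of_int \<bar>x+z\<bar> * real_of_int \<bar>x+d\<bar>)"
        unfolding Pe by (simp only: abs_mult of_int_mult)
      then have "inv_abs x * real_of_int \<bar>x+d\<bar> / ?P = inv_abs x * inv_abs (x+y) * inv_abs (x+z) / 3"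
        using nz' by (simp add: inv_abs_def)
      also have "\<dots> \<le> inv_abs x * inv_abs (x+y) * inv_abs (x+z)" by simp
      finally show ?thesis .
    qed
    moreover have "inv_abs x * inv_abs (x+y) * inv_abs (x+z) \<le> rho x * rho (x+y) * rho (x+z)"
      by (intro mult_mono inv_abs_le_rho) auto
    ultimately show ?thesis by linarith
  qed
  have "wt (a,b,c,d) * real_of_int \<bar>d\<bar> / ?P = inv_abs a * real_of_int \<bar>d\<bar> / ?P + inv_abs b * real_of_int \<bar>d\<bar> / ?P
      + inv_abs c * real_of_int \<bar>d\<bar> / ?P + inv_abs d * real_of_int \<bar>d\<bar> / ?P"
    by (simp add: wt_def add_divide_distrib distrib_right)
  also have "inv_abs d * real_of_int \<bar>d\<bar> = 1" using nz by (simp add: inv_abs_def)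
  also have "inv_abs a * real_of_int \<bar>d\<bar> / ?P \<le> 1 / ?P + rho a * rho (a+b) * rho (a+c)"
    using nz s by (intro star Psi_factor) auto
  also have "inv_abs b * real_of_int \<bar>d\<bar> / ?P \<le> 1 / ?P + rho b * rho (b+a) * rho (b+c)"
  proof (intro star)
    show "Psi (a,b,c,d) = 3 * ((b + a) * (b + c) * (b + d))"
      using Psi_factor(1)[of b a c d] s by (simp add: Psi_def)
  qed (use nz s in auto)
  also have "inv_abs c * real_of_int \<bar>d\<bar> / ?P \<le> 1 / ?P + rho c * rho (c+a) * rho (c+b)"
  proof (intro star)
    show "Psi (a,b,c,d) = 3 * ((c + a) * (c + b) * (c + d))"
      using Psi_factor(1)[of c a b d] s by (simp add: Psi_def)
  qed (use nz s in auto)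
  finally show ?thesis using pw by linarith
qed

text \<open>Only three functions occur: the slot with the derivative will be filled by a forcing
  term, which is bounded in the supremum norm only. The constant 7 = 4 + 3 counts the
  kernels.\<close>

lemma derivative_sum4:
  assumes nn: "\<And>k. 0 \<le> f k" "\<And>k. 0 \<le> g k" "\<And>k. 0 \<le> h k"
  shows "(\<Sum>(a,b,c,d)\<in>zero_quads A. wt (a,b,c,d) * real_of_int \<bar>d\<bar> / real_of_int \<bar>Psi (a,b,c,d)\<bar> * (f a * g b * h c))
     \<le> 7 * R0\<^sup>2 * (L2_set f A * L2_set g A * L2_set h A)"
proof -
  let ?Q = "zero_quads A"
  let ?N = "R0\<^sup>2 * (L2_set f A * L2_set g A * L2_set h A)"
  have "(\<Sum>(a,b,c,d)\<in>?Q. wt (a,b,c,d) * real_of_int \<bar>d\<bar> / real_of_int \<bar>Psi (a,b,c,d)\<bar> * (f a * g b * h c))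
     \<le> (\<Sum>(a,b,c,d)\<in>?Q. (4 * (rho (a+b) * rho (a+c) * rho (b+c)) + rho a * rho (a+b) * rho (a+c)
        + rho b * rho (b+a) * rho (b+c) + rho c * rho (c+a) * rho (c+b)) * (f a * g b * h c))"
  proof (intro sum_mono, clarify)
    fix a b c d assume q: "(a,b,c,d) \<in> ?Q"
    show "wt (a,b,c,d) * real_of_int \<bar>d\<bar> / real_of_int \<bar>Psi (a,b,c,d)\<bar> * (f a * g b * h c)
      \<le> (4 * (rho (a+b) * rho (a+c) * rho (b+c)) + rho a * rho (a+b) * rho (a+c)
        + rho b * rho (b+a) * rho (b+c) + rho c * rho (c+a) * rho (c+b)) * (f a * g b * h c)"
    proof (cases "Psi (a,b,c,d) = 0")
      case True
      \<comment> \<open>Resonant quadruples contribute nothing on the left, because division by zero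
        yields 0.\<close>
      then show ?thesis by (simp add: nn)
    next
      case False
      then show ?thesis using derivative_weight_le[OF q] by (intro mult_right_mono) (auto simp: nn)
    qed
  qed
  also have "\<dots> = 4 * (\<Sum>(a,b,c,d)\<in>?Q. rho (a+b) * rho (a+c) * rho (b+c) * (f a * g b * h c))
     + (\<Sum>(a,b,c,d)\<in>?Q. rho a * rho (a+b) * rho (a+c) * (f a * g b * h c))
     + (\<Sum>(a,b,c,d)\<in>?Q. rho b * rho (b+a) * rho (b+c) * (f a * g b * h c))
     + (\<Sum>(a,b,c,d)\<in>?Q. rho c * rho (c+a) * rho (c+b) * (f a * g b * h c))"
    by (simp add: sum.distrib[symmetric] sum_distrib_left case_prod_unfold algebra_simps)
  also have "(\<Sum>(a,b,c,d)\<in>?Q. rho b * rho (b+a) * rho (b+c) * (f a * g b * h c))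
     = (\<Sum>(a,b,c,d)\<in>?Q. rho a * rho (a+b) * rho (a+c) * (g a * f b * h c))"
    by (rule sum.reindex_bij_witness[of _ "\<lambda>(a,b,c,d). (b,a,c,d)" "\<lambda>(a,b,c,d). (b,a,c,d)"])
      (auto simp: zero_quads_def)
  also have "(\<Sum>(a,b,c,d)\<in>?Q. rho c * rho (c+a) * rho (c+b) * (f a * g b * h c))
     = (\<Sum>(a,b,c,d)\<in>?Q. rho a * rho (a+b) * rho (a+c) * (h a * f b * g c))"
    by (rule sum.reindex_bij_witness[of _ "\<lambda>(a,b,c,d). (b,c,a,d)" "\<lambda>(a,b,c,d). (c,a,b,d)"])
      (auto simp: zero_quads_def)
  finally show ?thesis
    using pairwise_quads_sum[of f g h, OF nn] star_quads_sum[of f g h, OF nn] star_quads_sum[of g f h, OF nn(2) nn(1) nn(3)]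
      star_quads_sum[of h f g, OF nn(3) nn(1) nn(2)]
    by (simp add: mult_ac)
qed

text \<open>Weight and phase are symmetric, so a permutation of the quadruple moves the derivative
  to the last slot; the same works for the two slots in between.\<close>

lemma derivative_sum1:
  assumes nn: "\<And>k. 0 \<le> f k" "\<And>k. 0 \<le> g k" "\<And>k. 0 \<le> h k"
  shows "(\<Sum>(a,b,c,d)\<in>zero_quads A. wt (a,b,c,d) * real_of_int \<bar>a\<bar> / real_of_int \<bar>Psi (a,b,c,d)\<bar> * (f b * g c * h d))
     \<le> 7 * R0\<^sup>2 * (L2_set f A * L2_set g A * L2_set h A)"
proof -
  have "(\<Sum>(a,b,c,d)\<in>zero_quads A. wt (a,b,c,d) * real_of_int \<bar>a\<bar> / real_of_int \<bar>Psi (a,b,c,d)\<bar> * (f b * g c * h d))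
    = (\<Sum>(a,b,c,d)\<in>zero_quads A. wt (a,b,c,d) * real_of_int \<bar>d\<bar> / real_of_int \<bar>Psi (a,b,c,d)\<bar> * (f a * g b * h c))"
    by (rule sum.reindex_bij_witness[of _ "\<lambda>(a,b,c,d). (d,a,b,c)" "\<lambda>(a,b,c,d). (b,c,d,a)"])
      (auto simp: zero_quads_def wt_def Psi_def algebra_simps)
  with derivative_sum4[OF nn] show ?thesis by simp
qed

lemma derivative_sum2:
  assumes nn: "\<And>k. 0 \<le> f k" "\<And>k. 0 \<le> g k" "\<And>k. 0 \<le> h k"
  shows "(\<Sum>(a,b,c,d)\<in>zero_quads A. wt (a,b,c,d) * real_of_int \<bar>b\<bar> / real_of_int \<bar>Psi (a,b,c,d)\<bar> * (f a * g c * h d))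
     \<le> 7 * R0\<^sup>2 * (L2_set f A * L2_set g A * L2_set h A)"
proof -
  have "(\<Sum>(a,b,c,d)\<in>zero_quads A. wt (a,b,c,d) * real_of_int \<bar>b\<bar> / real_of_int \<bar>Psi (a,b,c,d)\<bar> * (f a * g c * h d))
    = (\<Sum>(a,b,c,d)\<in>zero_quads A. wt (a,b,c,d) * real_of_int \<bar>d\<bar> / real_of_int \<bar>Psi (a,b,c,d)\<bar> * (f a * g b * h c))"
    by (rule sum.reindex_bij_witness[of _ "\<lambda>(a,b,c,d). (a,d,b,c)" "\<lambda>(a,b,c,d). (a,c,d,b)"])
      (auto simp: zero_quads_def wt_def Psi_def algebra_simps)
  with derivative_sum4[OF nn] show ?thesis by simp
qed

lemma derivative_sum3:
  assumes nn: "\<And>k. 0 \<le> f k" "\<And>k. 0 \<le> g k" "\<And>k. 0 \<le> h k"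
  shows "(\<Sum>(a,b,c,d)\<in>zero_quads A. wt (a,b,c,d) * real_of_int \<bar>c\<bar> / real_of_int \<bar>Psi (a,b,c,d)\<bar> * (f a * g b * h d))
     \<le> 7 * R0\<^sup>2 * (L2_set f A * L2_set g A * L2_set h A)"
proof -
  have "(\<Sum>(a,b,c,d)\<in>zero_quads A. wt (a,b,c,d) * real_of_int \<bar>c\<bar> / real_of_int \<bar>Psi (a,b,c,d)\<bar> * (f a * g b * h d))
    = (\<Sum>(a,b,c,d)\<in>zero_quads A. wt (a,b,c,d) * real_of_int \<bar>d\<bar> / real_of_int \<bar>Psi (a,b,c,d)\<bar> * (f a * g b * h c))"
    by (rule sum.reindex_bij_witness[of _ "\<lambda>(a,b,c,d). (a,b,d,c)" "\<lambda>(a,b,c,d). (a,b,d,c)"])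
      (auto simp: zero_quads_def wt_def Psi_def algebra_simps)
  with derivative_sum4[OF nn] show ?thesis by simp
qed

end

section \<open>Quartic normal form\<close>

type_synonym path = "real \<Rightarrow> int \<Rightarrow> complex"

definition quartic :: "int set \<Rightarrow> (int \<times> int \<times> int \<times> int \<Rightarrow> complex) \<Rightarrow> path \<Rightarrow> path \<Rightarrow> path \<Rightarrow> path \<Rightarrow> real \<Rightarrow> complex" where
  "quartic A e p1 p2 p3 p4 t = (\<Sum>(a,b,c,d)\<in>zero_quads A. e (a,b,c,d) * (p1 t a * p2 t b * p3 t c * p4 t d))"

locale kdv_frame = freq_set +
  fixes T m :: real
  assumes T_nonneg: "0 \<le> T" and m_ge_1: "1 \<le> m"
begin

text \<open>The function \<open>\<sigma>\<close> dominates the \<open>L^2\<close> norm of \<open>p\<close> and, up to the factor \<open>m\<close>, the forcing, so that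
  multilinear sums in several such paths are bounded by products of the \<open>\<sigma>\<close>'s.\<close>

definition fam :: "(real \<Rightarrow> real) \<Rightarrow> path \<Rightarrow> path \<Rightarrow> bool" where
  "fam \<sigma> p G \<longleftrightarrow> (\<forall>t\<in>{0..T}.
     (\<forall>k\<in>A. ((\<lambda>s. p s k) has_vector_derivative (- \<i> * of_int (k^3) * p t k + \<i> * of_int k * G t k)) (at t within {0..T})
        \<and> cmod (G t k) \<le> m * \<sigma> t)
     \<and> L2_set (\<lambda>k. cmod (p t k)) A \<le> \<sigma> t)"

lemma famD:
  assumes "fam \<sigma> p G" "t \<in> {0..T}"
  shows "k \<in> A \<Longrightarrow> ((\<lambda>s. p s k) has_vector_derivative (- \<i> * of_int (k^3) * p t k + \<i> * of_int k * G t k)) (at t within {0..T})"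
    and "k \<in> A \<Longrightarrow> cmod (G t k) \<le> m * \<sigma> t"
    and "L2_set (\<lambda>k. cmod (p t k)) A \<le> \<sigma> t"
    and "0 \<le> \<sigma> t"
  using assms order_trans[OF L2_set_nonneg[of "\<lambda>k. cmod (p t k)" A]] by (auto simp: fam_def)

text \<open>\<open>S\<close> carries the multiplier i e / Psi on the quadruples with phase above
  \<open>L\<close>; the linear part of its derivative reproduces the quartic sum there. Three
  leftovers form the remainder: exact resonances, nonzero phases up to \<open>L\<close>, and terms
  with one factor replaced by its forcing. A larger \<open>L\<close> shrinks \<open>S\<close> and
  enlarges the remainder.\<close>

lemma quartic_normal_form:
  assumes f1: "fam \<sigma>1 p1 G1" and f2: "fam \<sigma>2 p2 G2" and f3: "fam \<sigma>3 p3 G3" and f4: "fam \<sigma>4 p4 G4"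
    and e: "\<And>q. q \<in> zero_quads A \<Longrightarrow> cmod (e q) \<le> \<Gamma> * wt q"
    and \<Gamma>: "0 \<le> \<Gamma>" and L: "1 \<le> L"
  shows "\<exists>S S'. \<forall>t\<in>{0..T}. (S has_vector_derivative S' t) (at t within {0..T})
     \<and> cmod (S t) \<le> 4 * \<Gamma> * L powr (-1/8) * R0\<^sup>2 * (\<sigma>1 t * \<sigma>2 t * \<sigma>3 t * \<sigma>4 t)
     \<and> cmod (S' t - quartic A e p1 p2 p3 p4 t) \<le> 44 * \<Gamma> * L * m * R0\<^sup>2 * (\<sigma>1 t * \<sigma>2 t * \<sigma>3 t * \<sigma>4 t)"
proof -
  define W where "W = {q\<in>zero_quads A. L < real_of_int \<bar>Psi q\<bar>}"
  define P where "P = (\<lambda>q t. case q of (a,b,c,d) \<Rightarrow> p1 t a * p2 t b * p3 t c * p4 t d)"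
  define R where "R = (\<lambda>q t. case q of (a,b,c,d) \<Rightarrow>
     of_int a * G1 t a * (p2 t b * p3 t c * p4 t d) + of_int b * G2 t b * (p1 t a * p3 t c * p4 t d)
     + of_int c * G3 t c * (p1 t a * p2 t b * p4 t d) + of_int d * G4 t d * (p1 t a * p2 t b * p3 t c))"
  \<comment> \<open>The linear parts of the four equations add up to the phase; \<open>R\<close>
    collects the forcing, one slot at a time.\<close>
  define P' where "P' = (\<lambda>q t. - \<i> * of_int (Psi q) * P q t + \<i> * R q t)"
  define S where "S t = (\<Sum>q\<in>W. (\<i> * e q / of_int (Psi q)) * P q t)" for t
  define S' where "S' t = (\<Sum>q\<in>W. (\<i> * e q / of_int (Psi q)) * P' q t)" for t
  have finQ: "finite (zero_quads A)" by (rule finite_zero_quads[OF finite_A])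
  have WQ: "W \<subseteq> zero_quads A" by (auto simp: W_def)
  have Psi_W: "Psi q \<noteq> 0" if "q \<in> W" for q using that L by (auto simp: W_def)
  have "(S has_vector_derivative S' t) (at t within {0..T}) \<and>
      cmod (S t) \<le> 4 * \<Gamma> * L powr (-1/8) * R0\<^sup>2 * (\<sigma>1 t * \<sigma>2 t * \<sigma>3 t * \<sigma>4 t) \<and>
      cmod (S' t - quartic A e p1 p2 p3 p4 t) \<le> 44 * \<Gamma> * L * m * R0\<^sup>2 * (\<sigma>1 t * \<sigma>2 t * \<sigma>3 t * \<sigma>4 t)"
    if t: "t \<in> {0..T}" for t
  proof (intro conjI)
    have dP: "(P q has_vector_derivative P' q t) (at t within {0..T})" if q: "q \<in> zero_quads A" for q
    proof -
      obtain a b c d where q': "q = (a,b,c,d)" by (cases q)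
      have mem: "a \<in> A" "b \<in> A" "c \<in> A" "d \<in> A" using q by (auto simp: q' zero_quads_def)
      have Pq: "P q = (\<lambda>t. p1 t a * p2 t b * p3 t c * p4 t d)" by (simp add: P_def q' fun_eq_iff)
      show ?thesis unfolding Pq
        by (rule has_vector_derivative_eq_rhs, (rule has_vector_derivative_mult famD(1)[OF f1 t mem(1)]
             famD(1)[OF f2 t mem(2)] famD(1)[OF f3 t mem(3)] famD(1)[OF f4 t mem(4)])+)
          (simp add: P'_def P_def R_def q' Psi_def algebra_simps)
    qed
    show "(S has_vector_derivative S' t) (at t within {0..T})"
      unfolding S_def[abs_def] S'_def using WQ
      by (intro has_vector_derivative_sum has_vector_derivative_mult_right dP) auto
    define f1' where "f1' = (\<lambda>k. cmod (p1 t k))"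
    define f2' where "f2' = (\<lambda>k. cmod (p2 t k))"
    define f3' where "f3' = (\<lambda>k. cmod (p3 t k))"
    define f4' where "f4' = (\<lambda>k. cmod (p4 t k))"
    note fd = f1'_def f2'_def f3'_def f4'_def
    have nn: "0 \<le> f1' k" "0 \<le> f2' k" "0 \<le> f3' k" "0 \<le> f4' k" for k by (auto simp: fd)
    define pp where "pp = \<sigma>1 t * \<sigma>2 t * \<sigma>3 t * \<sigma>4 t"
    have N: "L2_set f1' A \<le> \<sigma>1 t" "L2_set f2' A \<le> \<sigma>2 t" "L2_set f3' A \<le> \<sigma>3 t" "L2_set f4' A \<le> \<sigma>4 t"
      using famD(3)[OF f1 t] famD(3)[OF f2 t] famD(3)[OF f3 t] famD(3)[OF f4 t] by (simp_all add: fd)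
    have s0: "0 \<le> \<sigma>1 t" "0 \<le> \<sigma>2 t" "0 \<le> \<sigma>3 t" "0 \<le> \<sigma>4 t"
      using famD(4)[OF f1 t] famD(4)[OF f2 t] famD(4)[OF f3 t] famD(4)[OF f4 t] by auto
    have N3: "L2_set f A * L2_set g A * L2_set h A \<le> x * y * z"
      if "L2_set f A \<le> x" "L2_set g A \<le> y" "L2_set h A \<le> z" for f g h x y z
      using that by (intro mult_mono mult_nonneg_nonneg) (auto intro: order_trans[OF L2_set_nonneg])
    have N4: "L2_set f1' A * L2_set f2' A * L2_set f3' A * L2_set f4' A \<le> pp"
      unfolding pp_def using N s0 by (intro mult_mono) auto
    have pp0: "0 \<le> pp" unfolding pp_def using s0 by simp
    have wt4: "wt q \<le> 4" if "q \<in> zero_quads A" for q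
    proof -
      obtain a b c d where q': "q = (a,b,c,d)" by (cases q)
      have "a \<noteq> 0" "b \<noteq> 0" "c \<noteq> 0" "d \<noteq> 0" using that zero_A by (auto simp: q' zero_quads_def)
      then show ?thesis using inv_abs_le_1[of a] inv_abs_le_1[of b] inv_abs_le_1[of c] inv_abs_le_1[of d]
        by (simp add: wt_def q')
    qed
    have e4: "cmod (e q) \<le> 4 * \<Gamma>" if "q \<in> zero_quads A" for q
      using e[OF that] mult_left_mono[OF wt4[OF that] \<Gamma>] by simp
    have normP: "cmod (P (a,b,c,d) t) = f1' a * f2' b * f3' c * f4' d" for a b c d
      by (simp add: P_def fd norm_mult)

    have "cmod (S t) \<le> (\<Sum>q\<in>W. cmod ((\<i> * e q / of_int (Psi q)) * P q t))"
      unfolding S_def by (rule norm_sum)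
    also have "\<dots> \<le> (\<Sum>(a,b,c,d)\<in>W. 4 * \<Gamma> * (f1' a * f2' b * f3' c * f4' d / real_of_int \<bar>Psi (a,b,c,d)\<bar>))"
    proof (intro sum_mono, clarify)
      fix a b c d assume q: "(a,b,c,d) \<in> W"
      have "cmod ((\<i> * e (a,b,c,d) / of_int (Psi (a,b,c,d))) * P (a,b,c,d) t)
        = cmod (e (a,b,c,d)) * (f1' a * f2' b * f3' c * f4' d / real_of_int \<bar>Psi (a,b,c,d)\<bar>)"
        by (simp add: norm_mult norm_divide normP)
      also have "\<dots> \<le> 4 * \<Gamma> * (f1' a * f2' b * f3' c * f4' d / real_of_int \<bar>Psi (a,b,c,d)\<bar>)"
        using q WQ by (intro mult_right_mono e4) (auto simp: nn)
      finally show "cmod ((\<i> * e (a,b,c,d) / of_int (Psi (a,b,c,d))) * P (a,b,c,d) t)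
         \<le> 4 * \<Gamma> * (f1' a * f2' b * f3' c * f4' d / real_of_int \<bar>Psi (a,b,c,d)\<bar>)" .
    qed
    also have "\<dots> = 4 * \<Gamma> * (\<Sum>(a,b,c,d)\<in>W. f1' a * f2' b * f3' c * f4' d / real_of_int \<bar>Psi (a,b,c,d)\<bar>)"
      by (simp add: sum_distrib_left case_prod_unfold)
    also have "\<dots> \<le> 4 * \<Gamma> * (L powr (-1/8) * R0\<^sup>2 * (L2_set f1' A * L2_set f2' A * L2_set f3' A * L2_set f4' A))"
      unfolding W_def using \<Gamma> by (intro mult_left_mono high_Psi_sum nn L) auto
    also have "\<dots> \<le> 4 * \<Gamma> * (L powr (-1/8) * R0\<^sup>2 * pp)"
      using \<Gamma> by (intro mult_left_mono N4) auto
    finally show "cmod (S t) \<le> 4 * \<Gamma> * L powr (-1/8) * R0\<^sup>2 * (\<sigma>1 t * \<sigma>2 t * \<sigma>3 t * \<sigma>4 t)"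
      by (simp add: pp_def mult_ac)
    have split: "(\<i> * e q / of_int (Psi q)) * P' q t = e q * P q t - e q / of_int (Psi q) * R q t" if "q \<in> W" for q
      using Psi_W[OF that] by (simp add: P'_def field_simps)
    have "quartic A e p1 p2 p3 p4 t = (\<Sum>q\<in>zero_quads A. e q * P q t)"
      by (simp add: quartic_def P_def case_prod_unfold)
    also have "\<dots> = (\<Sum>q\<in>W. e q * P q t) + (\<Sum>q\<in>zero_quads A - W. e q * P q t)"
      using sum.subset_diff[OF WQ finQ] by (simp add: add.commute)
    finally have eq: "S' t - quartic A e p1 p2 p3 p4 t
        = - (\<Sum>q\<in>W. e q / of_int (Psi q) * R q t) - (\<Sum>q\<in>zero_quads A - W. e q * P q t)"
      unfolding S'_def using split by (simp add: sum_subtractf)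
    have A1: "cmod (\<Sum>q\<in>zero_quads A - W. e q * P q t) \<le> 4 * \<Gamma> * ((3 + L * R0\<^sup>2) * pp)"
    proof -
      have "cmod (\<Sum>q\<in>zero_quads A - W. e q * P q t) \<le> (\<Sum>q\<in>zero_quads A - W. cmod (e q * P q t))"
        by (rule norm_sum)
      also have "\<dots> \<le> (\<Sum>(a,b,c,d)\<in>zero_quads A - W. 4 * \<Gamma> * (f1' a * f2' b * f3' c * f4' d))"
        by (intro sum_mono) (auto simp: norm_mult normP nn intro!: mult_right_mono e4)
      also have "\<dots> = 4 * \<Gamma> * (\<Sum>(a,b,c,d)\<in>zero_quads A - W. f1' a * f2' b * f3' c * f4' d)"
        by (simp add: sum_distrib_left case_prod_unfold)
      also have "(\<Sum>(a,b,c,d)\<in>zero_quads A - W. f1' a * f2' b * f3' c * f4' d)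
         = (\<Sum>(a,b,c,d)\<in>{q\<in>zero_quads A. Psi q = 0}. f1' a * f2' b * f3' c * f4' d)
         + (\<Sum>(a,b,c,d)\<in>{q\<in>zero_quads A. Psi q \<noteq> 0 \<and> real_of_int \<bar>Psi q\<bar> \<le> L}. f1' a * f2' b * f3' c * f4' d)"
        using finQ L by (subst sum.union_disjoint[symmetric]) (auto simp: W_def not_less intro!: sum.cong)
      also have "\<dots> \<le> 3 * (L2_set f1' A * L2_set f2' A * L2_set f3' A * L2_set f4' A)
         + L * R0\<^sup>2 * (L2_set f1' A * L2_set f2' A * L2_set f3' A * L2_set f4' A)"
        by (intro add_mono resonant_sum low_Psi_sum nn L)
      also have "\<dots> = (3 + L * R0\<^sup>2) * (L2_set f1' A * L2_set f2' A * L2_set f3' A * L2_set f4' A)"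
        by (simp add: algebra_simps)
      also have "\<dots> \<le> (3 + L * R0\<^sup>2) * pp"
        using L by (intro mult_left_mono N4) auto
      finally show ?thesis using \<Gamma> by (simp add: mult_left_mono)
    qed
    have A2: "cmod (\<Sum>q\<in>W. e q / of_int (Psi q) * R q t) \<le> \<Gamma> * (28 * m * R0\<^sup>2 * pp)"
    proof -
      define w where "w = (\<lambda>(q, k). wt q * real_of_int \<bar>k\<bar> / real_of_int \<bar>Psi q\<bar>)"
      have "cmod (\<Sum>q\<in>W. e q / of_int (Psi q) * R q t) \<le> (\<Sum>q\<in>W. cmod (e q / of_int (Psi q) * R q t))"
        by (rule norm_sum)
      \<comment> \<open>The range is enlarged to where the derivative sums are available; terms with
        vanishing phase are 0 by division.\<close>
      also have "\<dots> \<le> (\<Sum>q\<in>zero_quads A. cmod (e q / of_int (Psi q) * R q t))"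
        using finQ WQ by (intro sum_mono2) auto
      also have "\<dots> \<le> (\<Sum>(a,b,c,d)\<in>zero_quads A. \<Gamma> * m *
           (\<sigma>1 t * (w ((a,b,c,d), a) * (f2' b * f3' c * f4' d)) + \<sigma>2 t * (w ((a,b,c,d), b) * (f1' a * f3' c * f4' d))
          + \<sigma>3 t * (w ((a,b,c,d), c) * (f1' a * f2' b * f4' d)) + \<sigma>4 t * (w ((a,b,c,d), d) * (f1' a * f2' b * f3' c))))"
      proof (intro sum_mono, clarify)
        fix a b c d assume q: "(a,b,c,d) \<in> zero_quads A"
        then have mem: "a \<in> A" "b \<in> A" "c \<in> A" "d \<in> A" by (auto simp: zero_quads_def)
        let ?r = "real_of_int \<bar>a\<bar> * (m * \<sigma>1 t) * (f2' b * f3' c * f4' d) + real_of_int \<bar>b\<bar> * (m * \<sigma>2 t) * (f1' a * f3' c * f4' d)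
          + real_of_int \<bar>c\<bar> * (m * \<sigma>3 t) * (f1' a * f2' b * f4' d) + real_of_int \<bar>d\<bar> * (m * \<sigma>4 t) * (f1' a * f2' b * f3' c)"
        have "cmod (R (a,b,c,d) t) \<le> ?r"
          unfolding R_def prod.case
          using famD(2)[OF f1 t mem(1)] famD(2)[OF f2 t mem(2)] famD(2)[OF f3 t mem(3)] famD(2)[OF f4 t mem(4)]
          by (intro norm_triangle_le add_mono) (auto simp: norm_mult fd s0 order_trans[OF zero_le_one m_ge_1] intro!: mult_mono mult_nonneg_nonneg)
        then have "cmod (e (a,b,c,d) / of_int (Psi (a,b,c,d)) * R (a,b,c,d) t)
           \<le> (\<Gamma> * wt (a,b,c,d)) / real_of_int \<bar>Psi (a,b,c,d)\<bar> * ?r"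
          using e[OF q] \<Gamma> by (auto simp: norm_mult norm_divide intro!: mult_mono divide_right_mono)
        also have "\<dots> = \<Gamma> * m *
           (\<sigma>1 t * (w ((a,b,c,d), a) * (f2' b * f3' c * f4' d)) + \<sigma>2 t * (w ((a,b,c,d), b) * (f1' a * f3' c * f4' d))
          + \<sigma>3 t * (w ((a,b,c,d), c) * (f1' a * f2' b * f4' d)) + \<sigma>4 t * (w ((a,b,c,d), d) * (f1' a * f2' b * f3' c)))"
          by (simp add: w_def add_divide_distrib algebra_simps)
        finally show "cmod (e (a,b,c,d) / of_int (Psi (a,b,c,d)) * R (a,b,c,d) t) \<le> \<dots>" .
      qed
      also have "\<dots> = \<Gamma> * m *
           (\<sigma>1 t * (\<Sum>(a,b,c,d)\<in>zero_quads A. w ((a,b,c,d), a) * (f2' b * f3' c * f4' d))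
          + \<sigma>2 t * (\<Sum>(a,b,c,d)\<in>zero_quads A. w ((a,b,c,d), b) * (f1' a * f3' c * f4' d))
          + \<sigma>3 t * (\<Sum>(a,b,c,d)\<in>zero_quads A. w ((a,b,c,d), c) * (f1' a * f2' b * f4' d))
          + \<sigma>4 t * (\<Sum>(a,b,c,d)\<in>zero_quads A. w ((a,b,c,d), d) * (f1' a * f2' b * f3' c)))"
        by (simp add: sum_distrib_left sum.distrib[symmetric] case_prod_unfold)
      also have "\<dots> \<le> \<Gamma> * m *
           (\<sigma>1 t * (7 * R0\<^sup>2 * (\<sigma>2 t * \<sigma>3 t * \<sigma>4 t)) + \<sigma>2 t * (7 * R0\<^sup>2 * (\<sigma>1 t * \<sigma>3 t * \<sigma>4 t))
          + \<sigma>3 t * (7 * R0\<^sup>2 * (\<sigma>1 t * \<sigma>2 t * \<sigma>4 t)) + \<sigma>4 t * (7 * R0\<^sup>2 * (\<sigma>1 t * \<sigma>2 t * \<sigma>3 t)))"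
      proof (intro mult_left_mono add_mono s0)
        show "(\<Sum>(a,b,c,d)\<in>zero_quads A. w ((a,b,c,d), a) * (f2' b * f3' c * f4' d)) \<le> 7 * R0\<^sup>2 * (\<sigma>2 t * \<sigma>3 t * \<sigma>4 t)"
          using order_trans[OF derivative_sum1[OF nn(2) nn(3) nn(4)] mult_left_mono[OF N3[OF N(2) N(3) N(4)], of "7 * R0\<^sup>2"]]
          by (simp add: w_def)
        show "(\<Sum>(a,b,c,d)\<in>zero_quads A. w ((a,b,c,d), b) * (f1' a * f3' c * f4' d)) \<le> 7 * R0\<^sup>2 * (\<sigma>1 t * \<sigma>3 t * \<sigma>4 t)"
          using order_trans[OF derivative_sum2[OF nn(1) nn(3) nn(4)] mult_left_mono[OF N3[OF N(1) N(3) N(4)], of "7 * R0\<^sup>2"]]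
          by (simp add: w_def)
        show "(\<Sum>(a,b,c,d)\<in>zero_quads A. w ((a,b,c,d), c) * (f1' a * f2' b * f4' d)) \<le> 7 * R0\<^sup>2 * (\<sigma>1 t * \<sigma>2 t * \<sigma>4 t)"
          using order_trans[OF derivative_sum3[OF nn(1) nn(2) nn(4)] mult_left_mono[OF N3[OF N(1) N(2) N(4)], of "7 * R0\<^sup>2"]]
          by (simp add: w_def)
        show "(\<Sum>(a,b,c,d)\<in>zero_quads A. w ((a,b,c,d), d) * (f1' a * f2' b * f3' c)) \<le> 7 * R0\<^sup>2 * (\<sigma>1 t * \<sigma>2 t * \<sigma>3 t)"
          using order_trans[OF derivative_sum4[OF nn(1) nn(2) nn(3)] mult_left_mono[OF N3[OF N(1) N(2) N(3)], of "7 * R0\<^sup>2"]]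
          by (simp add: w_def)
      qed (use \<Gamma> m_ge_1 in auto)
      also have "\<dots> = \<Gamma> * (28 * m * R0\<^sup>2 * pp)" by (simp add: pp_def algebra_simps)
      finally show ?thesis .
    qed
    have "cmod (S' t - quartic A e p1 p2 p3 p4 t) \<le> \<Gamma> * (28 * m * R0\<^sup>2 * pp) + 4 * \<Gamma> * ((3 + L * R0\<^sup>2) * pp)"
      unfolding eq using A1 A2 norm_triangle_ineq4[of "- (\<Sum>q\<in>W. e q / of_int (Psi q) * R q t)" "\<Sum>q\<in>zero_quads A - W. e q * P q t"]
      by (simp only: norm_minus_cancel)
    \<comment> \<open>28 is 7 for each of the four slots; 12 and 4 are the bound 4 of
      \<open>wt\<close> times the three resonant pairings and the low phases. All merge into 44
      because \<open>L\<close>, \<open>m\<close> and \<open>R0\<close> are at least 1.\<close>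
    also have "\<dots> = (28 * m * R0\<^sup>2 + 12 + 4 * L * R0\<^sup>2) * (\<Gamma> * pp)" by (simp add: algebra_simps)
    also have "\<dots> \<le> (44 * L * m * R0\<^sup>2) * (\<Gamma> * pp)"
    proof (intro mult_right_mono)
      have R: "1 \<le> R0\<^sup>2" using R0_ge_1 by simp
      have "m * R0\<^sup>2 \<le> L * m * R0\<^sup>2"
        using mult_right_mono[OF L, of "m * R0\<^sup>2"] m_ge_1 by (simp add: mult.assoc)
      moreover have "L * R0\<^sup>2 \<le> L * m * R0\<^sup>2"
        using mult_right_mono[OF m_ge_1, of "L * R0\<^sup>2"] L by (simp add: mult_ac)
      moreover have "1 \<le> L * m * R0\<^sup>2"
        using mult_mono[of 1 "L * m" 1 "R0\<^sup>2"] mult_mono[of 1 L 1 m] L m_ge_1 R by simp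
      ultimately show "28 * m * R0\<^sup>2 + 12 + 4 * L * R0\<^sup>2 \<le> 44 * L * m * R0\<^sup>2"
        by linarith
    qed (use \<Gamma> pp0 in auto)
    finally show "cmod (S' t - quartic A e p1 p2 p3 p4 t) \<le> 44 * \<Gamma> * L * m * R0\<^sup>2 * (\<sigma>1 t * \<sigma>2 t * \<sigma>3 t * \<sigma>4 t)"
      by (simp add: pp_def mult_ac)
  qed
  then show ?thesis by blast
qed

end

section \<open>Cubic normal form\<close>

text \<open>The one derivative of the nonlinearity sits on the last factor, the form in which energy
  fluxes appear after pairing with that factor.\<close>

definition cubic :: "int set \<Rightarrow> path \<Rightarrow> path \<Rightarrow> path \<Rightarrow> real \<Rightarrow> complex" where
  "cubic A p1 p2 p3 t = (\<Sum>(a,b,c)\<in>zero_triples A. of_int c * (p1 t a * p2 t b * p3 t c))"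

text \<open>Both input frequencies are confined to \<open>A\<close> while the output is not, so this
  is the exact convolution of two truncated sequences.\<close>

definition cv :: "int set \<Rightarrow> path \<Rightarrow> path \<Rightarrow> path" where
  "cv A p q t k = (\<Sum>x\<in>{x\<in>A. k - x \<in> A}. p t x * q t (k - x))"

context freq_set
begin

lemma sum_conv_pair_le:
  assumes nn: "\<And>k. 0 \<le> f k" "\<And>k. 0 \<le> g k"
  shows "(\<Sum>x\<in>{x\<in>A. k - x \<in> A}. f x * g (k - x)) \<le> L2_set f A * L2_set g A"
proof -
  let ?B = "{x\<in>A. k - x \<in> A}"
  have "(\<Sum>x\<in>?B. f x * g (k - x)) \<le> L2_set f ?B * L2_set (\<lambda>x. g (k - x)) ?B"
    by (rule sum_mult_le_L2_set)
  also have "\<dots> \<le> L2_set f A * L2_set g A"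
  proof (intro mult_mono)
    show "L2_set f ?B \<le> L2_set f A"
    unfolding L2_set_def using finite_A by (intro real_sqrt_le_mono sum_mono2) auto
    show "L2_set (\<lambda>x. g (k - x)) ?B \<le> L2_set g A"
  proof -
    have "(\<Sum>x\<in>?B. (g (k - x))\<^sup>2) = (\<Sum>x\<in>(\<lambda>x. k - x) ` ?B. (g x)\<^sup>2)"
      by (subst sum.reindex) (auto simp: inj_on_def)
    also have "\<dots> \<le> (\<Sum>x\<in>A. (g x)\<^sup>2)" using finite_A by (intro sum_mono2) auto
    finally show ?thesis unfolding L2_set_def by (rule real_sqrt_le_mono)
  qed
  qed auto
  finally show ?thesis .
qed

lemma sum_rho_mult_le:
  "(\<Sum>a\<in>A. rho a * f a) \<le> R0 * L2_set f A"
proof -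
  have "(\<Sum>a\<in>A. rho a * f a) \<le> L2_set rho A * L2_set f A" by (rule sum_mult_le_L2_set)
  also have "\<dots> \<le> R0 * L2_set f A"
  proof (intro mult_right_mono L2_set_le_if_sum_le)
    show "(\<Sum>i\<in>A. (rho i)\<^sup>2) \<le> R0\<^sup>2"
      using sum_rho_sq[OF finite_A] R0_ge_1 self_le_power[of R0 2] by linarith
  qed (use R0_ge_1 in auto)
  finally show ?thesis .
qed

lemma add3_eq_0_iff: "a + b + c = 0 \<longleftrightarrow> c = - a - (b :: int)"
  by auto

lemma zero_triples_sum_first:
  "(\<Sum>(a,b,c)\<in>zero_triples A. F a b c) = (\<Sum>a\<in>A. \<Sum>b\<in>{b\<in>A. - a - b \<in> A}. F a b (- a - b))"
proof -
  have "(\<Sum>(a,b,c)\<in>zero_triples A. F a b c) = (\<Sum>(a,b)\<in>Sigma A (\<lambda>a. {b\<in>A. - a - b \<in> A}). F a b (- a - b))"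
    by (rule sum.reindex_bij_witness[of _ "\<lambda>(a,b). (a,b,-a-b)" "\<lambda>(a,b,c). (a,b)"])
      (auto simp: zero_triples_def add3_eq_0_iff)
  then show ?thesis using finite_A by (subst sum.Sigma) auto
qed

text \<open>The weight makes the first factor summable, and the convolution of the other two is
  bounded by Cauchy-Schwarz. Thus one decaying weight controls a cubic sum, whereas a quartic sum
  needs three.\<close>

lemma triple_rho_sum:
  assumes nn: "\<And>k. 0 \<le> f k" "\<And>k. 0 \<le> g k" "\<And>k. 0 \<le> h k"
  shows "(\<Sum>(a,b,c)\<in>zero_triples A. rho a * (f a * g b * h c)) \<le> R0 * (L2_set f A * L2_set g A * L2_set h A)"
proof -
  have "(\<Sum>(a,b,c)\<in>zero_triples A. rho a * (f a * g b * h c))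
     = (\<Sum>a\<in>A. rho a * f a * (\<Sum>b\<in>{b\<in>A. - a - b \<in> A}. g b * h (- a - b)))"
    by (subst zero_triples_sum_first) (simp add: sum_distrib_left mult_ac)
  also have "\<dots> \<le> (\<Sum>a\<in>A. rho a * f a * (L2_set g A * L2_set h A))"
    by (intro sum_mono mult_left_mono sum_conv_pair_le nn) (auto simp: nn)
  also have "\<dots> = (\<Sum>a\<in>A. rho a * f a) * (L2_set g A * L2_set h A)"
    by (simp add: sum_distrib_right)
  also have "\<dots> \<le> R0 * L2_set f A * (L2_set g A * L2_set h A)"
    by (intro mult_right_mono sum_rho_mult_le) auto
  finally show ?thesis by (simp add: mult_ac)
qed

end

context kdv_frame
begin

text \<open>The forcing is itself quadratic up to an error \<open>\<epsilon>\<close>.  This is what a second normal form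
  needs: the time derivative of a cubic sum is then a quartic sum.\<close>

definition fam2 :: "real \<Rightarrow> (real \<Rightarrow> real) \<Rightarrow> path \<Rightarrow> path \<Rightarrow> bool" where
  "fam2 \<epsilon> \<sigma> p G \<longleftrightarrow> fam \<sigma> p G \<and>
     (\<exists>ch f \<sigma>a pa Ga \<sigma>b pb Gb \<sigma>c pc Gc \<sigma>d pd Gd.
        fam \<sigma>a pa Ga \<and> fam \<sigma>b pb Gb \<and> fam \<sigma>c pc Gc \<and> fam \<sigma>d pd Gd
      \<and> (\<forall>t\<in>{0..T}. \<sigma>a t * \<sigma>b t \<le> m * \<sigma> t \<and> \<sigma>c t * \<sigma>d t \<le> m * \<sigma> t)
      \<and> (\<forall>k. cmod (ch k) \<le> 1)
      \<and> (\<forall>t\<in>{0..T}. \<forall>k\<in>A. G t k = ch k * (cv A pa pb t k + cv A pc pd t k) + f t k \<and> cmod (f t k) \<le> \<epsilon>))"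

text \<open>Writing k as x + y turns triples into quadruples with multiplier
  \<open>e (x+y) b c\<close>. The inverse frequencies of b and c that bound it are part of
  \<open>wt\<close>, as the quartic normal form demands.\<close>

lemma cubic_slot:
  assumes fa: "fam \<sigma>a pa Ga" and fb: "fam \<sigma>b pb Gb" and f2: "fam \<sigma>2 p2 G2" and f3: "fam \<sigma>3 p3 G3"
    and e: "\<And>k b c. (k,b,c) \<in> zero_triples A \<Longrightarrow> cmod (e k b c) \<le> inv_abs b + inv_abs c"
    and L: "1 \<le> L"
  shows "\<exists>S S'. \<forall>t\<in>{0..T}. (S has_vector_derivative S' t) (at t within {0..T})
     \<and> cmod (S t) \<le> 4 * L powr (-1/8) * R0\<^sup>2 * (\<sigma>a t * \<sigma>b t * \<sigma>2 t * \<sigma>3 t)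
     \<and> cmod (S' t - (\<Sum>(k,b,c)\<in>zero_triples A. e k b c * cv A pa pb t k * (p2 t b * p3 t c)))
         \<le> 44 * L * m * R0\<^sup>2 * (\<sigma>a t * \<sigma>b t * \<sigma>2 t * \<sigma>3 t)"
proof -
  \<comment> \<open>A sum x + y outside \<open>A\<close> is no frequency of the cubic sum, hence the
    multiplier 0.\<close>
  define e4 where "e4 = (\<lambda>(x,y,b,c). if x + y \<in> A then e (x+y) b c else 0)"
  have "(\<Sum>(k,b,c)\<in>zero_triples A. e k b c * cv A pa pb t k * (p2 t b * p3 t c)) = quartic A e4 pa pb p2 p3 t" for t
  proof -
    have "(\<Sum>(k,b,c)\<in>zero_triples A. e k b c * cv A pa pb t k * (p2 t b * p3 t c))
      = (\<Sum>(k,b,c)\<in>zero_triples A. \<Sum>x\<in>{x\<in>A. k - x \<in> A}. e k b c * (pa t x * pb t (k - x) * p2 t b * p3 t c))"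
      by (simp add: cv_def sum_distrib_left sum_distrib_right case_prod_unfold mult.assoc)
    also have "\<dots> = (\<Sum>(q,x)\<in>Sigma (zero_triples A) (\<lambda>q. {x\<in>A. fst q - x \<in> A}).
         case q of (k,b,c) \<Rightarrow> e k b c * (pa t x * pb t (k - x) * p2 t b * p3 t c))"
      using finite_A by (subst sum.Sigma[symmetric]) (auto simp: finite_zero_triples case_prod_unfold)
    also have "\<dots> = (\<Sum>(x,y,b,c)\<in>{q\<in>zero_quads A. fst q + fst (snd q) \<in> A}. e (x+y) b c * (pa t x * pb t y * p2 t b * p3 t c))"
      by (rule sum.reindex_bij_witness[of _ "\<lambda>(x,y,b,c). ((x+y,b,c),x)" "\<lambda>((k,b,c),x). (x,k-x,b,c)"])
        (auto simp: zero_triples_def zero_quads_def)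
    also have "\<dots> = (\<Sum>(x,y,b,c)\<in>zero_quads A. e4 (x,y,b,c) * (pa t x * pb t y * p2 t b * p3 t c))"
      using finite_zero_quads[OF finite_A] by (intro sum.mono_neutral_cong_left) (auto simp: e4_def split: if_splits)
    finally show ?thesis by (simp add: quartic_def)
  qed
  moreover have "cmod (e4 q) \<le> 1 * wt q" if "q \<in> zero_quads A" for q
  proof -
    obtain x y b c where q: "q = (x,y,b,c)" by (cases q)
    show ?thesis
    proof (cases "x + y \<in> A")
      case True
      then have "(x+y,b,c) \<in> zero_triples A" using that by (auto simp: q zero_quads_def zero_triples_def)
      then have "cmod (e4 q) \<le> inv_abs b + inv_abs c" using e True by (simp add: q e4_def)
      also have "\<dots> \<le> inv_abs x + inv_abs y + (inv_abs b + inv_abs c)" by simp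
      finally show ?thesis by (simp add: q wt_def)
    qed (simp add: q e4_def wt_def)
  qed
  ultimately show ?thesis
    using quartic_normal_form[OF fa fb f2 f3, of e4 1 L] L by simp
qed

text \<open>A forcing may consist of two products, in order to cover both v * v + w * w and y * d +
  y * h; each one is treated as a quartic sum. The forcing error is bounded only pointwise, so its
  contribution stays a sum until the supports of the other factors are known.\<close>

lemma fam2_slot:
  assumes f1: "fam2 \<epsilon> \<sigma>1 p1 G1" and f2: "fam \<sigma>2 p2 G2" and f3: "fam \<sigma>3 p3 G3"
    and e: "\<And>k b c. (k,b,c) \<in> zero_triples A \<Longrightarrow> cmod (e k b c) \<le> inv_abs b + inv_abs c"
    and L: "1 \<le> L"
  shows "\<exists>S S'. \<forall>t\<in>{0..T}. (S has_vector_derivative S' t) (at t within {0..T})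
     \<and> cmod (S t) \<le> 8 * L powr (-1/8) * m * R0\<^sup>2 * (\<sigma>1 t * \<sigma>2 t * \<sigma>3 t)
     \<and> cmod (S' t - (\<Sum>(k,b,c)\<in>zero_triples A. e k b c * G1 t k * (p2 t b * p3 t c)))
         \<le> 88 * L * m\<^sup>2 * R0\<^sup>2 * (\<sigma>1 t * \<sigma>2 t * \<sigma>3 t)
           + \<epsilon> * (\<Sum>(k,b,c)\<in>zero_triples A. cmod (e k b c) * (cmod (p2 t b) * cmod (p3 t c)))"
proof -
  obtain ch f \<sigma>a pa Ga \<sigma>b pb Gb \<sigma>c pc Gc \<sigma>d pd Gd where
    H: "fam \<sigma>a pa Ga \<and> fam \<sigma>b pb Gb \<and> fam \<sigma>c pc Gc \<and> fam \<sigma>d pd Gd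
      \<and> (\<forall>t\<in>{0..T}. \<sigma>a t * \<sigma>b t \<le> m * \<sigma>1 t \<and> \<sigma>c t * \<sigma>d t \<le> m * \<sigma>1 t)
      \<and> (\<forall>k. cmod (ch k) \<le> 1)
      \<and> (\<forall>t\<in>{0..T}. \<forall>k\<in>A. G1 t k = ch k * (cv A pa pb t k + cv A pc pd t k) + f t k \<and> cmod (f t k) \<le> \<epsilon>)"
    using f1 unfolding fam2_def by (elim conjE exE) (rule that, intro conjI, assumption+)
  from H have fs: "fam \<sigma>a pa Ga" "fam \<sigma>b pb Gb" "fam \<sigma>c pc Gc" "fam \<sigma>d pd Gd"
    and sz: "\<And>t. t \<in> {0..T} \<Longrightarrow> \<sigma>a t * \<sigma>b t \<le> m * \<sigma>1 t" "\<And>t. t \<in> {0..T} \<Longrightarrow> \<sigma>c t * \<sigma>d t \<le> m * \<sigma>1 t"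
    and chle: "\<And>k. cmod (ch k) \<le> 1"
    and G: "\<And>t k. t \<in> {0..T} \<Longrightarrow> k \<in> A \<Longrightarrow> G1 t k = ch k * (cv A pa pb t k + cv A pc pd t k) + f t k"
    and f: "\<And>t k. t \<in> {0..T} \<Longrightarrow> k \<in> A \<Longrightarrow> cmod (f t k) \<le> \<epsilon>"
    by simp_all
  have e': "cmod (e k b c * ch k) \<le> inv_abs b + inv_abs c" if "(k,b,c) \<in> zero_triples A" for k b c
    using mult_mono[OF e[OF that] chle[of k]] by (simp add: norm_mult)
  define Ha where "Ha t = (\<Sum>(k,b,c)\<in>zero_triples A. (e k b c * ch k) * cv A pa pb t k * (p2 t b * p3 t c))" for t
  define Hc where "Hc t = (\<Sum>(k,b,c)\<in>zero_triples A. (e k b c * ch k) * cv A pc pd t k * (p2 t b * p3 t c))" for t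
  let ?l = "L powr (-1/8)"
  obtain Sa Sa' where Sa: "\<And>t. t \<in> {0..T} \<Longrightarrow> (Sa has_vector_derivative Sa' t) (at t within {0..T})
     \<and> cmod (Sa t) \<le> 4 * ?l * R0\<^sup>2 * (\<sigma>a t * \<sigma>b t * \<sigma>2 t * \<sigma>3 t)
     \<and> cmod (Sa' t - Ha t) \<le> 44 * L * m * R0\<^sup>2 * (\<sigma>a t * \<sigma>b t * \<sigma>2 t * \<sigma>3 t)"
    using cubic_slot[OF fs(1,2) f2 f3, of "\<lambda>k b c. e k b c * ch k", OF e' L] unfolding Ha_def by blast
  obtain Sc Sc' where Sc: "\<And>t. t \<in> {0..T} \<Longrightarrow> (Sc has_vector_derivative Sc' t) (at t within {0..T})
     \<and> cmod (Sc t) \<le> 4 * ?l * R0\<^sup>2 * (\<sigma>c t * \<sigma>d t * \<sigma>2 t * \<sigma>3 t)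
     \<and> cmod (Sc' t - Hc t) \<le> 44 * L * m * R0\<^sup>2 * (\<sigma>c t * \<sigma>d t * \<sigma>2 t * \<sigma>3 t)"
    using cubic_slot[OF fs(3,4) f2 f3, of "\<lambda>k b c. e k b c * ch k", OF e' L] unfolding Hc_def by blast
  have "((\<lambda>t. Sa t + Sc t) has_vector_derivative (Sa' t + Sc' t)) (at t within {0..T})
     \<and> cmod (Sa t + Sc t) \<le> 8 * ?l * m * R0\<^sup>2 * (\<sigma>1 t * \<sigma>2 t * \<sigma>3 t)
     \<and> cmod (Sa' t + Sc' t - (\<Sum>(k,b,c)\<in>zero_triples A. e k b c * G1 t k * (p2 t b * p3 t c)))
         \<le> 88 * L * m\<^sup>2 * R0\<^sup>2 * (\<sigma>1 t * \<sigma>2 t * \<sigma>3 t)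
           + \<epsilon> * (\<Sum>(k,b,c)\<in>zero_triples A. cmod (e k b c) * (cmod (p2 t b) * cmod (p3 t c)))"
    if t: "t \<in> {0..T}" for t
  proof (intro conjI)
    show "((\<lambda>t. Sa t + Sc t) has_vector_derivative (Sa' t + Sc' t)) (at t within {0..T})"
      using Sa[OF t] Sc[OF t] by (intro has_vector_derivative_add) auto
    have s0: "0 \<le> \<sigma>2 t" "0 \<le> \<sigma>3 t" using famD(4)[OF f2 t] famD(4)[OF f3 t] by auto
    have za: "\<sigma>a t * \<sigma>b t * \<sigma>2 t * \<sigma>3 t \<le> m * (\<sigma>1 t * \<sigma>2 t * \<sigma>3 t)"
      using mult_right_mono[OF mult_right_mono[OF sz(1)[OF t] s0(1)] s0(2)] by (simp add: mult_ac)
    have zc: "\<sigma>c t * \<sigma>d t * \<sigma>2 t * \<sigma>3 t \<le> m * (\<sigma>1 t * \<sigma>2 t * \<sigma>3 t)"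
      using mult_right_mono[OF mult_right_mono[OF sz(2)[OF t] s0(1)] s0(2)] by (simp add: mult_ac)
    have "cmod (Sa t + Sc t) \<le> 4 * ?l * R0\<^sup>2 * (\<sigma>a t * \<sigma>b t * \<sigma>2 t * \<sigma>3 t) + 4 * ?l * R0\<^sup>2 * (\<sigma>c t * \<sigma>d t * \<sigma>2 t * \<sigma>3 t)"
      using Sa[OF t] Sc[OF t] by (intro norm_triangle_le add_mono) auto
    also have "\<dots> \<le> 4 * ?l * R0\<^sup>2 * (m * (\<sigma>1 t * \<sigma>2 t * \<sigma>3 t)) + 4 * ?l * R0\<^sup>2 * (m * (\<sigma>1 t * \<sigma>2 t * \<sigma>3 t))"
      by (intro add_mono mult_left_mono za zc) auto
    finally show "cmod (Sa t + Sc t) \<le> 8 * ?l * m * R0\<^sup>2 * (\<sigma>1 t * \<sigma>2 t * \<sigma>3 t)"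
      by (simp add: mult_ac)
    define Hf where "Hf = (\<Sum>(k,b,c)\<in>zero_triples A. e k b c * f t k * (p2 t b * p3 t c))"
    have "(\<Sum>(k,b,c)\<in>zero_triples A. e k b c * G1 t k * (p2 t b * p3 t c)) = Ha t + Hc t + Hf"
      unfolding Ha_def Hc_def Hf_def sum.distrib[symmetric]
      by (intro sum.cong refl) (auto simp: zero_triples_def G[OF t] algebra_simps)
    then have "cmod (Sa' t + Sc' t - (\<Sum>(k,b,c)\<in>zero_triples A. e k b c * G1 t k * (p2 t b * p3 t c)))
      = cmod ((Sa' t - Ha t) + (Sc' t - Hc t) + - Hf)" by (simp add: algebra_simps)
    also have "\<dots> \<le> 44 * L * m * R0\<^sup>2 * (\<sigma>a t * \<sigma>b t * \<sigma>2 t * \<sigma>3 t) + 44 * L * m * R0\<^sup>2 * (\<sigma>c t * \<sigma>d t * \<sigma>2 t * \<sigma>3 t)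
       + \<epsilon> * (\<Sum>(k,b,c)\<in>zero_triples A. cmod (e k b c) * (cmod (p2 t b) * cmod (p3 t c)))"
    proof (intro norm_triangle_le add_mono)
      have "cmod Hf \<le> (\<Sum>(k,b,c)\<in>zero_triples A. \<epsilon> * (cmod (e k b c) * (cmod (p2 t b) * cmod (p3 t c))))"
        unfolding Hf_def
      proof (intro sum_norm_le, clarify)
        fix k b c assume "(k,b,c) \<in> zero_triples A"
        then have "cmod (f t k) \<le> \<epsilon>" using f[OF t] by (auto simp: zero_triples_def)
        from mult_right_mono[OF this, of "cmod (e k b c) * (cmod (p2 t b) * cmod (p3 t c))"]
        show "cmod (e k b c * f t k * (p2 t b * p3 t c)) \<le> \<epsilon> * (cmod (e k b c) * (cmod (p2 t b) * cmod (p3 t c)))"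
          by (simp add: norm_mult mult_ac)
      qed
      then show "cmod (- Hf) \<le> \<epsilon> * (\<Sum>(k,b,c)\<in>zero_triples A. cmod (e k b c) * (cmod (p2 t b) * cmod (p3 t c)))"
        by (simp add: sum_distrib_left case_prod_unfold)
    qed (use Sa[OF t] Sc[OF t] in auto)
    also have "\<dots> \<le> 44 * L * m * R0\<^sup>2 * (m * (\<sigma>1 t * \<sigma>2 t * \<sigma>3 t)) + 44 * L * m * R0\<^sup>2 * (m * (\<sigma>1 t * \<sigma>2 t * \<sigma>3 t))
       + \<epsilon> * (\<Sum>(k,b,c)\<in>zero_triples A. cmod (e k b c) * (cmod (p2 t b) * cmod (p3 t c)))"
    proof (rule add_right_mono)
      have "0 \<le> 44 * L * m * R0\<^sup>2" using L m_ge_1 by simp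
      then show "44 * L * m * R0\<^sup>2 * (\<sigma>a t * \<sigma>b t * \<sigma>2 t * \<sigma>3 t) + 44 * L * m * R0\<^sup>2 * (\<sigma>c t * \<sigma>d t * \<sigma>2 t * \<sigma>3 t)
         \<le> 44 * L * m * R0\<^sup>2 * (m * (\<sigma>1 t * \<sigma>2 t * \<sigma>3 t)) + 44 * L * m * R0\<^sup>2 * (m * (\<sigma>1 t * \<sigma>2 t * \<sigma>3 t))"
        using mult_left_mono[OF za] mult_left_mono[OF zc] by (intro add_mono) auto
    qed
    finally show "cmod (Sa' t + Sc' t - (\<Sum>(k,b,c)\<in>zero_triples A. e k b c * G1 t k * (p2 t b * p3 t c)))
         \<le> 88 * L * m\<^sup>2 * R0\<^sup>2 * (\<sigma>1 t * \<sigma>2 t * \<sigma>3 t)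
           + \<epsilon> * (\<Sum>(k,b,c)\<in>zero_triples A. cmod (e k b c) * (cmod (p2 t b) * cmod (p3 t c)))"
      by (simp add: power2_eq_square algebra_simps)
  qed
  then have "\<forall>t\<in>{0..T}. ((\<lambda>t. Sa t + Sc t) has_vector_derivative (\<lambda>t. Sa' t + Sc' t) t) (at t within {0..T})
     \<and> cmod ((\<lambda>t. Sa t + Sc t) t) \<le> 8 * ?l * m * R0\<^sup>2 * (\<sigma>1 t * \<sigma>2 t * \<sigma>3 t)
     \<and> cmod ((\<lambda>t. Sa' t + Sc' t) t - (\<Sum>(k,b,c)\<in>zero_triples A. e k b c * G1 t k * (p2 t b * p3 t c)))
         \<le> 88 * L * m\<^sup>2 * R0\<^sup>2 * (\<sigma>1 t * \<sigma>2 t * \<sigma>3 t)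
           + \<epsilon> * (\<Sum>(k,b,c)\<in>zero_triples A. cmod (e k b c) * (cmod (p2 t b) * cmod (p3 t c)))"
    by (intro ballI) simp
  then show ?thesis by (intro exI)
qed


text \<open>A crude count of modes. It is affordable because it is always multiplied by a truncation
  error that tends to 0 while \<open>n\<close> stays fixed.\<close>

lemma sum_low_modes_le:
  assumes nn: "\<And>k. 0 \<le> f k" and z: "\<And>k. k \<in> A \<Longrightarrow> int n < \<bar>k\<bar> \<Longrightarrow> f k = 0"
  shows "(\<Sum>k\<in>A. f k) \<le> (2 * real n + 1) * L2_set f A"
proof -
  have "(\<Sum>k\<in>A. f k) = (\<Sum>k\<in>A \<inter> {- int n..int n}. f k)"
  proof (intro sum.mono_neutral_right finite_A ballI)
    fix k assume k: "k \<in> A - A \<inter> {- int n..int n}"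
    then have "k \<in> A" "\<not> (- int n \<le> k \<and> k \<le> int n)" by auto
    then show "f k = 0" by (intro z) linarith+
  qed auto
  also have "\<dots> \<le> (\<Sum>k\<in>A \<inter> {- int n..int n}. L2_set f A)"
    using finite_A by (intro sum_mono L2_set_ge_elem) auto
  also have "\<dots> = real (card (A \<inter> {- int n..int n})) * L2_set f A" by simp
  also have "\<dots> \<le> (2 * real n + 1) * L2_set f A"
  proof (intro mult_right_mono)
    have "card (A \<inter> {- int n..int n}) \<le> card {- int n..int n}" by (intro card_mono) auto
    then show "real (card (A \<inter> {- int n..int n})) \<le> 2 * real n + 1" by simp
  qed auto
  finally show ?thesis .
qed

lemma sum_zero_triples_product_le:
  fixes f g :: "int \<Rightarrow> real"
  assumes nn: "\<And>k. 0 \<le> f k" "\<And>k. 0 \<le> g k"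
  shows "(\<Sum>(k,b,c)\<in>zero_triples A. f b * g c) \<le> (\<Sum>b\<in>A. f b) * (\<Sum>c\<in>A. g c)"
proof -
  have "(\<Sum>(k,b,c)\<in>zero_triples A. f b * g c) = (\<Sum>(a,b,c)\<in>zero_triples A. f a * g b)"
    by (rule sum.reindex_bij_witness[of _ "\<lambda>(a,b,c). (c,a,b)" "\<lambda>(k,b,c). (b,c,k)"])
      (auto simp: zero_triples_def)
  also have "\<dots> \<le> (\<Sum>a\<in>A. \<Sum>b\<in>A. f a * g b)"
    by (rule sum_zero_triples_le[OF finite_A, of "\<lambda>a b. f a * g b"]) (simp add: nn)
  finally show ?thesis by (simp add: sum_product)
qed

text \<open>The derivative c divided by the phase 3abc leaves 1/(3ab), so the gain must come from
  |ab| alone. Since |c| <= 2|ab|, the phase is at most the square of 3|ab|; this square root turns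
  the exponent 1/4 into 1/8.\<close>

lemma cubic_weight_le:
  fixes a b c :: int
  assumes nz: "a \<noteq> 0" "b \<noteq> 0" "c \<noteq> 0" and s: "a + b + c = 0" and L: "1 \<le> L" "L < real_of_int \<bar>3 * (a * b * c)\<bar>"
  shows "1 / real_of_int \<bar>3 * (a * b)\<bar> \<le> L powr (-1/8) * rho a"
proof -
  define w where "w = real_of_int \<bar>a * b\<bar>"
  have w1: "1 \<le> w" using nz unfolding w_def of_int_1_le_iff by (simp add: int_one_le_iff_zero_less)
  have "\<bar>c\<bar> \<le> \<bar>a\<bar> + \<bar>b\<bar>" using s by linarith
  also have "\<dots> \<le> 2 * \<bar>a * b\<bar>"
  proof -
    have "\<bar>a\<bar> * 1 \<le> \<bar>a\<bar> * \<bar>b\<bar>" "1 * \<bar>b\<bar> \<le> \<bar>a\<bar> * \<bar>b\<bar>"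
      using nz by (intro mult_left_mono mult_right_mono; simp)+
    then show ?thesis by (simp add: abs_mult)
  qed
  finally have c: "real_of_int \<bar>c\<bar> \<le> 2 * w"
    unfolding w_def by (metis of_int_le_iff of_int_mult of_int_numeral)
  have "real_of_int \<bar>3 * (a * b * c)\<bar> = 3 * (w * real_of_int \<bar>c\<bar>)"
    by (simp add: w_def abs_mult)
  also have "\<dots> \<le> 3 * (w * (2 * w))" using c w1 by (intro mult_left_mono) auto
  also have "\<dots> \<le> (3 * w)\<^sup>2" by (simp add: power2_eq_square)
  finally have Lw: "L \<le> (3 * w) powr 2" using L w1 by (simp add: powr_numeral)
  have "1 / (3 * w) = (3 * w) powr (-1)" using w1 by (simp add: powr_minus_divide)
  also have "\<dots> = (3 * w) powr (-1/4) * (3 * w) powr (-3/4)" by (simp add: powr_add[symmetric])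
  also have "\<dots> \<le> L powr (-1/8) * w powr (-3/4)"
  proof (intro mult_mono)
    have "(3 * w) powr (-1/4) = ((3 * w) powr 2) powr (-1/8)" by (simp add: powr_powr)
    also have "\<dots> \<le> L powr (-1/8)" using L Lw by (intro powr_mono2') auto
    finally show "(3 * w) powr (-1/4) \<le> L powr (-1/8)" .
    show "(3 * w) powr (-3/4) \<le> w powr (-3/4)" using w1 by (intro powr_mono2') auto
  qed auto
  also have "w powr (-3/4) = rho a * rho b"
    using nz by (simp add: w_def rho_def abs_mult powr_mult)
  also have "L powr (-1/8) * (rho a * rho b) \<le> L powr (-1/8) * (rho a * 1)"
    by (intro mult_left_mono rho_le_1) auto
  finally show ?thesis by (simp add: w_def abs_mult)
qed

lemma phase_expansion:
  fixes x y P a b c g1 g2 g3 q1 q2 q3 :: complex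
  shows "x * (y * P + \<i> * (a * g1 * q1 + b * g2 * q2 + c * g3 * q3))
    = (x * y) * P + (x * (\<i> * a)) * g1 * q1 + (x * (\<i> * b)) * g2 * q2 + (x * (\<i> * c)) * g3 * q3"
  by (simp add: algebra_simps)

text \<open>The correction with multiplier i/(3ab) loses no derivative. Differentiating it puts a
  forcing into each slot with coefficients of size 1/b, 1/a and c/(ab), all controlled by inverse
  frequencies; these terms are quartic up to errors, and their own corrections \<open>S1\<close>,
  \<open>S2\<close>, \<open>S3\<close> are subtracted. The low support of the third factor makes the
  forcing errors summable.\<close>

lemma cubic_normal_form:
  assumes f1: "fam2 \<epsilon> \<sigma>1 p1 G1" and f2: "fam2 \<epsilon> \<sigma>2 p2 G2" and f3: "fam2 \<epsilon> \<sigma>3 p3 G3"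
    and supp: "\<And>t k. t \<in> {0..T} \<Longrightarrow> k \<in> A \<Longrightarrow> int n < \<bar>k\<bar> \<Longrightarrow> p3 t k = 0 \<and> G3 t k = 0"
    and L: "1 \<le> L" and \<epsilon>: "0 \<le> \<epsilon>"
  shows "\<exists>S S'. \<forall>t\<in>{0..T}. (S has_vector_derivative S' t) (at t within {0..T})
     \<and> cmod (S t) \<le> 25 * L powr (-1/8) * m * R0\<^sup>2 * (\<sigma>1 t * \<sigma>2 t * \<sigma>3 t)
     \<and> cmod (S' t - cubic A p1 p2 p3 t) \<le> 265 * L * m\<^sup>2 * R0\<^sup>2 * (\<sigma>1 t * \<sigma>2 t * \<sigma>3 t)
         + \<epsilon> * (2 * real n + 1) * R0\<^sup>2 * (\<sigma>1 t * \<sigma>2 t + \<sigma>1 t * \<sigma>3 t + \<sigma>2 t * \<sigma>3 t)"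
proof -
  let ?l = "L powr (-1/8)"
  let ?Z = "zero_triples A"
  have fam: "fam \<sigma>1 p1 G1" "fam \<sigma>2 p2 G2" "fam \<sigma>3 p3 G3" using f1 f2 f3 by (auto simp: fam2_def)
  have finZ: "finite ?Z" by (rule finite_zero_triples[OF finite_A])
  define hi where "hi a b c \<longleftrightarrow> L < real_of_int \<bar>3 * (a * b * c)\<bar>" for a b c :: int
  have hi_perm: "hi b a c \<longleftrightarrow> hi a b c" "hi a c b \<longleftrightarrow> hi a b c" for a b c
    by (simp_all add: hi_def mult_ac)
  define e1 where "e1 k b c = (if hi k b c then - 1 / of_int (3 * b) else (0::complex))" for k b c
  \<comment> \<open>The cutoff |k| <= n loses nothing, since \<open>G3\<close> vanishes beyond it,
    and it bounds the multiplier by n times weights decaying in b and c.\<close>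
  define e3 where "e3 k b c = (if hi k b c \<and> \<bar>k\<bar> \<le> int n then - of_int k / of_int (3 * (b * c)) else (0::complex))" for k b c
  have nzZ: "a \<noteq> 0" "b \<noteq> 0" "c \<noteq> 0" if "(a,b,c) \<in> ?Z" for a b c
    using that zero_A by (auto simp: zero_triples_def)
  have e1_le: "cmod (e1 k b c) \<le> inv_abs b" for k b c
    by (auto simp: e1_def norm_divide inv_abs_def norm_mult divide_simps)
  have e1_bd: "cmod (e1 k b c) \<le> inv_abs b + inv_abs c" for k b c
    using e1_le[of k b c] inv_abs_nonneg[of c] by linarith
  have e3_bd: "cmod (e3 k b c) \<le> inv_abs b + inv_abs c" if "(k,b,c) \<in> ?Z" for k b c
  proof -
    have k: "k = - b - c" using that by (auto simp: zero_triples_def)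
    have nz: "b \<noteq> 0" "c \<noteq> 0" using nzZ[OF that] by auto
    have "real_of_int \<bar>k\<bar> \<le> real_of_int \<bar>b\<bar> + real_of_int \<bar>c\<bar>" unfolding k by linarith
    then have "real_of_int \<bar>k\<bar> / real_of_int \<bar>3 * (b * c)\<bar> \<le> (real_of_int \<bar>b\<bar> + real_of_int \<bar>c\<bar>) / real_of_int \<bar>3 * (b * c)\<bar>"
      by (intro divide_right_mono) auto
    also have "\<dots> = (inv_abs b + inv_abs c) / 3"
      using nz by (simp add: inv_abs_def abs_mult add_divide_distrib)
    also have "\<dots> \<le> inv_abs b + inv_abs c" by simp
    finally show ?thesis by (auto simp: e3_def norm_divide norm_mult abs_mult)
  qed
  have e3_le: "cmod (e3 k b c) \<le> real n * (rho b * rho c)" if "(k,b,c) \<in> ?Z" for k b c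
  proof (cases "hi k b c \<and> \<bar>k\<bar> \<le> int n")
    case True
    then have "cmod (e3 k b c) = real_of_int \<bar>k\<bar> * (inv_abs b * inv_abs c) / 3"
      by (simp add: e3_def norm_divide norm_mult inv_abs_def)
    also have "\<dots> \<le> real_of_int \<bar>k\<bar> * (inv_abs b * inv_abs c)" by simp
    also have "\<dots> \<le> real n * (rho b * rho c)"
    proof (intro mult_mono inv_abs_le_rho)
      have "real_of_int \<bar>k\<bar> \<le> real_of_int (int n)" using True by (subst of_int_le_iff) simp
      then show "real_of_int \<bar>k\<bar> \<le> real n" by simp
    qed auto
    finally show ?thesis .
  qed (auto simp: e3_def)
  define H1 where "H1 t = (\<Sum>(k,b,c)\<in>?Z. e1 k b c * G1 t k * (p2 t b * p3 t c))" for t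
  define H2 where "H2 t = (\<Sum>(k,b,c)\<in>?Z. e1 k b c * G2 t k * (p1 t b * p3 t c))" for t
  define H3 where "H3 t = (\<Sum>(k,b,c)\<in>?Z. e3 k b c * G3 t k * (p1 t b * p2 t c))" for t
  define Er where "Er e p q t = (\<Sum>(k,b,c)\<in>?Z. cmod (e k b c) * (cmod (p t b) * cmod (q t c)))"
    for e :: "int \<Rightarrow> int \<Rightarrow> int \<Rightarrow> complex" and p q :: path and t :: real
  obtain S1 S1' where S1: "\<And>t. t \<in> {0..T} \<Longrightarrow> (S1 has_vector_derivative S1' t) (at t within {0..T})
     \<and> cmod (S1 t) \<le> 8 * ?l * m * R0\<^sup>2 * (\<sigma>1 t * \<sigma>2 t * \<sigma>3 t)
     \<and> cmod (S1' t - H1 t) \<le> 88 * L * m\<^sup>2 * R0\<^sup>2 * (\<sigma>1 t * \<sigma>2 t * \<sigma>3 t) + \<epsilon> * Er e1 p2 p3 t"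
    using fam2_slot[OF f1 fam(2) fam(3), of e1, OF e1_bd L] unfolding H1_def Er_def by blast
  obtain S2 S2' where S2: "\<And>t. t \<in> {0..T} \<Longrightarrow> (S2 has_vector_derivative S2' t) (at t within {0..T})
     \<and> cmod (S2 t) \<le> 8 * ?l * m * R0\<^sup>2 * (\<sigma>2 t * \<sigma>1 t * \<sigma>3 t)
     \<and> cmod (S2' t - H2 t) \<le> 88 * L * m\<^sup>2 * R0\<^sup>2 * (\<sigma>2 t * \<sigma>1 t * \<sigma>3 t) + \<epsilon> * Er e1 p1 p3 t"
    using fam2_slot[OF f2 fam(1) fam(3), of e1, OF e1_bd L] unfolding H2_def Er_def by blast
  obtain S3 S3' where S3: "\<And>t. t \<in> {0..T} \<Longrightarrow> (S3 has_vector_derivative S3' t) (at t within {0..T})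
     \<and> cmod (S3 t) \<le> 8 * ?l * m * R0\<^sup>2 * (\<sigma>3 t * \<sigma>1 t * \<sigma>2 t)
     \<and> cmod (S3' t - H3 t) \<le> 88 * L * m\<^sup>2 * R0\<^sup>2 * (\<sigma>3 t * \<sigma>1 t * \<sigma>2 t) + \<epsilon> * Er e3 p1 p2 t"
    using fam2_slot[OF f3 fam(1) fam(2), of e3, OF e3_bd L] unfolding H3_def Er_def by blast
  define W where "W = {(a,b,c)\<in>?Z. hi a b c}"
  have WZ: "W \<subseteq> ?Z" by (auto simp: W_def)
  define S0 where "S0 t = (\<Sum>(a,b,c)\<in>W. \<i> / of_int (3 * (a * b)) * (p1 t a * p2 t b * p3 t c))" for t
  define S0' where "S0' t = (\<Sum>(a,b,c)\<in>W. \<i> / of_int (3 * (a * b)) *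
      (- \<i> * of_int (3 * (a * b * c)) * (p1 t a * p2 t b * p3 t c)
       + \<i> * (of_int a * G1 t a * (p2 t b * p3 t c) + of_int b * G2 t b * (p1 t a * p3 t c) + of_int c * G3 t c * (p1 t a * p2 t b))))" for t
  define S where "S t = S0 t - S1 t - S2 t - S3 t" for t
  define S' where "S' t = S0' t - S1' t - S2' t - S3' t" for t
  have "(S has_vector_derivative S' t) (at t within {0..T})
     \<and> cmod (S t) \<le> 25 * ?l * m * R0\<^sup>2 * (\<sigma>1 t * \<sigma>2 t * \<sigma>3 t)
     \<and> cmod (S' t - cubic A p1 p2 p3 t) \<le> 265 * L * m\<^sup>2 * R0\<^sup>2 * (\<sigma>1 t * \<sigma>2 t * \<sigma>3 t)
         + \<epsilon> * (2 * real n + 1) * R0\<^sup>2 * (\<sigma>1 t * \<sigma>2 t + \<sigma>1 t * \<sigma>3 t + \<sigma>2 t * \<sigma>3 t)"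
    if t: "t \<in> {0..T}" for t
  proof (intro conjI)
    define g1 where "g1 = (\<lambda>k. cmod (p1 t k))"
    define g2 where "g2 = (\<lambda>k. cmod (p2 t k))"
    define g3 where "g3 = (\<lambda>k. cmod (p3 t k))"
    note gd = g1_def g2_def g3_def
    have nn: "0 \<le> g1 k" "0 \<le> g2 k" "0 \<le> g3 k" for k by (auto simp: gd)
    have N: "L2_set g1 A \<le> \<sigma>1 t" "L2_set g2 A \<le> \<sigma>2 t" "L2_set g3 A \<le> \<sigma>3 t"
      using famD(3)[OF fam(1) t] famD(3)[OF fam(2) t] famD(3)[OF fam(3) t] by (simp_all add: gd)
    have s0: "0 \<le> \<sigma>1 t" "0 \<le> \<sigma>2 t" "0 \<le> \<sigma>3 t"
      using famD(4)[OF fam(1) t] famD(4)[OF fam(2) t] famD(4)[OF fam(3) t] by auto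
    define pp where "pp = \<sigma>1 t * \<sigma>2 t * \<sigma>3 t"
    have pp0: "0 \<le> pp" using s0 by (simp add: pp_def)
    have N3: "L2_set g1 A * L2_set g2 A * L2_set g3 A \<le> pp"
      unfolding pp_def using N s0 by (intro mult_mono) auto
    have R1: "1 \<le> R0" "R0 \<le> R0\<^sup>2" using R0_ge_1 self_le_power[of R0 2] by auto
    have rs: "(\<Sum>(a,b,c)\<in>?Z. rho a * (g1 a * g2 b * g3 c)) \<le> R0\<^sup>2 * pp"
    proof -
      have "(\<Sum>(a,b,c)\<in>?Z. rho a * (g1 a * g2 b * g3 c)) \<le> R0 * (L2_set g1 A * L2_set g2 A * L2_set g3 A)"
        by (rule triple_rho_sum[OF nn])
      also have "\<dots> \<le> R0\<^sup>2 * pp" using R1 N3 by (intro mult_mono) auto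
      finally show ?thesis .
    qed
    have d0: "(S0 has_vector_derivative S0' t) (at t within {0..T})"
      unfolding S0_def[abs_def] S0'_def
    proof (intro has_vector_derivative_sum, clarify)
      fix a b c assume q: "(a,b,c) \<in> W"
      then have mem: "a \<in> A" "b \<in> A" "c \<in> A" and s: "c = - a - b" using WZ by (auto simp: zero_triples_def)
      have cubes: "complex_of_int (a^3) + of_int (b^3) + of_int (c^3) = of_int (3 * (a * b * c))"
        unfolding of_int_add[symmetric] s by (simp add: power3_eq_cube algebra_simps)
      show "((\<lambda>t. \<i> / of_int (3 * (a * b)) * (p1 t a * p2 t b * p3 t c)) has_vector_derivative
        \<i> / of_int (3 * (a * b)) * (- \<i> * of_int (3 * (a * b * c)) * (p1 t a * p2 t b * p3 t c)
       + \<i> * (of_int a * G1 t a * (p2 t b * p3 t c) + of_int b * G2 t b * (p1 t a * p3 t c) + of_int c * G3 t c * (p1 t a * p2 t b))))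
       (at t within {0..T})"
      proof (rule has_vector_derivative_mult_right)
        show "((\<lambda>t. p1 t a * p2 t b * p3 t c) has_vector_derivative (- \<i> * of_int (3 * (a * b * c)) * (p1 t a * p2 t b * p3 t c)
       + \<i> * (of_int a * G1 t a * (p2 t b * p3 t c) + of_int b * G2 t b * (p1 t a * p3 t c) + of_int c * G3 t c * (p1 t a * p2 t b))))
       (at t within {0..T})"
          unfolding cubes[symmetric]
          by (rule has_vector_derivative_eq_rhs, (rule has_vector_derivative_mult famD(1)[OF fam(1) t mem(1)]
             famD(1)[OF fam(2) t mem(2)] famD(1)[OF fam(3) t mem(3)])+) (simp add: algebra_simps)
      qed
    qed
    show "(S has_vector_derivative S' t) (at t within {0..T})"
      unfolding S_def[abs_def] S'_def using d0 S1[OF t] S2[OF t] S3[OF t]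
      by (intro has_vector_derivative_diff) auto
    have "cmod (S0 t) \<le> (\<Sum>(a,b,c)\<in>W. ?l * (rho a * (g1 a * g2 b * g3 c)))"
      unfolding S0_def
    proof (intro sum_norm_le, clarify)
      fix a b c assume q: "(a,b,c) \<in> W"
      then have "1 / real_of_int \<bar>3 * (a * b)\<bar> \<le> ?l * rho a"
        using nzZ[of a b c] L by (intro cubic_weight_le[of a b c]) (auto simp: W_def hi_def zero_triples_def)
      from mult_right_mono[OF this, of "g1 a * g2 b * g3 c"]
      show "cmod (\<i> / of_int (3 * (a * b)) * (p1 t a * p2 t b * p3 t c)) \<le> ?l * (rho a * (g1 a * g2 b * g3 c))"
        by (simp add: nn norm_mult norm_divide gd abs_mult mult_ac)
    qed
    also have "\<dots> \<le> (\<Sum>(a,b,c)\<in>?Z. ?l * (rho a * (g1 a * g2 b * g3 c)))"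
      using finZ WZ by (intro sum_mono2) (auto simp: nn)
    also have "\<dots> = ?l * (\<Sum>(a,b,c)\<in>?Z. rho a * (g1 a * g2 b * g3 c))"
      by (simp add: sum_distrib_left case_prod_unfold)
    also have "\<dots> \<le> ?l * (R0\<^sup>2 * pp)" by (intro mult_left_mono rs) auto
    also have "\<dots> = ?l * 1 * R0\<^sup>2 * pp" by simp
    also have "\<dots> \<le> ?l * m * R0\<^sup>2 * pp" using m_ge_1 pp0 by (intro mult_right_mono mult_left_mono) auto
    finally have "cmod (S0 t) \<le> ?l * m * R0\<^sup>2 * pp" .
    then have "cmod (S t) \<le> ?l * m * R0\<^sup>2 * pp + 8 * ?l * m * R0\<^sup>2 * pp + 8 * ?l * m * R0\<^sup>2 * pp + 8 * ?l * m * R0\<^sup>2 * pp"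
      unfolding S_def using S1[OF t] S2[OF t] S3[OF t]
      by (intro norm_triangle_le_diff add_mono) (auto simp: pp_def mult_ac)
    also have "\<dots> = 25 * ?l * m * R0\<^sup>2 * (\<sigma>1 t * \<sigma>2 t * \<sigma>3 t)"
      by (simp add: pp_def)
    finally show "cmod (S t) \<le> \<dots>" .
    \<comment> \<open>Triples with phase at most \<open>L\<close>. There |c| <= L / |a|, decay
      enough for a direct bound.\<close>
    define lo where "lo = (\<Sum>(a,b,c)\<in>?Z - W. of_int c * (p1 t a * p2 t b * p3 t c))"
    have "cmod lo \<le> (\<Sum>(a,b,c)\<in>?Z - W. L * (rho a * (g1 a * g2 b * g3 c)))"
      unfolding lo_def
    proof (intro sum_norm_le, clarify)
      fix a b c assume q: "(a,b,c) \<in> ?Z" "(a,b,c) \<notin> W"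
      have nz: "a \<noteq> 0" "b \<noteq> 0" using nzZ[OF q(1)] by auto
      have le: "3 * (real_of_int \<bar>a\<bar> * real_of_int \<bar>b\<bar> * real_of_int \<bar>c\<bar>) \<le> L"
        using q by (simp add: W_def hi_def not_less abs_mult)
      have "real_of_int \<bar>a\<bar> * real_of_int \<bar>c\<bar> * 1 \<le> real_of_int \<bar>a\<bar> * real_of_int \<bar>c\<bar> * (3 * real_of_int \<bar>b\<bar>)"
        using nz by (intro mult_left_mono) auto
      also have "\<dots> \<le> L" using le by (simp add: mult_ac)
      finally have "real_of_int \<bar>c\<bar> \<le> L * inv_abs a"
        using nz by (simp add: inv_abs_def field_simps)
      also have "\<dots> \<le> L * rho a" using L by (intro mult_left_mono inv_abs_le_rho) auto
      finally have "real_of_int \<bar>c\<bar> * (g1 a * g2 b * g3 c) \<le> L * rho a * (g1 a * g2 b * g3 c)"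
        by (intro mult_right_mono) (auto simp: nn)
      then show "cmod (of_int c * (p1 t a * p2 t b * p3 t c)) \<le> L * (rho a * (g1 a * g2 b * g3 c))"
        by (simp add: norm_mult gd mult_ac)
    qed
    also have "\<dots> \<le> (\<Sum>(a,b,c)\<in>?Z. L * (rho a * (g1 a * g2 b * g3 c)))"
      using finZ L by (intro sum_mono2) (auto simp: nn)
    also have "\<dots> = L * (\<Sum>(a,b,c)\<in>?Z. rho a * (g1 a * g2 b * g3 c))"
      by (simp add: sum_distrib_left case_prod_unfold)
    also have "\<dots> \<le> L * (R0\<^sup>2 * pp)" using L by (intro mult_left_mono rs) auto
    also have "\<dots> \<le> L * m\<^sup>2 * R0\<^sup>2 * pp"
    proof -
      have "1 \<le> m\<^sup>2" using m_ge_1 by simp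
      then have "L * 1 * R0\<^sup>2 * pp \<le> L * m\<^sup>2 * R0\<^sup>2 * pp"
        using L pp0 by (intro mult_right_mono mult_left_mono) auto
      then show ?thesis by (simp add: mult_ac)
    qed
    finally have lo_le: "cmod lo \<le> L * m\<^sup>2 * R0\<^sup>2 * pp" .
    have S0'_eq: "S0' t = cubic A p1 p2 p3 t - lo + H1 t + H2 t + H3 t"
    proof -
      have "S0' t = (\<Sum>(a,b,c)\<in>W. of_int c * (p1 t a * p2 t b * p3 t c) + e1 a b c * G1 t a * (p2 t b * p3 t c)
          + e1 b a c * G2 t b * (p1 t a * p3 t c) + e3 c a b * G3 t c * (p1 t a * p2 t b))"
        unfolding S0'_def
      proof (intro sum.cong refl, clarify)
        fix a b c assume q: "(a,b,c) \<in> W"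
        then have nz: "complex_of_int a \<noteq> 0" "complex_of_int b \<noteq> 0" and h: "hi a b c" and c: "c \<in> A"
          using nzZ[of a b c] by (auto simp: W_def zero_triples_def)
        have e3G: "e3 c a b * G3 t c = - of_int c / of_int (3 * (a * b)) * G3 t c"
          using h supp[OF t c] by (cases "\<bar>c\<bar> \<le> int n") (auto simp: e3_def hi_perm)
        have h': "hi b a c" using h by (simp add: hi_perm)
        show "\<i> / of_int (3 * (a * b)) *
      (- \<i> * of_int (3 * (a * b * c)) * (p1 t a * p2 t b * p3 t c)
       + \<i> * (of_int a * G1 t a * (p2 t b * p3 t c) + of_int b * G2 t b * (p1 t a * p3 t c) + of_int c * G3 t c * (p1 t a * p2 t b)))
       = of_int c * (p1 t a * p2 t b * p3 t c) + e1 a b c * G1 t a * (p2 t b * p3 t c)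
          + e1 b a c * G2 t b * (p1 t a * p3 t c) + e3 c a b * G3 t c * (p1 t a * p2 t b)"
        proof -
          have k: "\<i> / of_int (3 * (a * b)) * (- \<i> * of_int (3 * (a * b * c))) = complex_of_int c"
            "\<i> / of_int (3 * (a * b)) * (\<i> * of_int a) = e1 a b c"
            "\<i> / of_int (3 * (a * b)) * (\<i> * of_int b) = e1 b a c"
            "\<i> / of_int (3 * (a * b)) * (\<i> * of_int c) = - complex_of_int c / of_int (3 * (a * b))"
            using nz h h' by (simp_all add: e1_def)
          show ?thesis unfolding e3G phase_expansion k by (simp only: mult.assoc)
        qed
      qed
      also have "\<dots> = (\<Sum>(a,b,c)\<in>W. of_int c * (p1 t a * p2 t b * p3 t c))
         + (\<Sum>(a,b,c)\<in>W. e1 a b c * G1 t a * (p2 t b * p3 t c))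
         + (\<Sum>(a,b,c)\<in>W. e1 b a c * G2 t b * (p1 t a * p3 t c))
         + (\<Sum>(a,b,c)\<in>W. e3 c a b * G3 t c * (p1 t a * p2 t b))"
        by (simp add: sum.distrib case_prod_unfold)
      also have "(\<Sum>(a,b,c)\<in>W. of_int c * (p1 t a * p2 t b * p3 t c)) = cubic A p1 p2 p3 t - lo"
        unfolding cubic_def lo_def by (simp add: sum_diff[OF finZ WZ])
      also have "(\<Sum>(a,b,c)\<in>W. e1 a b c * G1 t a * (p2 t b * p3 t c)) = H1 t"
        unfolding H1_def using finZ WZ by (intro sum.mono_neutral_left) (auto simp: W_def e1_def split: if_splits)
      also have "(\<Sum>(a,b,c)\<in>W. e1 b a c * G2 t b * (p1 t a * p3 t c)) = H2 t"
      proof -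
        have "(\<Sum>(a,b,c)\<in>W. e1 b a c * G2 t b * (p1 t a * p3 t c)) = (\<Sum>(a,b,c)\<in>?Z. e1 b a c * G2 t b * (p1 t a * p3 t c))"
          using finZ WZ by (intro sum.mono_neutral_left) (auto simp: W_def e1_def hi_perm split: if_splits)
        also have "\<dots> = H2 t" unfolding H2_def
          by (rule sum.reindex_bij_witness[of _ "\<lambda>(a,b,c). (b,a,c)" "\<lambda>(a,b,c). (b,a,c)"]) (auto simp: zero_triples_def)
        finally show ?thesis .
      qed
      also have "(\<Sum>(a,b,c)\<in>W. e3 c a b * G3 t c * (p1 t a * p2 t b)) = H3 t"
      proof -
        have "(\<Sum>(a,b,c)\<in>W. e3 c a b * G3 t c * (p1 t a * p2 t b)) = (\<Sum>(a,b,c)\<in>?Z. e3 c a b * G3 t c * (p1 t a * p2 t b))"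
          using finZ WZ by (intro sum.mono_neutral_left) (auto simp: W_def e3_def hi_perm split: if_splits)
        also have "\<dots> = H3 t" unfolding H3_def
          by (rule sum.reindex_bij_witness[of _ "\<lambda>(k,b,c). (b,c,k)" "\<lambda>(a,b,c). (c,a,b)"]) (auto simp: zero_triples_def)
        finally show ?thesis .
      qed
      finally show ?thesis .
    qed
    \<comment> \<open>The factor 1/b of the multiplier makes the sum over b converge; the sum over c
      is finite by the support of \<open>p3\<close>.\<close>
    have Er1: "Er e1 q p3 t \<le> (2 * real n + 1) * R0\<^sup>2 * (x * \<sigma>3 t)"
      if q: "L2_set (\<lambda>k. cmod (q t k)) A \<le> x" for q x
    proof -
      have x0: "0 \<le> x" using q order_trans[OF L2_set_nonneg] by blast
      have "Er e1 q p3 t \<le> (\<Sum>(k,b,c)\<in>?Z. (rho b * cmod (q t b)) * g3 c)"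
        unfolding Er_def
      proof (intro sum_mono, clarify)
        fix k b c
        have "cmod (e1 k b c) \<le> rho b" using e1_le[of k b c] inv_abs_le_rho[of b] by linarith
        from mult_right_mono[OF this, of "cmod (q t b) * cmod (p3 t c)"]
        show "cmod (e1 k b c) * (cmod (q t b) * cmod (p3 t c)) \<le> (rho b * cmod (q t b)) * g3 c"
          by (simp add: gd mult_ac)
      qed
      also have "\<dots> \<le> (\<Sum>b\<in>A. rho b * cmod (q t b)) * (\<Sum>c\<in>A. g3 c)"
        by (intro sum_zero_triples_product_le) (auto simp: nn)
      also have "\<dots> \<le> (R0 * x) * ((2 * real n + 1) * \<sigma>3 t)"
      proof (intro mult_mono)
        show "(\<Sum>b\<in>A. rho b * cmod (q t b)) \<le> R0 * x"
          using R1 q by (intro order_trans[OF sum_rho_mult_le] mult_left_mono) auto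
        have "(\<Sum>c\<in>A. g3 c) \<le> (2 * real n + 1) * L2_set g3 A"
          using supp[OF t] by (intro sum_low_modes_le) (auto simp: gd)
        also have "\<dots> \<le> (2 * real n + 1) * \<sigma>3 t" using N by (intro mult_left_mono) auto
        finally show "(\<Sum>c\<in>A. g3 c) \<le> (2 * real n + 1) * \<sigma>3 t" .
      qed (use R1 x0 nn in \<open>auto intro: sum_nonneg\<close>)
      also have "\<dots> = R0 * ((2 * real n + 1) * (x * \<sigma>3 t))" by (simp add: mult_ac)
      also have "\<dots> \<le> R0\<^sup>2 * ((2 * real n + 1) * (x * \<sigma>3 t))"
        using R1 x0 s0 by (intro mult_right_mono) auto
      finally show ?thesis by (simp add: mult_ac)
    qed
    have Er3: "Er e3 p1 p2 t \<le> (2 * real n + 1) * R0\<^sup>2 * (\<sigma>1 t * \<sigma>2 t)"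
    proof -
      have "Er e3 p1 p2 t \<le> (\<Sum>(k,b,c)\<in>?Z. real n * ((rho b * g1 b) * (rho c * g2 c)))"
        unfolding Er_def
      proof (intro sum_mono, clarify)
        fix k b c assume q: "(k,b,c) \<in> ?Z"
        from mult_right_mono[OF e3_le[OF q], of "cmod (p1 t b) * cmod (p2 t c)"]
        show "cmod (e3 k b c) * (cmod (p1 t b) * cmod (p2 t c)) \<le> real n * ((rho b * g1 b) * (rho c * g2 c))"
          by (simp add: gd mult_ac)
      qed
      also have "\<dots> = real n * (\<Sum>(k,b,c)\<in>?Z. (rho b * g1 b) * (rho c * g2 c))"
        by (simp add: sum_distrib_left case_prod_unfold)
      also have "\<dots> \<le> real n * ((\<Sum>b\<in>A. rho b * g1 b) * (\<Sum>c\<in>A. rho c * g2 c))"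
        by (intro mult_left_mono sum_zero_triples_product_le) (auto simp: nn)
      also have "\<dots> \<le> real n * ((R0 * \<sigma>1 t) * (R0 * \<sigma>2 t))"
        using R1 N s0 nn by (intro mult_left_mono mult_mono order_trans[OF sum_rho_mult_le]) (auto intro: sum_nonneg)
      also have "\<dots> = real n * (R0\<^sup>2 * (\<sigma>1 t * \<sigma>2 t))" by (simp add: power2_eq_square)
      also have "\<dots> \<le> (2 * real n + 1) * (R0\<^sup>2 * (\<sigma>1 t * \<sigma>2 t))" using s0 by (intro mult_right_mono) auto
      finally show ?thesis by (simp add: mult_ac)
    qed
    define E where "E = 88 * L * m\<^sup>2 * R0\<^sup>2 * pp"
    have Er_1: "\<epsilon> * Er e1 p2 p3 t \<le> \<epsilon> * ((2 * real n + 1) * R0\<^sup>2 * (\<sigma>2 t * \<sigma>3 t))"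
      using \<epsilon> N by (intro mult_left_mono Er1) (auto simp: gd)
    have Er_2: "\<epsilon> * Er e1 p1 p3 t \<le> \<epsilon> * ((2 * real n + 1) * R0\<^sup>2 * (\<sigma>1 t * \<sigma>3 t))"
      using \<epsilon> N by (intro mult_left_mono Er1) (auto simp: gd)
    have Er_3: "\<epsilon> * Er e3 p1 p2 t \<le> \<epsilon> * ((2 * real n + 1) * R0\<^sup>2 * (\<sigma>1 t * \<sigma>2 t))"
      using \<epsilon> Er3 by (intro mult_left_mono) auto
    have d1: "cmod (S1' t - H1 t) \<le> E + \<epsilon> * ((2 * real n + 1) * R0\<^sup>2 * (\<sigma>2 t * \<sigma>3 t))"
      using S1[OF t] Er_1 by (auto simp: E_def pp_def mult_ac)
    have d2: "cmod (S2' t - H2 t) \<le> E + \<epsilon> * ((2 * real n + 1) * R0\<^sup>2 * (\<sigma>1 t * \<sigma>3 t))"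
      using S2[OF t] Er_2 by (auto simp: E_def pp_def mult_ac)
    have d3: "cmod (S3' t - H3 t) \<le> E + \<epsilon> * ((2 * real n + 1) * R0\<^sup>2 * (\<sigma>1 t * \<sigma>2 t))"
      using S3[OF t] Er_3 by (auto simp: E_def pp_def mult_ac)
    have "S' t - cubic A p1 p2 p3 t = - lo - (S1' t - H1 t) - (S2' t - H2 t) - (S3' t - H3 t)"
      by (simp add: S'_def S0'_eq)
    also have "cmod \<dots> \<le> L * m\<^sup>2 * R0\<^sup>2 * pp + (E + \<epsilon> * ((2 * real n + 1) * R0\<^sup>2 * (\<sigma>2 t * \<sigma>3 t)))
       + (E + \<epsilon> * ((2 * real n + 1) * R0\<^sup>2 * (\<sigma>1 t * \<sigma>3 t))) + (E + \<epsilon> * ((2 * real n + 1) * R0\<^sup>2 * (\<sigma>1 t * \<sigma>2 t)))"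
    proof -
      have "cmod (- x - y - z - w) \<le> cmod x + cmod y + cmod z + cmod w" for x y z w :: complex
        using norm_triangle_ineq4[of "- x - y - z" w] norm_triangle_ineq4[of "- x - y" z] norm_triangle_ineq4[of "- x" y]
        by simp
      from this[of lo "S1' t - H1 t" "S2' t - H2 t" "S3' t - H3 t"] d1 d2 d3 lo_le show ?thesis
        by linarith
    qed
    \<comment> \<open>One low-phase term and three forcing slots: 265 = 1 + 3 * 88, just as 25 = 1 +
      3 * 8 for the correction.\<close>
    also have "\<dots> = 265 * L * m\<^sup>2 * R0\<^sup>2 * (\<sigma>1 t * \<sigma>2 t * \<sigma>3 t)
         + \<epsilon> * (2 * real n + 1) * R0\<^sup>2 * (\<sigma>1 t * \<sigma>2 t + \<sigma>1 t * \<sigma>3 t + \<sigma>2 t * \<sigma>3 t)"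
      by (simp add: E_def pp_def algebra_simps)
    finally show "cmod (S' t - cubic A p1 p2 p3 t) \<le> \<dots>" .
  qed
  then show ?thesis by blast
qed

end

section \<open>The energy estimate\<close>

text \<open>The bound on the modulus of the derivative makes exp (- K x) f decreasing and exp (K x)
  f increasing. Both directions matter, since the dual problem is solved from the final
  time.\<close>

lemma gronwall_two_sided:
  fixes f f' :: "real \<Rightarrow> real"
  assumes der: "\<And>t. t \<in> {0..T} \<Longrightarrow> (f has_vector_derivative f' t) (at t within {0..T})"
    and bd: "\<And>t. t \<in> {0..T} \<Longrightarrow> \<bar>f' t\<bar> \<le> K * f t"
    and t: "t0 \<in> {0..T}" "t \<in> {0..T}"
  shows "f t \<le> exp (K * \<bar>t - t0\<bar>) * f t0"
proof -
  have dx: "((\<lambda>x. exp (c * x) * f x) has_real_derivative exp (c * x) * (f' x + c * f x)) (at x within {0..T})"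
    if "x \<in> {0..T}" for x c
  proof -
    have fd: "(f has_real_derivative f' x) (at x within {0..T})"
      using der[OF that] by (simp add: has_real_derivative_iff_has_vector_derivative)
    show ?thesis by (rule derivative_eq_intros fd refl | simp add: algebra_simps)+
  qed
  have dx_open: "((\<lambda>x. exp (c * x) * f x) has_real_derivative exp (c * x) * (f' x + c * f x)) (at x)"
    if "0 < x" "x < T" for x c
    using dx[of x c] that by (simp add: at_within_Icc_at)
  have cont: "continuous_on {a..b} (\<lambda>x. exp (c * x) * f x)" if "0 \<le> a" "b \<le> T" for a b c
    by (rule continuous_on_subset[OF DERIV_continuous_on[OF dx]]) (use that in auto)
  show ?thesis
  proof (cases "t0 \<le> t")
    case True
    have "exp (- K * t) * f t \<le> exp (- K * t0) * f t0"
    proof (rule DERIV_nonpos_imp_decreasing_open[OF True])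
      fix x assume x: "t0 < x" "x < t"
      then have "f' x + - K * f x \<le> 0" using bd[of x] t by auto
      then show "\<exists>y. ((\<lambda>x. exp (- K * x) * f x) has_real_derivative y) (at x) \<and> y \<le> 0"
        using dx_open[of x "- K"] x t by (intro exI conjI) (auto simp: mult_nonneg_nonpos)
    next
      show "continuous_on {t0..t} (\<lambda>x. exp (- K * x) * f x)" using t by (intro cont) auto
    qed
    then have "exp (K * t) * (exp (- K * t) * f t) \<le> exp (K * t) * (exp (- K * t0) * f t0)"
      by (intro mult_left_mono) auto
    also have "exp (K * t) * (exp (- K * t) * f t) = f t"
      by (simp add: mult.assoc[symmetric] exp_add[symmetric])
    also have "exp (K * t) * (exp (- K * t0) * f t0) = exp (K * \<bar>t - t0\<bar>) * f t0"
      using True by (simp add: mult.assoc[symmetric] exp_add[symmetric] right_diff_distrib)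
    finally show ?thesis .
  next
    case False
    then have le: "t \<le> t0" by simp
    have "exp (K * t) * f t \<le> exp (K * t0) * f t0"
    proof (rule DERIV_nonneg_imp_increasing_open[OF le])
      fix x assume x: "t < x" "x < t0"
      then have "f' x + K * f x \<ge> 0" using bd[of x] t by auto
      then show "\<exists>y. ((\<lambda>x. exp (K * x) * f x) has_real_derivative y) (at x) \<and> 0 \<le> y"
        using dx_open[of x K] x t by (intro exI[of _ "exp (K * x) * (f' x + K * f x)"] conjI) auto
    next
      show "continuous_on {t..t0} (\<lambda>x. exp (K * x) * f x)" using t by (intro cont) auto
    qed
    then have "exp (- K * t) * (exp (K * t) * f t) \<le> exp (- K * t) * (exp (K * t0) * f t0)"
      by (intro mult_left_mono) auto
    also have "exp (- K * t) * (exp (K * t) * f t) = f t"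
      by (simp add: mult.assoc[symmetric] exp_add[symmetric])
    also have "exp (- K * t) * (exp (K * t0) * f t0) = exp (K * \<bar>t - t0\<bar>) * f t0"
      using False by (simp add: mult.assoc[symmetric] exp_add[symmetric] right_diff_distrib)
    finally show ?thesis .
  qed
qed

text \<open>Chosen so that \<open>L powr (-1/8)\<close> makes the normal form correction at most a fixed fraction of
  the energy.\<close>

definition cutoff_scale :: "real \<Rightarrow> real" where
  "cutoff_scale m = (400 * m\<^sup>2 * R0\<^sup>2 + 1) ^ 8"

text \<open>530 = 2 * 265 stems from four cubic sums with coefficient of modulus 1/2. The summands 2
  and 1 absorb the truncation errors, and the factor 3 converts the squared size function into the
  corrected energy.\<close>

definition growth_rate :: "real \<Rightarrow> real" where
  "growth_rate m = 3 * (530 * cutoff_scale m * m^3 * R0\<^sup>2 + 2) + 1"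

lemma cutoff_scale_ge_1: "1 \<le> cutoff_scale m"
  unfolding cutoff_scale_def by (intro one_le_power) simp

lemma cutoff_scale_powr: "cutoff_scale m powr (-1/8) = 1 / (400 * m\<^sup>2 * R0\<^sup>2 + 1)"
proof -
  define x where "x = 400 * m\<^sup>2 * R0\<^sup>2 + 1"
  have x: "0 < x" unfolding x_def by (intro add_nonneg_pos) auto
  have "x ^ 8 = x powr 8" using x by (simp add: powr_numeral)
  then have "cutoff_scale m powr (-1/8) = (x powr 8) powr (-1/8)"
    by (simp add: cutoff_scale_def x_def)
  also have "\<dots> = x powr (-1)" by (simp add: powr_powr)
  also have "\<dots> = 1 / x" using x by (simp add: powr_minus_divide)
  finally show ?thesis by (simp add: x_def)
qed

context kdv_frame
begin

lemma cubic_eq_sum_last: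
  "cubic A p q r t = (\<Sum>c\<in>A. of_int c * (cv A p q t (- c) * r t c))"
proof -
  have "cubic A p q r t = (\<Sum>(c,a,b)\<in>zero_triples A. of_int c * (p t a * q t b * r t c))"
    unfolding cubic_def
    by (rule sum.reindex_bij_witness[of _ "\<lambda>(c,a,b). (a,b,c)" "\<lambda>(a,b,c). (c,a,b)"]) (auto simp: zero_triples_def)
  also have "\<dots> = (\<Sum>c\<in>A. \<Sum>a\<in>{a\<in>A. - c - a \<in> A}. of_int c * (p t a * q t (- c - a) * r t c))"
    by (rule zero_triples_sum_first)
  also have "\<dots> = (\<Sum>c\<in>A. of_int c * (cv A p q t (- c) * r t c))"
    by (simp add: cv_def sum_distrib_left sum_distrib_right)
  finally show ?thesis .
qed

lemma cv_bound:
  "cmod (cv A p q t k) \<le> L2_set (\<lambda>k. cmod (p t k)) A * L2_set (\<lambda>k. cmod (q t k)) A"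
proof -
  have "cmod (cv A p q t k) \<le> (\<Sum>x\<in>{x\<in>A. k - x \<in> A}. cmod (p t x) * cmod (q t (k - x)))"
    unfolding cv_def by (intro sum_norm_le) (simp add: norm_mult)
  also have "\<dots> \<le> L2_set (\<lambda>k. cmod (p t k)) A * L2_set (\<lambda>k. cmod (q t k)) A"
    by (rule sum_conv_pair_le) auto
  finally show ?thesis .
qed

text \<open>The forcing of \<open>d\<close> contains y * d, so the size function has to follow the
  norm of \<open>d\<close> itself; \<open>\<eta>\<close> and \<open>\<epsilon>\<close> are added so
  that it also dominates the source y * h and the pointwise error.\<close>

lemma driven_family:
  fixes \<eta> M \<epsilon> :: real
  assumes y: "fam (\<lambda>_. M) y Gy" and h: "fam (\<lambda>_. \<eta>) h Gh" and Mm: "M \<le> m" and \<epsilon>: "0 \<le> \<epsilon>"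
    and supp: "\<And>t k. int n < \<bar>k\<bar> \<Longrightarrow> d t k = 0"
    and der: "\<And>t k. t \<in> {0..T} \<Longrightarrow> k \<in> A \<Longrightarrow> ((\<lambda>s. d s k) has_vector_derivative (- \<i> * of_int (k^3) * d t k + \<i> * of_int k * G t k)) (at t within {0..T})"
    and G: "\<And>t k. t \<in> {0..T} \<Longrightarrow> k \<in> A \<Longrightarrow> G t k = (if \<bar>k\<bar> \<le> int n then (cv A y d t k + cv A y h t k) / 2 + f t k else 0)"
    and f: "\<And>t k. t \<in> {0..T} \<Longrightarrow> k \<in> A \<Longrightarrow> cmod (f t k) \<le> \<epsilon>"
    and T0: "0 \<le> \<eta>" "0 \<le> M"
  shows "fam2 \<epsilon> (\<lambda>t. L2_set (\<lambda>k. cmod (d t k)) A + \<eta> + \<epsilon>) d G"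
proof -
  define \<delta> where "\<delta> t = L2_set (\<lambda>k. cmod (d t k)) A" for t
  define \<sigma> where "\<sigma> t = \<delta> t + \<eta> + \<epsilon>" for t
  have \<delta>0: "0 \<le> \<delta> t" for t by (simp add: \<delta>_def)
  have fd: "fam \<sigma> d G"
    unfolding fam_def
  proof (intro ballI conjI)
    fix t k assume t: "t \<in> {0..T}" and k: "k \<in> A"
    show "((\<lambda>s. d s k) has_vector_derivative (- \<i> * of_int (k^3) * d t k + \<i> * of_int k * G t k)) (at t within {0..T})"
      by (rule der[OF t k])
    have c1: "cmod (cv A y d t k) \<le> M * \<delta> t"
      using famD(3)[OF y t] T0 by (intro order_trans[OF cv_bound] mult_mono) (auto simp: \<delta>_def)
    have c2: "cmod (cv A y h t k) \<le> M * \<eta>"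
      using famD(3)[OF y t] famD(3)[OF h t] T0 by (intro order_trans[OF cv_bound] mult_mono) auto
    have "cmod ((cv A y d t k + cv A y h t k) / 2 + f t k) \<le> (M * \<delta> t + M * \<eta>) / 2 + \<epsilon>"
      using c1 c2 f[OF t k] by (intro norm_triangle_le add_mono) (auto simp: norm_divide intro!: norm_triangle_le)
    also have "\<dots> \<le> M * \<delta> t + M * \<eta> + 1 * \<epsilon>"
      using mult_nonneg_nonneg[OF T0(2) \<delta>0[of t]] mult_nonneg_nonneg[OF T0(2) T0(1)] by simp
    also have "\<dots> \<le> m * \<delta> t + m * \<eta> + m * \<epsilon>"
      using Mm m_ge_1 \<delta>0 T0 \<epsilon> by (intro add_mono mult_right_mono) auto
    finally have "cmod ((cv A y d t k + cv A y h t k) / 2 + f t k) \<le> m * \<sigma> t"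
      by (simp add: \<sigma>_def algebra_simps)
    moreover have "0 \<le> m * \<sigma> t" using m_ge_1 \<delta>0 T0 \<epsilon> by (simp add: \<sigma>_def)
    ultimately show "cmod (G t k) \<le> m * \<sigma> t" using G[OF t k] by simp
  qed (use T0 \<epsilon> in \<open>auto simp: \<sigma>_def \<delta>_def\<close>)
  have "fam2 \<epsilon> \<sigma> d G"
    unfolding fam2_def
  proof (intro conjI fd exI)
    show "fam (\<lambda>_. M) y Gy" "fam \<sigma> d G" "fam (\<lambda>_. M) y Gy" "fam (\<lambda>_. \<eta>) h Gh" by (rule y fd h)+
    show "\<forall>t\<in>{0..T}. M * \<sigma> t \<le> m * \<sigma> t \<and> M * \<eta> \<le> m * \<sigma> t"
    proof (intro ballI conjI)
      fix t assume "t \<in> {0..T}"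
      have "0 \<le> \<sigma> t" "\<eta> \<le> \<sigma> t" using \<delta>0[of t] T0 \<epsilon> by (auto simp: \<sigma>_def)
      then show "M * \<sigma> t \<le> m * \<sigma> t" "M * \<eta> \<le> m * \<sigma> t"
        using Mm T0 m_ge_1 by (auto intro!: mult_mono)
    qed
    show "\<forall>k. cmod (if \<bar>k\<bar> \<le> int n then 1/2 else (0::complex)) \<le> 1" by simp
    show "\<forall>t\<in>{0..T}. \<forall>k\<in>A. G t k = (if \<bar>k\<bar> \<le> int n then 1/2 else 0) * (cv A y d t k + cv A y h t k)
        + (if \<bar>k\<bar> \<le> int n then f t k else 0) \<and> cmod (if \<bar>k\<bar> \<le> int n then f t k else 0) \<le> \<epsilon>"
      using G f \<epsilon> by auto
  qed
  then show ?thesis by (simp add: \<sigma>_def[abs_def] \<delta>_def)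
qed

lemma half_expansion:
  fixes c x y z w :: complex
  shows "- \<i> * (c * (((x + y) / 2 + z) * w)) = - (\<i> / 2) * (c * (x * w)) - (\<i> / 2) * (c * (y * w)) - \<i> * (c * z * w)"
  by (simp add: algebra_simps add_divide_distrib)

text \<open>\<open>dd\<close> is the conjugate reflection of \<open>d\<close>, which makes the
  energy a bilinear sum even for paths without conjugate symmetry; solutions started from a single
  mode are of this kind. The derivative of the energy consists of four cubic sums, coupling y with
  \<open>d\<close> or \<open>h\<close>, or with \<open>dd\<close> or \<open>h\<close>, against the
  other path. No cancellation between them is used: each is removed by its own cubic normal
  form.\<close>

lemma energy_estimate:
  fixes \<eta> M \<epsilon> :: real
  assumes y: "fam2 \<epsilon> (\<lambda>_. M) y Gy" and h: "fam2 \<epsilon> (\<lambda>_. \<eta>) h Gh"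
    and Mm: "M \<le> m" and \<epsilon>: "0 \<le> \<epsilon>" and M0: "0 \<le> M" and \<eta>0: "0 \<le> \<eta>"
    and small: "4 * \<epsilon> * (2 * real n + 1)\<^sup>2 * R0\<^sup>2 \<le> 1"
    and supp: "\<And>t k. int n < \<bar>k\<bar> \<Longrightarrow> d t k = 0"
    and dd: "\<And>t k. dd t k = cnj (d t (- k))"
    and der: "\<And>t k. t \<in> {0..T} \<Longrightarrow> k \<in> A \<Longrightarrow> ((\<lambda>s. d s k) has_vector_derivative (- \<i> * of_int (k^3) * d t k + \<i> * of_int k * G t k)) (at t within {0..T})"
    and G: "\<And>t k. t \<in> {0..T} \<Longrightarrow> k \<in> A \<Longrightarrow> G t k = (if \<bar>k\<bar> \<le> int n then (cv A y d t k + cv A y h t k) / 2 + f t k else 0)"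
    and f: "\<And>t k. t \<in> {0..T} \<Longrightarrow> k \<in> A \<Longrightarrow> cmod (f t k) \<le> \<epsilon>"
    and der': "\<And>t k. t \<in> {0..T} \<Longrightarrow> k \<in> A \<Longrightarrow> ((\<lambda>s. dd s k) has_vector_derivative (- \<i> * of_int (k^3) * dd t k + \<i> * of_int k * G' t k)) (at t within {0..T})"
    and G': "\<And>t k. t \<in> {0..T} \<Longrightarrow> k \<in> A \<Longrightarrow> G' t k = (if \<bar>k\<bar> \<le> int n then (cv A y dd t k + cv A y h t k) / 2 + f' t k else 0)"
    and f': "\<And>t k. t \<in> {0..T} \<Longrightarrow> k \<in> A \<Longrightarrow> cmod (f' t k) \<le> \<epsilon>"
    and t: "t0 \<in> {0..T}" "t \<in> {0..T}"
  shows "(L2_set (\<lambda>k. cmod (d t k)) A)\<^sup>2 \<le> 4 * exp (growth_rate m * \<bar>t - t0\<bar>) *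
      ((L2_set (\<lambda>k. cmod (d t0 k)) A)\<^sup>2 + (\<eta> + \<epsilon>)\<^sup>2 + 4 * \<epsilon> * (2 * real n + 1)\<^sup>2 * R0\<^sup>2 * (M\<^sup>2 + 1))"
proof -
  define \<delta> where "\<delta> t = L2_set (\<lambda>k. cmod (d t k)) A" for t
  define \<kappa> where "\<kappa> = \<eta> + \<epsilon>"
  define \<sigma> where "\<sigma> t = \<delta> t + \<eta> + \<epsilon>" for t
  define \<epsilon>' where "\<epsilon>' = 4 * \<epsilon> * (2 * real n + 1)\<^sup>2 * R0\<^sup>2"
  define L where "L = cutoff_scale m"
  have L1: "1 \<le> L" unfolding L_def by (rule cutoff_scale_ge_1)
  have \<delta>0: "0 \<le> \<delta> t" for t by (simp add: \<delta>_def)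
  have \<epsilon>'0: "0 \<le> \<epsilon>'" "\<epsilon>' \<le> 1" using \<epsilon> small by (auto simp: \<epsilon>'_def)
  have \<sigma>\<kappa>: "\<sigma> t = \<delta> t + \<kappa>" for t by (simp add: \<sigma>_def \<kappa>_def)
  have \<sigma>0: "0 \<le> \<sigma> t" "\<eta> \<le> \<sigma> t" "\<delta> t \<le> \<sigma> t" for t using \<delta>0[of t] \<epsilon> \<eta>0 by (auto simp: \<sigma>_def)
  have fy: "fam (\<lambda>_. M) y Gy" and fh: "fam (\<lambda>_. \<eta>) h Gh" using y h by (auto simp: fam2_def)
  have ndd: "L2_set (\<lambda>k. cmod (dd t k)) A = \<delta> t" for t
    unfolding \<delta>_def dd complex_mod_cnj by (rule L2_set_reflect[OF sym_A])
  have supp': "dd t k = 0" if "int n < \<bar>k\<bar>" for t k using supp[of "- k" t] that by (simp add: dd)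
  have fd: "fam2 \<epsilon> \<sigma> d G"
    using driven_family[OF fy fh Mm \<epsilon> supp der G f \<eta>0 M0] by (simp add: \<sigma>_def[abs_def] \<delta>_def)
  have fdd: "fam2 \<epsilon> \<sigma> dd G'"
    using driven_family[OF fy fh Mm \<epsilon> supp' der' G' f' \<eta>0 M0] by (simp add: \<sigma>_def[abs_def] ndd)
  have sd: "d t k = 0 \<and> G t k = 0" if "t \<in> {0..T}" "k \<in> A" "int n < \<bar>k\<bar>" for t k
    using supp G that by auto
  have sdd: "dd t k = 0 \<and> G' t k = 0" if "t \<in> {0..T}" "k \<in> A" "int n < \<bar>k\<bar>" for t k
    using supp' G' that by auto
  define b1 where "b1 t = 25 * L powr (-1/8) * m * R0\<^sup>2 * (M * \<sigma> t * \<sigma> t)" for t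
  define b2 where "b2 t = 265 * L * m\<^sup>2 * R0\<^sup>2 * (M * \<sigma> t * \<sigma> t)
     + \<epsilon> * (2 * real n + 1) * R0\<^sup>2 * (M * \<sigma> t + M * \<sigma> t + \<sigma> t * \<sigma> t)" for t
  have cub_y: "\<exists>S S'. \<forall>t\<in>{0..T}. (S has_vector_derivative S' t) (at t within {0..T})
     \<and> cmod (S t) \<le> b1 t \<and> cmod (S' t - cubic A y q r t) \<le> b2 t"
    if "fam2 \<epsilon> \<sigma> q Gq" "fam2 \<epsilon> \<sigma> r Gr" "\<And>t k. t \<in> {0..T} \<Longrightarrow> k \<in> A \<Longrightarrow> int n < \<bar>k\<bar> \<Longrightarrow> r t k = 0 \<and> Gr t k = 0" for q Gq r Gr
    using cubic_normal_form[where n = n, OF y that(1) that(2) that(3) L1 \<epsilon>] unfolding b1_def b2_def by blast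
  \<comment> \<open>With \<open>h\<close> in the second slot the bounds contain
    \<open>\<eta>\<close> instead of \<open>\<sigma>\<close>; as \<open>\<eta>\<close> is at most
    \<open>\<sigma>\<close>, the same \<open>b1\<close> and \<open>b2\<close> serve.\<close>
  have cub_h: "\<exists>S S'. \<forall>t\<in>{0..T}. (S has_vector_derivative S' t) (at t within {0..T})
     \<and> cmod (S t) \<le> b1 t \<and> cmod (S' t - cubic A y h r t) \<le> b2 t"
    if r2: "fam2 \<epsilon> \<sigma> r Gr" and r0: "\<And>t k. t \<in> {0..T} \<Longrightarrow> k \<in> A \<Longrightarrow> int n < \<bar>k\<bar> \<Longrightarrow> r t k = 0 \<and> Gr t k = 0" for r Gr
  proof -
    have "25 * L powr (-1/8) * m * R0\<^sup>2 * (M * \<eta> * \<sigma> t) \<le> b1 t" for t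
      unfolding b1_def using \<sigma>0[of t] M0 \<eta>0 m_ge_1 by (intro mult_left_mono mult_right_mono) auto
    moreover have "265 * L * m\<^sup>2 * R0\<^sup>2 * (M * \<eta> * \<sigma> t)
     + \<epsilon> * (2 * real n + 1) * R0\<^sup>2 * (M * \<eta> + M * \<sigma> t + \<eta> * \<sigma> t) \<le> b2 t" for t
      unfolding b2_def using \<sigma>0[of t] M0 \<eta>0 m_ge_1 L1 \<epsilon>
      by (intro add_mono mult_left_mono mult_right_mono order_refl) auto
    moreover obtain S S' where "\<forall>t\<in>{0..T}. (S has_vector_derivative S' t) (at t within {0..T})
     \<and> cmod (S t) \<le> 25 * L powr (-1/8) * m * R0\<^sup>2 * (M * \<eta> * \<sigma> t)
     \<and> cmod (S' t - cubic A y h r t) \<le> 265 * L * m\<^sup>2 * R0\<^sup>2 * (M * \<eta> * \<sigma> t)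
         + \<epsilon> * (2 * real n + 1) * R0\<^sup>2 * (M * \<eta> + M * \<sigma> t + \<eta> * \<sigma> t)"
      using cubic_normal_form[where n = n, OF y h r2 r0 L1 \<epsilon>] by blast
    ultimately have "\<forall>t\<in>{0..T}. (S has_vector_derivative S' t) (at t within {0..T})
     \<and> cmod (S t) \<le> b1 t \<and> cmod (S' t - cubic A y h r t) \<le> b2 t"
      by (meson order_trans)
    then show ?thesis by (intro exI)
  qed
  obtain S1 S1' where S1: "\<And>t. t \<in> {0..T} \<Longrightarrow> (S1 has_vector_derivative S1' t) (at t within {0..T})
     \<and> cmod (S1 t) \<le> b1 t \<and> cmod (S1' t - cubic A y d dd t) \<le> b2 t"
    using cub_y[OF fd fdd sdd] by blast
  obtain S2 S2' where S2: "\<And>t. t \<in> {0..T} \<Longrightarrow> (S2 has_vector_derivative S2' t) (at t within {0..T})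
     \<and> cmod (S2 t) \<le> b1 t \<and> cmod (S2' t - cubic A y h dd t) \<le> b2 t"
    using cub_h[OF fdd sdd] by blast
  obtain S3 S3' where S3: "\<And>t. t \<in> {0..T} \<Longrightarrow> (S3 has_vector_derivative S3' t) (at t within {0..T})
     \<and> cmod (S3 t) \<le> b1 t \<and> cmod (S3' t - cubic A y dd d t) \<le> b2 t"
    using cub_y[OF fdd fd sd] by blast
  obtain S4 S4' where S4: "\<And>t. t \<in> {0..T} \<Longrightarrow> (S4 has_vector_derivative S4' t) (at t within {0..T})
     \<and> cmod (S4 t) \<le> b1 t \<and> cmod (S4' t - cubic A y h d t) \<le> b2 t"
    using cub_h[OF fd sd] by blast
  define E where "E t = (\<Sum>k\<in>A. d t k * dd t (- k))" for t
  have E_eq: "E t = of_real ((\<delta> t)\<^sup>2)" for t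
    by (simp add: E_def \<delta>_def L2_set_power2 dd complex_norm_square[symmetric])
  define F where "F t = (\<Sum>k\<in>A. of_int k * f t (- k) * dd t k) + (\<Sum>k\<in>A. of_int k * f' t (- k) * d t k)" for t
  define C where "C t = cubic A y d dd t + cubic A y h dd t + cubic A y dd d t + cubic A y h d t" for t
  have E_der: "(E has_vector_derivative (- (\<i> / 2) * C t - \<i> * F t)) (at t within {0..T})" if t: "t \<in> {0..T}" for t
  proof -
    have "(E has_vector_derivative (\<Sum>k\<in>A. d t k * (- \<i> * of_int ((-k)^3) * dd t (-k) + \<i> * of_int (-k) * G' t (-k))
        + (- \<i> * of_int (k^3) * d t k + \<i> * of_int k * G t k) * dd t (-k))) (at t within {0..T})"
      unfolding E_def[abs_def]
      by (intro has_vector_derivative_sum has_vector_derivative_mult der der' t uminus_A)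
    also have "(\<Sum>k\<in>A. d t k * (- \<i> * of_int ((-k)^3) * dd t (-k) + \<i> * of_int (-k) * G' t (-k))
        + (- \<i> * of_int (k^3) * d t k + \<i> * of_int k * G t k) * dd t (-k))
      = (\<Sum>k\<in>A. - \<i> * (of_int k * (G' t (-k) * d t k))) + (\<Sum>k\<in>A. \<i> * (of_int k * (G t k * dd t (-k))))"
      unfolding sum.distrib[symmetric] by (intro sum.cong refl) (simp add: algebra_simps)
    also have "(\<Sum>k\<in>A. \<i> * (of_int k * (G t k * dd t (-k)))) = (\<Sum>k\<in>A. - \<i> * (of_int k * (G t (-k) * dd t k)))"
      by (rule sum.reindex_bij_witness[of _ uminus uminus]) (auto simp: uminus_A)
    also have "(\<Sum>k\<in>A. - \<i> * (of_int k * (G t (-k) * dd t k)))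
       = (\<Sum>k\<in>A. - (\<i> / 2) * (of_int k * (cv A y d t (-k) * dd t k)) - (\<i> / 2) * (of_int k * (cv A y h t (-k) * dd t k))
           - \<i> * (of_int k * f t (-k) * dd t k))"
    proof (intro sum.cong refl)
      fix k assume k: "k \<in> A"
      show "- \<i> * (of_int k * (G t (-k) * dd t k)) = - (\<i> / 2) * (of_int k * (cv A y d t (-k) * dd t k)) - (\<i> / 2) * (of_int k * (cv A y h t (-k) * dd t k))
           - \<i> * (of_int k * f t (-k) * dd t k)"
        using supp'[of k t] by (cases "\<bar>k\<bar> \<le> int n") (simp_all only: G[OF t uminus_A[OF k]] abs_minus_cancel if_True half_expansion, simp)
    qed
    also have "\<dots> = - (\<i> / 2) * (cubic A y d dd t + cubic A y h dd t) - \<i> * (\<Sum>k\<in>A. of_int k * f t (- k) * dd t k)"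
      by (simp add: cubic_eq_sum_last sum_subtractf sum_negf sum_distrib_left distrib_left)
    also have "(\<Sum>k\<in>A. - \<i> * (of_int k * (G' t (-k) * d t k)))
       = (\<Sum>k\<in>A. - (\<i> / 2) * (of_int k * (cv A y dd t (-k) * d t k)) - (\<i> / 2) * (of_int k * (cv A y h t (-k) * d t k))
           - \<i> * (of_int k * f' t (-k) * d t k))"
    proof (intro sum.cong refl)
      fix k assume k: "k \<in> A"
      show "- \<i> * (of_int k * (G' t (-k) * d t k)) = - (\<i> / 2) * (of_int k * (cv A y dd t (-k) * d t k)) - (\<i> / 2) * (of_int k * (cv A y h t (-k) * d t k))
           - \<i> * (of_int k * f' t (-k) * d t k)"
        using supp[of k t] by (cases "\<bar>k\<bar> \<le> int n") (simp_all only: G'[OF t uminus_A[OF k]] abs_minus_cancel if_True half_expansion, simp)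
    qed
    also have "\<dots> = - (\<i> / 2) * (cubic A y dd d t + cubic A y h d t) - \<i> * (\<Sum>k\<in>A. of_int k * f' t (- k) * d t k)"
      by (simp add: cubic_eq_sum_last sum_subtractf sum_negf sum_distrib_left distrib_left)
    finally show ?thesis by (simp add: C_def F_def algebra_simps)
  qed
  \<comment> \<open>This constant absorbs the source \<open>h\<close> and the truncation errors, so
    that the corrected energy is nonnegative and obeys a homogeneous differential
    inequality.\<close>
  define c0 where "c0 = \<kappa>\<^sup>2 + \<epsilon>' * (M\<^sup>2 + 1)"
  define \<Phi> where "\<Phi> t = Re (E t + (\<i> / 2) * (S1 t + S2 t + S3 t + S4 t)) + c0" for t
  define \<Phi>' where "\<Phi>' t = Re (- (\<i> / 2) * C t - \<i> * F t + (\<i> / 2) * (S1' t + S2' t + S3' t + S4' t))" for t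
  have \<Phi>_der: "(\<Phi> has_vector_derivative \<Phi>' t) (at t within {0..T})" if t: "t \<in> {0..T}" for t
  proof -
    have "((\<lambda>t. E t + (\<i> / 2) * (S1 t + S2 t + S3 t + S4 t)) has_vector_derivative
        (- (\<i> / 2) * C t - \<i> * F t + (\<i> / 2) * (S1' t + S2' t + S3' t + S4' t))) (at t within {0..T})"
      using S1[OF t] S2[OF t] S3[OF t] S4[OF t]
      by (intro has_vector_derivative_add has_vector_derivative_mult_right E_der[OF t]) auto
    from bounded_linear.has_vector_derivative[OF bounded_linear_Re this]
    have "((\<lambda>t. Re (E t + (\<i> / 2) * (S1 t + S2 t + S3 t + S4 t)) + c0) has_vector_derivative (\<Phi>' t + 0)) (at t within {0..T})"
      unfolding \<Phi>'_def by (intro has_vector_derivative_add has_vector_derivative_const)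
    then show ?thesis by (simp add: \<Phi>_def[abs_def])
  qed
  have ss: "\<sigma> t * \<sigma> t \<le> 2 * (\<delta> t)\<^sup>2 + 2 * \<kappa>\<^sup>2" for t
    unfolding \<sigma>\<kappa> using zero_le_power2[of "\<delta> t - \<kappa>"] by (simp add: power2_eq_square algebra_simps)
  have \<Phi>_close: "\<bar>\<Phi> t - c0 - (\<delta> t)\<^sup>2\<bar> \<le> (\<delta> t)\<^sup>2 / 4 + \<kappa>\<^sup>2 / 4" if t: "t \<in> {0..T}" for t
  proof -
    have "\<bar>\<Phi> t - c0 - (\<delta> t)\<^sup>2\<bar> = \<bar>Re ((\<i> / 2) * (S1 t + S2 t + S3 t + S4 t))\<bar>"
      by (simp add: \<Phi>_def E_eq)
    also have "\<dots> \<le> cmod ((\<i> / 2) * (S1 t + S2 t + S3 t + S4 t))" by (rule abs_Re_le_cmod)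
    also have "\<dots> \<le> 2 * b1 t"
    proof -
      have "cmod (S1 t + S2 t + S3 t + S4 t) \<le> b1 t + b1 t + b1 t + b1 t"
        using S1[OF t] S2[OF t] S3[OF t] S4[OF t] by (intro norm_triangle_le add_mono) auto
      then show ?thesis by (simp add: norm_mult norm_divide)
    qed
    also have "\<dots> = 50 / (400 * m\<^sup>2 * R0\<^sup>2 + 1) * (m * M * R0\<^sup>2) * (\<sigma> t * \<sigma> t)"
      unfolding b1_def L_def cutoff_scale_powr by simp
    also have "\<dots> \<le> 1 / 8 * (\<sigma> t * \<sigma> t)"
    proof (intro mult_right_mono)
      have p: "0 < 400 * m\<^sup>2 * R0\<^sup>2 + 1" by (intro add_nonneg_pos) auto
      have "m * M \<le> m * m" using Mm m_ge_1 by (intro mult_left_mono) auto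
      then have "m * M * R0\<^sup>2 \<le> m\<^sup>2 * R0\<^sup>2" unfolding power2_eq_square[of m] by (intro mult_right_mono) auto
      \<comment> \<open>The origin of 400 in \<open>cutoff_scale\<close>: 50 = 2 * 25 bounds the
        total correction, and 1/8 is the fraction aimed at.\<close>
      then have "50 * (m * M * R0\<^sup>2) * 8 \<le> 400 * m\<^sup>2 * R0\<^sup>2 + 1" by simp
      then show "50 / (400 * m\<^sup>2 * R0\<^sup>2 + 1) * (m * M * R0\<^sup>2) \<le> 1 / 8"
        using p by (simp add: divide_simps)
    qed (use \<sigma>0 in auto)
    also have "\<dots> \<le> 1 / 8 * (2 * (\<delta> t)\<^sup>2 + 2 * \<kappa>\<^sup>2)" by (intro mult_left_mono ss) auto
    finally show ?thesis by simp
  qed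
  have c0_nonneg: "0 \<le> c0" "\<kappa>\<^sup>2 \<le> c0" "\<epsilon>' * (M\<^sup>2 + 1) \<le> c0" using \<epsilon>'0 by (auto simp: c0_def)
  have ss3: "\<sigma> t * \<sigma> t \<le> 3 * \<Phi> t" if t: "t \<in> {0..T}" for t
    using abs_le_D2[OF \<Phi>_close[OF t]] ss[of t] c0_nonneg zero_le_power2[of "\<delta> t"] zero_le_power2[of \<kappa>]
    by linarith
  have F_le: "cmod (F t) \<le> 2 * \<epsilon> * real n * (2 * real n + 1) * \<sigma> t" if t: "t \<in> {0..T}" for t
  proof -
    have one: "cmod (\<Sum>k\<in>A. of_int k * g t (- k) * r t k) \<le> \<epsilon> * real n * (2 * real n + 1) * \<sigma> t"
      if g: "\<And>k. k \<in> A \<Longrightarrow> cmod (g t k) \<le> \<epsilon>" and r: "\<And>k. int n < \<bar>k\<bar> \<Longrightarrow> r t k = 0"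
        and nr: "L2_set (\<lambda>k. cmod (r t k)) A = \<delta> t" for g r :: path
    proof -
      have "cmod (\<Sum>k\<in>A. of_int k * g t (- k) * r t k) \<le> (\<Sum>k\<in>A. (\<epsilon> * real n) * cmod (r t k))"
      proof (intro sum_norm_le)
        fix k assume k: "k \<in> A"
        show "cmod (of_int k * g t (- k) * r t k) \<le> (\<epsilon> * real n) * cmod (r t k)"
        proof (cases "int n < \<bar>k\<bar>")
          case False
          then have "real_of_int \<bar>k\<bar> \<le> real_of_int (int n)" by (subst of_int_le_iff) simp
          then have "real_of_int \<bar>k\<bar> * cmod (g t (- k)) \<le> real n * \<epsilon>"
            using g[OF uminus_A[OF k]] by (intro mult_mono) auto
          then have "real_of_int \<bar>k\<bar> * cmod (g t (- k)) * cmod (r t k) \<le> real n * \<epsilon> * cmod (r t k)"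
            by (intro mult_right_mono) auto
          then show ?thesis by (simp add: norm_mult mult_ac)
        qed (use r in simp)
      qed
      also have "\<dots> = (\<epsilon> * real n) * (\<Sum>k\<in>A. cmod (r t k))" by (simp add: sum_distrib_left)
      also have "\<dots> \<le> (\<epsilon> * real n) * ((2 * real n + 1) * L2_set (\<lambda>k. cmod (r t k)) A)"
        using \<epsilon> r by (intro mult_left_mono sum_low_modes_le) auto
      also have "\<dots> \<le> (\<epsilon> * real n) * ((2 * real n + 1) * \<sigma> t)"
        unfolding nr using \<epsilon> \<sigma>0(3)[of t] by (intro mult_left_mono) auto
      finally show ?thesis by (simp add: mult_ac)
    qed
    have "cmod (F t) \<le> \<epsilon> * real n * (2 * real n + 1) * \<sigma> t + \<epsilon> * real n * (2 * real n + 1) * \<sigma> t"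
      unfolding F_def
    proof (intro norm_triangle_mono one)
      show "L2_set (\<lambda>k. cmod (d t k)) A = \<delta> t" by (simp add: \<delta>_def)
    qed (fact f[OF t] f'[OF t] supp supp' ndd)+
    then show ?thesis by (simp add: mult_ac)
  qed
  have \<Phi>'_le: "\<bar>\<Phi>' t\<bar> \<le> growth_rate m * \<Phi> t" if t: "t \<in> {0..T}" for t
  proof -
    have "\<Phi>' t = Re ((\<i> / 2) * ((S1' t - cubic A y d dd t) + (S2' t - cubic A y h dd t)
       + (S3' t - cubic A y dd d t) + (S4' t - cubic A y h d t)) - \<i> * F t)"
      by (simp add: \<Phi>'_def C_def algebra_simps)
    then have "\<bar>\<Phi>' t\<bar> \<le> cmod ((\<i> / 2) * ((S1' t - cubic A y d dd t) + (S2' t - cubic A y h dd t)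
       + (S3' t - cubic A y dd d t) + (S4' t - cubic A y h d t)) - \<i> * F t)"
      using abs_Re_le_cmod by metis
    also have "\<dots> \<le> cmod ((\<i> / 2) * ((S1' t - cubic A y d dd t) + (S2' t - cubic A y h dd t)
       + (S3' t - cubic A y dd d t) + (S4' t - cubic A y h d t))) + cmod (\<i> * F t)"
      by (rule norm_triangle_ineq4)
    also have "\<dots> \<le> 2 * b2 t + 2 * \<epsilon> * real n * (2 * real n + 1) * \<sigma> t"
    proof (intro add_mono)
      have "cmod ((S1' t - cubic A y d dd t) + (S2' t - cubic A y h dd t)
       + (S3' t - cubic A y dd d t) + (S4' t - cubic A y h d t)) \<le> b2 t + b2 t + b2 t + b2 t"
        using S1[OF t] S2[OF t] S3[OF t] S4[OF t] by (intro norm_triangle_mono) auto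
      then show "cmod ((\<i> / 2) * ((S1' t - cubic A y d dd t) + (S2' t - cubic A y h dd t)
       + (S3' t - cubic A y dd d t) + (S4' t - cubic A y h d t))) \<le> 2 * b2 t"
        by (simp add: norm_mult norm_divide)
      show "cmod (\<i> * F t) \<le> 2 * \<epsilon> * real n * (2 * real n + 1) * \<sigma> t"
        using F_le[OF t] by (simp add: norm_mult)
    qed
    also have "\<dots> \<le> 530 * L * m^3 * R0\<^sup>2 * (\<sigma> t * \<sigma> t) + 2 * (\<sigma> t * \<sigma> t) + \<epsilon>' * (M\<^sup>2 + 1)"
    proof -
      define w where "w = \<epsilon> * (2 * real n + 1) * R0\<^sup>2"
      define v where "v = \<epsilon> * real n * (2 * real n + 1)"
      have w0: "0 \<le> w" "0 \<le> v" using \<epsilon> by (auto simp: w_def v_def)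
      have R1: "1 \<le> R0\<^sup>2" using R0_ge_1 by simp
      have n1: "2 * real n + 1 \<le> (2 * real n + 1)\<^sup>2" by (rule self_le_power) auto
      have "\<epsilon> * R0\<^sup>2 * (2 * real n + 1) \<le> \<epsilon> * R0\<^sup>2 * (2 * real n + 1)\<^sup>2"
        using \<epsilon> n1 by (intro mult_left_mono) auto
      then have w4: "4 * w \<le> \<epsilon>'" by (simp add: w_def \<epsilon>'_def mult_ac)
      have "real n * (2 * real n + 1) * 1 \<le> (2 * real n + 1) * (2 * real n + 1) * R0\<^sup>2"
        using R1 by (intro mult_mono) auto
      then have "\<epsilon> * (real n * (2 * real n + 1) * 1) \<le> \<epsilon> * ((2 * real n + 1) * (2 * real n + 1) * R0\<^sup>2)"
        using \<epsilon> by (intro mult_left_mono) auto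
      then have "4 * (\<epsilon> * (real n * (2 * real n + 1))) \<le> 4 * (\<epsilon> * ((2 * real n + 1) * (2 * real n + 1) * R0\<^sup>2))"
        by simp
      then have v4: "4 * v \<le> \<epsilon>'" by (simp only: v_def \<epsilon>'_def power2_eq_square mult_ac)
      have "M * (\<sigma> t * \<sigma> t) \<le> m * (\<sigma> t * \<sigma> t)" using Mm \<sigma>0[of t] by (intro mult_right_mono) auto
      then have "530 * L * m\<^sup>2 * R0\<^sup>2 * (M * (\<sigma> t * \<sigma> t)) \<le> 530 * L * m\<^sup>2 * R0\<^sup>2 * (m * (\<sigma> t * \<sigma> t))"
        using L1 by (intro mult_left_mono) auto
      then have p1: "530 * L * m\<^sup>2 * R0\<^sup>2 * (M * \<sigma> t * \<sigma> t) \<le> 530 * L * m^3 * R0\<^sup>2 * (\<sigma> t * \<sigma> t)"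
        by (simp add: power3_eq_cube power2_eq_square mult_ac)
      have ms: "2 * (M * \<sigma> t) \<le> M\<^sup>2 + \<sigma> t * \<sigma> t"
        using zero_le_power2[of "M - \<sigma> t"] by (simp add: power2_eq_square algebra_simps)
      have s1: "2 * \<sigma> t \<le> 1 + \<sigma> t * \<sigma> t"
        using zero_le_power2[of "1 - \<sigma> t"] by (simp add: power2_eq_square algebra_simps)
      have "2 * b2 t + 2 * \<epsilon> * real n * (2 * real n + 1) * \<sigma> t
        = 530 * L * m\<^sup>2 * R0\<^sup>2 * (M * \<sigma> t * \<sigma> t) + 2 * w * (2 * (M * \<sigma> t) + \<sigma> t * \<sigma> t) + v * (2 * \<sigma> t)"
        by (simp add: b2_def w_def v_def algebra_simps)
      also have "\<dots> \<le> 530 * L * m^3 * R0\<^sup>2 * (\<sigma> t * \<sigma> t) + 2 * w * ((M\<^sup>2 + \<sigma> t * \<sigma> t) + \<sigma> t * \<sigma> t) + v * (1 + \<sigma> t * \<sigma> t)"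
        using w0 by (intro add_mono p1 mult_left_mono add_right_mono ms s1) auto
      also have "\<dots> = 530 * L * m^3 * R0\<^sup>2 * (\<sigma> t * \<sigma> t) + (4 * w + v) * (\<sigma> t * \<sigma> t) + (2 * w * M\<^sup>2 + v)"
        by (simp add: algebra_simps)
      also have "\<dots> \<le> 530 * L * m^3 * R0\<^sup>2 * (\<sigma> t * \<sigma> t) + 2 * (\<sigma> t * \<sigma> t) + (\<epsilon>' * M\<^sup>2 + \<epsilon>')"
        using w0 w4 v4 \<epsilon>'0 \<sigma>0[of t] by (intro add_mono mult_right_mono order_refl) auto
      finally show ?thesis by (simp add: algebra_simps)
    qed
    also have "\<dots> \<le> (530 * L * m^3 * R0\<^sup>2 + 2) * (3 * \<Phi> t) + \<Phi> t"
    proof -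
      have "(530 * L * m^3 * R0\<^sup>2 + 2) * (\<sigma> t * \<sigma> t) \<le> (530 * L * m^3 * R0\<^sup>2 + 2) * (3 * \<Phi> t)"
        using L1 m_ge_1 by (intro mult_left_mono ss3[OF t]) auto
      moreover have "\<epsilon>' * (M\<^sup>2 + 1) \<le> \<Phi> t"
      proof -
        have "\<Phi> t \<ge> (\<delta> t)\<^sup>2 + c0 - ((\<delta> t)\<^sup>2 / 4 + \<kappa>\<^sup>2 / 4)" using abs_le_D2[OF \<Phi>_close[OF t]] by simp
        moreover have "0 \<le> (\<delta> t)\<^sup>2" "0 \<le> \<kappa>\<^sup>2" by auto
        ultimately show ?thesis unfolding c0_def by linarith
      qed
      ultimately show ?thesis by (simp add: algebra_simps)
    qed
    also have "\<dots> = growth_rate m * \<Phi> t" by (simp add: growth_rate_def L_def algebra_simps)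
    finally show ?thesis .
  qed
  have gr: "\<Phi> t \<le> exp (growth_rate m * \<bar>t - t0\<bar>) * \<Phi> t0"
    by (rule gronwall_two_sided[OF \<Phi>_der \<Phi>'_le t])
  \<comment> \<open>Up to \<open>c0\<close>, energy and corrected energy agree within a factor 2 in
    either direction; the two comparisons give the factor 4.\<close>
  have "(\<delta> t)\<^sup>2 \<le> 2 * \<Phi> t"
    using abs_le_D1[OF \<Phi>_close[OF t(2)]] abs_le_D2[OF \<Phi>_close[OF t(2)]] c0_nonneg zero_le_power2[of "\<delta> t"] zero_le_power2[of \<kappa>]
    by linarith
  also have "\<dots> \<le> 2 * (exp (growth_rate m * \<bar>t - t0\<bar>) * \<Phi> t0)" using gr by simp
  also have "\<dots> \<le> 2 * (exp (growth_rate m * \<bar>t - t0\<bar>) * (2 * ((\<delta> t0)\<^sup>2 + c0)))"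
  proof (intro mult_left_mono)
    have lin: "x \<le> 2 * (d + c)" if "x - c - d \<le> d / 4 + k / 4" "0 \<le> c" "k \<le> c" "0 \<le> d" for x c d k :: real
      using that by (simp add: field_simps)
    show "\<Phi> t0 \<le> 2 * ((\<delta> t0)\<^sup>2 + c0)"
      by (rule lin[OF abs_le_D1[OF \<Phi>_close[OF t(1)]] c0_nonneg(1,2)]) simp
  qed auto
  also have "\<dots> = 4 * exp (growth_rate m * \<bar>t - t0\<bar>) * ((\<delta> t0)\<^sup>2 + c0)" by simp
  finally show ?thesis unfolding \<delta>_def c0_def \<kappa>_def \<epsilon>'_def by (simp only: add.assoc)
qed

end

section \<open>Square-summable sequences\<close>

definition sqs :: "seq \<Rightarrow> bool" where
  "sqs p \<longleftrightarrow> (\<lambda>k. (cmod (p k))\<^sup>2) summable_on UNIV"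

definition l2n :: "seq \<Rightarrow> real" where
  "l2n p = sqrt (infsum (\<lambda>k. (cmod (p k))\<^sup>2) UNIV)"

definition hi :: "nat \<Rightarrow> seq \<Rightarrow> seq" where
  "hi n p k = (if int n < \<bar>k\<bar> then p k else 0)"

definition lo :: "nat \<Rightarrow> seq \<Rightarrow> seq" where
  "lo n p k = (if \<bar>k\<bar> \<le> int n then p k else 0)"

definition conv :: "seq \<Rightarrow> seq \<Rightarrow> seq" where
  "conv p q k = infsum (\<lambda>a. p a * q (k - a)) UNIV"

lemma l2n_nonneg [simp]: "0 \<le> l2n p"
  by (simp add: l2n_def infsum_nonneg)

lemma L2_set_le_l2n:
  assumes "sqs p" "finite F"
  shows "L2_set (\<lambda>k. cmod (p k)) F \<le> l2n p"
  unfolding L2_set_def l2n_def using assms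
  by (intro real_sqrt_le_mono finite_sum_le_infsum) (auto simp: sqs_def)

text \<open>Reduces estimates of infinite sums to finite sets, so that the inequalities for
  \<open>L2_set\<close> can be reused; summability comes along with the bound.\<close>

lemma sqs_l2n_boundI:
  assumes "\<And>F. finite F \<Longrightarrow> L2_set (\<lambda>k. cmod (p k)) F \<le> B"
  shows "sqs p" "l2n p \<le> B"
proof -
  have B: "0 \<le> B" using assms[of "{}"] by simp
  have le: "(\<Sum>k\<in>F. (cmod (p k))\<^sup>2) \<le> B\<^sup>2" if "finite F" for F
    using power_mono[OF assms[OF that], of 2] by (simp add: L2_set_power2)
  show s: "sqs p" unfolding sqs_def
    by (rule nonneg_bdd_above_summable_on) (auto intro!: bdd_aboveI[of _ "B\<^sup>2"] le)
  have "infsum (\<lambda>k. (cmod (p k))\<^sup>2) UNIV \<le> B\<^sup>2"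
    using s by (intro infsum_le_finite_sums le) (auto simp: sqs_def)
  then show "l2n p \<le> B" unfolding l2n_def using B by (simp add: real_le_lsqrt infsum_nonneg)
qed

lemma cmod_le_l2n: "sqs p \<Longrightarrow> cmod (p k) \<le> l2n p"
  using L2_set_le_l2n[of p "{k}"] by simp

lemma sqs_mono:
  assumes "sqs p" "\<And>k. cmod (q k) \<le> cmod (p k)"
  shows "sqs q" "l2n q \<le> l2n p"
proof -
  have "L2_set (\<lambda>k. cmod (q k)) F \<le> l2n p" if "finite F" for F
    using assms that by (intro order_trans[OF L2_set_mono L2_set_le_l2n[OF assms(1)]]) auto
  then show "sqs q" "l2n q \<le> l2n p" by (auto intro: sqs_l2n_boundI)
qed

lemma sqs_add:
  assumes "sqs p" "sqs q"
  shows "sqs (\<lambda>k. p k + q k)" "l2n (\<lambda>k. p k + q k) \<le> l2n p + l2n q"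
proof -
  have "L2_set (\<lambda>k. cmod (p k + q k)) F \<le> l2n p + l2n q" if "finite F" for F
  proof -
    have "L2_set (\<lambda>k. cmod (p k + q k)) F \<le> L2_set (\<lambda>k. cmod (p k) + cmod (q k)) F"
      by (intro L2_set_mono norm_triangle_ineq) auto
    also have "\<dots> \<le> L2_set (\<lambda>k. cmod (p k)) F + L2_set (\<lambda>k. cmod (q k)) F"
      by (rule L2_set_triangle_ineq)
    also have "\<dots> \<le> l2n p + l2n q" by (intro add_mono L2_set_le_l2n assms that)
    finally show ?thesis .
  qed
  then show "sqs (\<lambda>k. p k + q k)" "l2n (\<lambda>k. p k + q k) \<le> l2n p + l2n q" by (auto intro: sqs_l2n_boundI)
qed

lemma sqs_diff:
  assumes "sqs p" "sqs q"
  shows "sqs (\<lambda>k. p k - q k)" "l2n (\<lambda>k. p k - q k) \<le> l2n p + l2n q"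
proof -
  have m: "sqs (\<lambda>k. - q k)" "l2n (\<lambda>k. - q k) \<le> l2n q"
    using sqs_mono[OF assms(2), of "\<lambda>k. - q k"] by auto
  show "sqs (\<lambda>k. p k - q k)" "l2n (\<lambda>k. p k - q k) \<le> l2n p + l2n q"
    using sqs_add[OF assms(1) m(1)] m(2) by auto
qed

lemma sqs_hi: "sqs p \<Longrightarrow> sqs (hi n p)" "sqs p \<Longrightarrow> l2n (hi n p) \<le> l2n p"
  using sqs_mono[of p "hi n p"] by (auto simp: hi_def)

lemma sqs_lo: "sqs p \<Longrightarrow> sqs (lo n p)" "sqs p \<Longrightarrow> l2n (lo n p) \<le> l2n p"
  using sqs_mono[of p "lo n p"] by (auto simp: lo_def)

lemma sqs_zero: "sqs (\<lambda>k. 0)" "l2n (\<lambda>k. 0) = 0"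
  by (simp_all add: sqs_def l2n_def)

lemma hi_mono: "sqs p \<Longrightarrow> m \<le> n \<Longrightarrow> l2n (hi n p) \<le> l2n (hi m p)"
  by (rule sqs_mono(2)[OF sqs_hi(1)]) (auto simp: hi_def)

lemma hi_triangle:
  assumes "sqs p" "sqs q"
  shows "l2n (hi n p) \<le> l2n (\<lambda>k. p k - q k) + l2n (hi n q)"
proof -
  have d: "sqs (\<lambda>k. p k - q k)" by (rule sqs_diff[OF assms])
  have eq: "hi n p = (\<lambda>k. hi n (\<lambda>k. p k - q k) k + hi n q k)" by (auto simp: hi_def)
  have "l2n (hi n p) \<le> l2n (hi n (\<lambda>k. p k - q k)) + l2n (hi n q)"
    unfolding eq by (rule sqs_add(2)[OF sqs_hi(1)[OF d] sqs_hi(1)[OF assms(2)]])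
  also have "\<dots> \<le> l2n (\<lambda>k. p k - q k) + l2n (hi n q)" by (intro add_right_mono sqs_hi d)
  finally show ?thesis .
qed

lemma hi_small:
  assumes "sqs p" "0 < e"
  shows "\<exists>n. l2n (hi n p) \<le> e"
proof -
  let ?f = "\<lambda>k. (cmod (p k))\<^sup>2"
  have s: "?f summable_on UNIV" using assms by (simp add: sqs_def)
  obtain F where F: "finite F" "dist (sum ?f F) (infsum ?f UNIV) \<le> e\<^sup>2"
    using infsum_finite_approximation[OF s, of "e\<^sup>2"] assms(2) by auto
  obtain n where n: "\<And>k. k \<in> F \<Longrightarrow> \<bar>k\<bar> \<le> int n"
  proof -
    have "finite ((\<lambda>k. nat \<bar>k\<bar>) ` F)" using F by simp
    then obtain n where "\<forall>x\<in>(\<lambda>k. nat \<bar>k\<bar>) ` F. x \<le> n" by (meson finite_nat_set_iff_bounded_le)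
    then show ?thesis by (intro that[of n]) force
  qed
  have "L2_set (\<lambda>k. cmod (hi n p k)) H \<le> e" if H: "finite H" for H
  proof (rule L2_set_le_if_sum_le)
    have disj: "(H - F) \<inter> F = {}" by auto
    have "(\<Sum>k\<in>H. (cmod (hi n p k))\<^sup>2) = (\<Sum>k\<in>H - F. (cmod (hi n p k))\<^sup>2)"
      using H n by (intro sum.mono_neutral_right) (auto simp: hi_def dest!: n)
    also have "\<dots> \<le> (\<Sum>k\<in>H - F. ?f k)" by (intro sum_mono) (auto simp: hi_def)
    also have "\<dots> = sum ?f ((H - F) \<union> F) - sum ?f F"
      using H F disj by (subst sum.union_disjoint) auto
    also have "sum ?f ((H - F) \<union> F) \<le> infsum ?f UNIV"
      using H F s by (intro finite_sum_le_infsum) auto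
    also have "infsum ?f UNIV - sum ?f F \<le> e\<^sup>2" using F(2) by (simp add: dist_real_def abs_le_iff)
    finally show "(\<Sum>k\<in>H. (cmod (hi n p k))\<^sup>2) \<le> e\<^sup>2" by simp
  qed (use assms in simp)
  then show ?thesis using sqs_l2n_boundI(2) by blast
qed

section \<open>Convolutions of square-summable sequences\<close>

lemma conv_finite_bound:
  assumes "sqs p" "sqs q" "finite F"
  shows "(\<Sum>a\<in>F. cmod (p a * q (k - a))) \<le> l2n p * l2n q"
proof -
  have "(\<Sum>a\<in>F. cmod (p a * q (k - a))) = (\<Sum>a\<in>F. cmod (p a) * cmod (q (k - a)))"
    by (simp add: norm_mult)
  also have "\<dots> \<le> L2_set (\<lambda>a. cmod (p a)) F * L2_set (\<lambda>a. cmod (q (k - a))) F"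
    by (rule sum_mult_le_L2_set)
  also have "L2_set (\<lambda>a. cmod (q (k - a))) F = L2_set (\<lambda>a. cmod (q a)) ((\<lambda>a. k - a) ` F)"
    by (simp add: L2_set_def sum.reindex inj_on_def)
  also have "L2_set (\<lambda>a. cmod (p a)) F * L2_set (\<lambda>a. cmod (q a)) ((\<lambda>a. k - a) ` F) \<le> l2n p * l2n q"
    using assms by (intro mult_mono L2_set_le_l2n) auto
  finally show ?thesis .
qed

lemma conv_abs_summable:
  assumes "sqs p" "sqs q"
  shows "(\<lambda>a. cmod (p a * q (k - a))) summable_on UNIV"
  unfolding abs_summable_iff_bdd_above
  using conv_finite_bound[OF assms] by (intro bdd_aboveI[of _ "l2n p * l2n q"]) auto

lemma conv_summable: "sqs p \<Longrightarrow> sqs q \<Longrightarrow> (\<lambda>a. p a * q (k - a)) summable_on UNIV"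
  by (rule abs_summable_summable[OF conv_abs_summable])

lemma conv_bound:
  assumes "sqs p" "sqs q"
  shows "cmod (conv p q k) \<le> l2n p * l2n q"
proof -
  have "cmod (conv p q k) \<le> infsum (\<lambda>a. cmod (p a * q (k - a))) UNIV"
    unfolding conv_def by (rule norm_infsum_bound[OF conv_abs_summable[OF assms]])
  also have "\<dots> \<le> l2n p * l2n q"
    using conv_abs_summable[OF assms] by (intro infsum_le_finite_sums conv_finite_bound assms) auto
  finally show ?thesis .
qed

lemma conv_add_left:
  assumes "sqs p" "sqs p'" "sqs q"
  shows "conv (\<lambda>k. p k + p' k) q k = conv p q k + conv p' q k"
  unfolding conv_def using conv_summable[OF assms(1,3)] conv_summable[OF assms(2,3)]
  by (simp add: distrib_right infsum_add)

lemma conv_commute: "conv p q k = conv q p k"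
  unfolding conv_def
  by (rule infsum_reindex_bij_witness[of _ "\<lambda>a. k - a" "\<lambda>a. k - a"]) (auto simp: mult.commute)

lemma conv_add_right:
  assumes "sqs p" "sqs q" "sqs q'"
  shows "conv p (\<lambda>k. q k + q' k) k = conv p q k + conv p q' k"
  using conv_add_left[OF assms(2,3,1)] by (simp add: conv_commute[of p])

lemma conv_minus_left: "conv (\<lambda>k. - p k) q k = - conv p q k"
  unfolding conv_def by (simp add: infsum_uminus)

lemma hi_lo: "p = (\<lambda>k. hi n p k + lo n p k)"
  by (auto simp: hi_def lo_def)

lemma conv_split:
  assumes "sqs p" "sqs q"
  shows "conv p q k = conv (hi n p) q k + conv (lo n p) (hi n q) k + conv (lo n p) (lo n q) k"
proof -
  have "conv p q k = conv (hi n p) q k + conv (lo n p) q k"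
    using conv_add_left[OF sqs_hi(1)[OF assms(1)] sqs_lo(1)[OF assms(1)] assms(2), of n n k] by (simp flip: hi_lo)
  also have "conv (lo n p) q k = conv (lo n p) (hi n q) k + conv (lo n p) (lo n q) k"
    using conv_add_right[OF sqs_lo(1)[OF assms(1)] sqs_hi(1)[OF assms(2)] sqs_lo(1)[OF assms(2)], of n n n k] by (simp flip: hi_lo)
  finally show ?thesis by simp
qed

lemma conv_lo_lo_eq_0:
  assumes "2 * int n < \<bar>k\<bar>"
  shows "conv (lo n p) (lo n q) k = 0"
proof -
  have "lo n p a * lo n q (k - a) = 0" for a using assms by (auto simp: lo_def)
  then show ?thesis unfolding conv_def by (simp only: infsum_0)
qed

text \<open>Two frequencies of modulus at most n cannot add up to k, so every surviving product has
  a factor in a tail. This doubling of the threshold is the source of the cutoffs 2 r and 4 r used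
  later.\<close>

lemma conv_high_bound:
  assumes "sqs p" "sqs q" "2 * int n < \<bar>k\<bar>" "l2n (hi n p) \<le> \<tau>" "l2n (hi n q) \<le> \<tau>" "l2n p \<le> M" "l2n q \<le> M"
  shows "cmod (conv p q k) \<le> 2 * M * \<tau>"
proof -
  have M0: "0 \<le> M" "0 \<le> \<tau>" using assms l2n_nonneg order_trans by blast+
  have "conv p q k = conv (hi n p) q k + conv (lo n p) (hi n q) k"
    using conv_split[OF assms(1,2), of k n] conv_lo_lo_eq_0[OF assms(3)] by simp
  also have "cmod \<dots> \<le> \<tau> * M + M * \<tau>"
  proof (intro norm_triangle_le add_mono)
    show "cmod (conv (hi n p) q k) \<le> \<tau> * M"
      using assms M0 by (intro order_trans[OF conv_bound mult_mono]) (auto simp: sqs_hi)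
    have "l2n (lo n p) \<le> M" using sqs_lo(2)[OF assms(1)] assms(6) order_trans by blast
    then show "cmod (conv (lo n p) (hi n q) k) \<le> M * \<tau>"
      using assms M0 by (intro order_trans[OF conv_bound mult_mono]) (auto simp: sqs_hi sqs_lo)
  qed
  finally show ?thesis by (simp add: mult_ac)
qed

section \<open>Truncation to finitely many frequencies and uniform tails\<close>

definition freqs :: "nat \<Rightarrow> int set" where
  "freqs N = {- int N..int N} - {0}"

lemma freqs_iff: "k \<in> freqs N \<longleftrightarrow> k \<noteq> 0 \<and> \<bar>k\<bar> \<le> int N"
  by (auto simp: freqs_def)

lemma freq_set_freqs: "freq_set (freqs N)"
proof
  show "uminus ` freqs N = freqs N"
  proof
    show "freqs N \<subseteq> uminus ` freqs N"
    proof
      fix x assume "x \<in> freqs N"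
      then have "- x \<in> freqs N" by (simp add: freqs_iff)
      then show "x \<in> uminus ` freqs N" by force
    qed
  qed (auto simp: freqs_iff)
qed (auto simp: freqs_def)

lemma conv_lo_lo_eq_cv:
  assumes "p t 0 = 0" "q t 0 = 0"
  shows "conv (lo N (p t)) (lo N (q t)) k = cv (freqs N) p q t k"
proof -
  have "conv (lo N (p t)) (lo N (q t)) k = infsum (\<lambda>x. p t x * q t (k - x)) {x\<in>freqs N. k - x \<in> freqs N}"
    unfolding conv_def using assms
    by (intro infsum_cong_neutral) (auto simp: lo_def freqs_iff)
  also have "\<dots> = cv (freqs N) p q t k"
    unfolding cv_def by (rule infsum_finite) (rule finite_subset[of _ "freqs N"], auto simp: freqs_def)
  finally show ?thesis .
qed

text \<open>What truncation omits are products with at least one frequency beyond N. The bound is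
  uniform in k but does not decay in k, which is why later estimates keep one factor on low
  modes.\<close>

lemma conv_cv_error:
  assumes "p t 0 = 0" "q t 0 = 0" "sqs (p t)" "sqs (q t)"
    "l2n (hi N (p t)) \<le> \<tau>" "l2n (hi N (q t)) \<le> \<tau>" "l2n (p t) \<le> M" "l2n (q t) \<le> M"
  shows "cmod (conv (p t) (q t) k - cv (freqs N) p q t k) \<le> 2 * M * \<tau>"
proof -
  have M0: "0 \<le> M" "0 \<le> \<tau>" using assms l2n_nonneg order_trans by blast+
  have "conv (p t) (q t) k - cv (freqs N) p q t k = conv (hi N (p t)) (q t) k + conv (lo N (p t)) (hi N (q t)) k"
    using conv_split[OF assms(3,4), of k N] conv_lo_lo_eq_cv[where N = N and k = k, of p t q, OF assms(1,2)] by simp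
  also have "cmod \<dots> \<le> \<tau> * M + M * \<tau>"
  proof (intro norm_triangle_le add_mono)
    show "cmod (conv (hi N (p t)) (q t) k) \<le> \<tau> * M"
      using assms M0 by (intro order_trans[OF conv_bound mult_mono]) (auto simp: sqs_hi)
    have "l2n (lo N (p t)) \<le> M" using sqs_lo(2)[OF assms(3)] assms(7) order_trans by blast
    then show "cmod (conv (lo N (p t)) (hi N (q t)) k) \<le> M * \<tau>"
      using assms M0 by (intro order_trans[OF conv_bound mult_mono]) (auto simp: sqs_hi sqs_lo)
  qed
  finally show ?thesis by (simp add: mult_ac)
qed

text \<open>Compactness of the time interval: times with large tails at ever higher cutoffs
  accumulate at some t, and l2 continuity at t together with the small tail of the single sequence
  there gives a contradiction.\<close>

lemma uniform_tails:
  fixes T e :: real and v :: path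
  assumes sq: "\<And>t. t \<in> {0..T} \<Longrightarrow> sqs (v t)"
    and cont: "\<And>t. t \<in> {0..T} \<Longrightarrow> ((\<lambda>s. l2n (\<lambda>k. v s k - v t k)) \<longlongrightarrow> 0) (at t within {0..T})"
    and e: "0 < e"
  shows "\<exists>n. \<forall>t\<in>{0..T}. l2n (hi n (v t)) \<le> e"
proof (rule ccontr)
  assume "\<not> ?thesis"
  then have "\<forall>n. \<exists>t. t \<in> {0..T} \<and> e < l2n (hi n (v t))" by (metis not_le)
  then obtain s where s: "\<And>n. s n \<in> {0..T}" "\<And>n. e < l2n (hi n (v (s n)))" by metis
  obtain t r where t: "t \<in> {0..T}" and r: "strict_mono r" "(s \<circ> r) \<longlonglongrightarrow> t"
    using s(1) compact_Icc[of 0 T] unfolding compact_def by metis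
  define \<phi> where "\<phi> x = l2n (\<lambda>k. v x k - v t k)" for x
  have "\<phi> t = 0" by (simp add: \<phi>_def sqs_zero)
  then have "continuous (at t within {0..T}) \<phi>"
    using cont[OF t] unfolding continuous_within \<phi>_def[abs_def] by (simp add: sqs_zero)
  then have "(\<phi> \<circ> (s \<circ> r)) \<longlonglongrightarrow> \<phi> t"
    using s(1) r(2) unfolding continuous_within_sequentially by auto
  then have "(\<lambda>j. \<phi> (s (r j))) \<longlonglongrightarrow> 0" using \<open>\<phi> t = 0\<close> by (simp add: o_def)
  then have "eventually (\<lambda>j. \<phi> (s (r j)) < e / 2) sequentially"
    using e by (intro order_tendstoD(2)[of _ 0]) auto
  then obtain J where J: "\<And>j. J \<le> j \<Longrightarrow> \<phi> (s (r j)) < e / 2" by (auto simp: eventually_sequentially)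
  obtain n where n: "l2n (hi n (v t)) \<le> e / 2" using hi_small[OF sq[OF t], of "e / 2"] e by auto
  define j where "j = max J n"
  have "l2n (hi (r j) (v (s (r j)))) \<le> \<phi> (s (r j)) + l2n (hi (r j) (v t))"
    unfolding \<phi>_def by (intro hi_triangle sq s t)
  \<comment> \<open>A strictly increasing index sequence satisfies j <= r j, so the cutoff r j lies
    beyond n.\<close>
  also have "l2n (hi (r j) (v t)) \<le> l2n (hi n (v t))"
    using seq_suble[OF r(1), of j] by (intro hi_mono sq t) (simp add: j_def)
  finally have "l2n (hi (r j) (v (s (r j)))) < e" using J[of j] n by (simp add: j_def)
  then show False using s(2)[of "r j"] by simp
qed

section \<open>Solutions without oscillating phases\<close>

text \<open>The equation is imposed mode by mode, and the forcing \<open>g\<close> is left open so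
  that a solution, a sum and a difference of two solutions all fit. No regularity in k is demanded
  beyond square summability.\<close>

definition curve :: "real \<Rightarrow> real \<Rightarrow> path \<Rightarrow> path \<Rightarrow> bool" where
  "curve T M p g \<longleftrightarrow> (\<forall>t\<in>{0..T}. sqs (p t) \<and> l2n (p t) \<le> M \<and> p t 0 = 0 \<and> (\<forall>k. p t (- k) = cnj (p t k))
     \<and> (\<forall>k. ((\<lambda>s. p s k) has_vector_derivative (- \<i> * of_int (k^3) * p t k + \<i> * of_int k * g t k)) (at t within {0..T})))"

definition tight :: "real \<Rightarrow> path \<Rightarrow> bool" where
  "tight T p \<longleftrightarrow> (\<forall>e>0. \<exists>n. \<forall>t\<in>{0..T}. l2n (hi n (p t)) \<le> e)"

text \<open>Undoes the substitution v k = exp (i k^3 t) u k: the result is the Fourier coefficient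
  of the KdV solution itself.\<close>

definition modulate :: "path \<Rightarrow> path" where
  "modulate v t k = exp (- (\<i> * of_int (k^3) * of_real t)) * v t k"

lemma curveD:
  assumes "curve T M p g" "t \<in> {0..T}"
  shows "sqs (p t)" "l2n (p t) \<le> M" "p t 0 = 0" "p t (- k) = cnj (p t k)"
    "((\<lambda>s. p s k) has_vector_derivative (- \<i> * of_int (k^3) * p t k + \<i> * of_int k * g t k)) (at t within {0..T})"
  using assms by (auto simp: curve_def)

lemma cmod_modulate [simp]: "cmod (modulate v t k) = cmod (v t k)"
  by (simp add: modulate_def norm_mult)

lemma modulate_at_0 [simp]: "modulate v t 0 = v t 0"
  by (simp add: modulate_def)

lemma sqs_modulate [simp]: "sqs (modulate v t) = sqs (v t)"
  by (simp add: sqs_def)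

lemma l2n_modulate [simp]: "l2n (modulate v t) = l2n (v t)"
  by (simp add: l2n_def)

lemma l2n_hi_modulate: "l2n (hi n (modulate v t)) = l2n (hi n (v t))"
proof -
  have "cmod (hi n (modulate v t) k) = cmod (hi n (v t) k)" for k by (simp add: hi_def)
  then show ?thesis by (simp add: l2n_def)
qed

lemma in_Hdot_0D:
  assumes "in_Hdot 0 p"
  shows "sqs p" "p 0 = 0" "p (- k) = cnj (p k)"
proof -
  have "(\<lambda>k. (real_of_int \<bar>k\<bar> powr (2 * 0)) * (cmod (p k))\<^sup>2) summable_on Z0"
    using assms by (simp add: in_Hdot_def)
  also have "?this \<longleftrightarrow> (\<lambda>k. (cmod (p k))\<^sup>2) summable_on UNIV"
    using assms by (intro summable_on_cong_neutral) (auto simp: Z0_def in_Hdot_def)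
  finally show "sqs p" by (simp add: sqs_def)
qed (use assms in \<open>auto simp: in_Hdot_def\<close>)

lemma hnorm_0_eq:
  assumes "p 0 = 0"
  shows "hnorm 0 p = l2n p"
proof -
  have "hnorm2 0 p = infsum (\<lambda>k. (cmod (p k))\<^sup>2) UNIV"
    unfolding hnorm2_def using assms by (intro infsum_cong_neutral) (auto simp: Z0_def)
  then show ?thesis by (simp add: hnorm_def l2n_def)
qed

text \<open>The oscillating factor is accounted for by k^3 - a^3 - (k - a)^3 = 3 k a (k - a). The
  terms a = 0 and a = k, excluded from \<open>kdv_rhs\<close>, vanish in the convolution because the
  mean is zero.\<close>

lemma kdv_rhs_eq_conv:
  assumes "v t 0 = 0"
  shows "conv (modulate v t) (modulate v t) k = exp (- (\<i> * of_int (k^3) * of_real t)) * kdv_rhs (v t) k t"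
proof -
  have ph: "exp (- (\<i> * of_int (a^3) * of_real t)) * exp (- (\<i> * of_int ((k-a)^3) * of_real t))
     = exp (- (\<i> * of_int (k^3) * of_real t)) * exp (\<i> * of_real (3 * real_of_int k * real_of_int a * real_of_int (k - a) * t))" for a
  proof -
    have "- (\<i> * of_int (a^3) * of_real t) + - (\<i> * of_int ((k-a)^3) * of_real t)
       = - (\<i> * of_int (k^3) * of_real t) + \<i> * of_real (3 * real_of_int k * real_of_int a * real_of_int (k - a) * t)"
      by (simp add: power3_eq_cube algebra_simps)
    then show ?thesis unfolding exp_add[symmetric] by (rule arg_cong)
  qed
  have "conv (modulate v t) (modulate v t) k
     = infsum (\<lambda>a. modulate v t a * modulate v t (k - a)) {k1. k1 \<noteq> 0 \<and> k1 \<noteq> k}"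
    unfolding conv_def using assms by (intro infsum_cong_neutral) (auto simp: modulate_def)
  also have "\<dots> = infsum (\<lambda>a. exp (- (\<i> * of_int (k^3) * of_real t)) *
       (exp (\<i> * of_real (3 * real_of_int k * real_of_int a * real_of_int (k - a) * t)) * v t a * v t (k - a))) {k1. k1 \<noteq> 0 \<and> k1 \<noteq> k}"
  proof (intro infsum_cong)
    fix a
    have "modulate v t a * modulate v t (k - a) = (exp (- (\<i> * of_int (a^3) * of_real t)) * exp (- (\<i> * of_int ((k-a)^3) * of_real t))) * v t a * v t (k - a)"
      by (simp add: modulate_def mult_ac)
    then show "modulate v t a * modulate v t (k - a) = exp (- (\<i> * of_int (k^3) * of_real t)) *
       (exp (\<i> * of_real (3 * real_of_int k * real_of_int a * real_of_int (k - a) * t)) * v t a * v t (k - a))"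
      unfolding ph by (simp only: mult.assoc)
  qed
  also have "\<dots> = exp (- (\<i> * of_int (k^3) * of_real t)) * kdv_rhs (v t) k t"
    unfolding kdv_rhs_def by (rule infsum_cmult_right')
  finally show ?thesis .
qed

text \<open>To differentiate the integral equation at every time, the integrand must be continuous
  in time. Truncated convolutions are finite sums of continuous functions, and uniform tails make
  them converge uniformly in time. The initial values are recovered for nonzero k only, since the
  integral equation is silent about k = 0.\<close>

lemma solution_curve:
  assumes sol: "is_solution T v0 v" and T: "0 \<le> T"
  obtains B where "curve T B (modulate v) (\<lambda>t k. conv (modulate v t) (modulate v t) k / 2)" "tight T (modulate v)"
    "\<And>k. k \<noteq> 0 \<Longrightarrow> v 0 k = v0 k"
proof -
  let ?u = "modulate v"
  have H: "in_Hdot 0 (v t)" if "t \<in> {0..T}" for t using sol that by (simp add: is_solution_def)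
  have "\<exists>B. \<forall>t\<in>{0..T}. hnorm 0 (v t) \<le> B" using sol by (simp add: is_solution_def)
  then obtain B where B: "\<And>t. t \<in> {0..T} \<Longrightarrow> hnorm 0 (v t) \<le> B" by blast
  have sq: "sqs (v t)" and z: "v t 0 = 0" and re: "\<And>k. v t (- k) = cnj (v t k)" if "t \<in> {0..T}" for t
    using in_Hdot_0D[OF H[OF that]] by auto
  have B': "l2n (v t) \<le> B" if "t \<in> {0..T}" for t using B[OF that] z[OF that] by (simp add: hnorm_0_eq)
  have cont: "((\<lambda>s. l2n (\<lambda>k. v s k - v t k)) \<longlongrightarrow> 0) (at t within {0..T})" if t: "t \<in> {0..T}" for t
  proof -
    have "((\<lambda>s. hnorm 0 (v s - v t)) \<longlongrightarrow> 0) (at t within {0..T})" using sol t by (simp add: is_solution_def)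
    moreover have "eventually (\<lambda>s. hnorm 0 (v s - v t) = l2n (\<lambda>k. v s k - v t k)) (at t within {0..T})"
      unfolding eventually_at_filter
    proof (intro always_eventually allI impI)
      fix s assume "s \<in> {0..T}"
      moreover have "v s - v t = (\<lambda>k. v s k - v t k)" by (simp add: fun_eq_iff)
      ultimately show "hnorm 0 (v s - v t) = l2n (\<lambda>k. v s k - v t k)"
        using z t by (simp add: hnorm_0_eq)
    qed
    ultimately show ?thesis by (simp add: tendsto_cong)
  qed
  have tails: "\<exists>n. \<forall>t\<in>{0..T}. l2n (hi n (v t)) \<le> e" if "0 < e" for e
    by (rule uniform_tails[OF sq cont that])
  have tight: "tight T ?u"
    unfolding tight_def l2n_hi_modulate using tails by blast
  have cont_k: "continuous_on {0..T} (\<lambda>s. v s k)" for k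
    unfolding continuous_on_def
  proof
    fix t assume t: "t \<in> {0..T}"
    have "((\<lambda>s. v s k - v t k) \<longlongrightarrow> 0) (at t within {0..T})"
    proof (rule tendsto_0_le[OF cont[OF t], of _ 1])
      show "eventually (\<lambda>s. norm (v s k - v t k) \<le> norm (l2n (\<lambda>k. v s k - v t k)) * 1) (at t within {0..T})"
        unfolding eventually_at_filter
      proof (intro always_eventually allI impI)
        fix s assume s: "s \<in> {0..T}"
        have "sqs (\<lambda>k. v s k - v t k)" by (intro sqs_diff sq s t)
        from cmod_le_l2n[OF this, of k] show "norm (v s k - v t k) \<le> norm (l2n (\<lambda>k. v s k - v t k)) * 1" by simp
      qed
    qed
    then show "((\<lambda>s. v s k) \<longlongrightarrow> v t k) (at t within {0..T})" by (simp add: Lim_null[of _ "v t k"])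
  qed
  have cont_u: "continuous_on {0..T} (\<lambda>s. ?u s k)" for k
    unfolding modulate_def by (intro continuous_intros cont_k)
  have cont_conv: "continuous_on {0..T} (\<lambda>t. conv (?u t) (?u t) k)" for k
  proof -
    have "uniform_limit {0..T} (\<lambda>N t. cv (freqs N) ?u ?u t k) (\<lambda>t. conv (?u t) (?u t) k) sequentially"
      unfolding uniform_limit_iff
    proof (intro allI impI)
      fix e :: real assume e: "0 < e"
      \<comment> \<open>The maximum with 1 keeps the divisor in the choice of \<open>n\<close>
        positive.\<close>
      define B1 where "B1 = max B 1"
      have B1: "0 < B1" "B \<le> B1" by (auto simp: B1_def)
      obtain n where n: "\<And>t. t \<in> {0..T} \<Longrightarrow> l2n (hi n (v t)) \<le> e / (4 * B1)"
        using tails[of "e / (4 * B1)"] e B1 by (meson divide_pos_pos mult_pos_pos zero_less_numeral)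
      show "\<forall>\<^sub>F N in sequentially. \<forall>t\<in>{0..T}. dist (cv (freqs N) ?u ?u t k) (conv (?u t) (?u t) k) < e"
        unfolding eventually_sequentially
      proof (intro exI[of _ n] allI impI ballI)
        fix N t assume N: "n \<le> N" and t: "t \<in> {0..T}"
        have h: "l2n (hi N (?u t)) \<le> e / (4 * B1)"
          unfolding l2n_hi_modulate using hi_mono[OF sq[OF t] N] n[OF t] by linarith
        have "cmod (conv (?u t) (?u t) k - cv (freqs N) ?u ?u t k) \<le> 2 * B1 * (e / (4 * B1))"
          using h z[OF t] sq[OF t] B'[OF t] B1 by (intro conv_cv_error) auto
        also have "\<dots> = e / 2" using B1 by simp
        also have "\<dots> < e" using e by simp
        finally show "dist (cv (freqs N) ?u ?u t k) (conv (?u t) (?u t) k) < e"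
          by (simp add: dist_norm norm_minus_commute)
      qed
    qed
    then show ?thesis
      by (rule uniform_limit_theorem[rotated]) (auto simp: cv_def intro!: always_eventually continuous_intros cont_u)
  qed
  have rhs_eq: "kdv_rhs (v t) k t = exp (\<i> * of_int (k^3) * of_real t) * conv (?u t) (?u t) k" if "t \<in> {0..T}" for t k
    unfolding kdv_rhs_eq_conv[of v, OF z[OF that]] by (simp add: mult.assoc[symmetric] exp_add[symmetric])
  have cont_rhs: "continuous_on {0..T} (\<lambda>t. kdv_rhs (v t) k t)" for k
  proof -
    have "continuous_on {0..T} (\<lambda>t. exp (\<i> * of_int (k^3) * of_real t) * conv (?u t) (?u t) k)"
      by (intro continuous_intros cont_conv)
    then show ?thesis by (rule continuous_on_eq) (rule rhs_eq[symmetric])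
  qed
  have eqn: "v t k = v0 k + (1/2) * \<i> * of_int k * integral {0..t} (\<lambda>\<tau>. kdv_rhs (v \<tau>) k \<tau>)" if "k \<noteq> 0" "t \<in> {0..T}" for t k
  proof -
    have "v t k - v0 k = (1/2) * \<i> * of_int k * integral {0..t} (\<lambda>\<tau>. kdv_rhs (v \<tau>) k \<tau>)"
      using sol that unfolding is_solution_def Z0_def by blast
    then show ?thesis by (metis diff_eq_eq add.commute)
  qed
  have dv: "((\<lambda>s. v s k) has_vector_derivative ((1/2) * \<i> * of_int k * kdv_rhs (v t) k t)) (at t within {0..T})" if t: "t \<in> {0..T}" for t k
  proof (cases "k = 0")
    case True
    have "((\<lambda>s. 0) has_vector_derivative ((1/2) * \<i> * of_int k * kdv_rhs (v t) k t)) (at t within {0..T})"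
      using True by simp
    from has_vector_derivative_transform[OF t _ this, of "\<lambda>s. v s k"] show ?thesis using True z by simp
  next
    case False
    have "((\<lambda>s. v0 k + (1/2) * \<i> * of_int k * integral {0..s} (\<lambda>\<tau>. kdv_rhs (v \<tau>) k \<tau>)) has_vector_derivative (0 + (1/2) * \<i> * of_int k * kdv_rhs (v t) k t)) (at t within {0..T})"
      by (intro has_vector_derivative_add has_vector_derivative_const has_vector_derivative_mult_right integral_has_vector_derivative cont_rhs t)
    from has_vector_derivative_transform[OF t _ this, of "\<lambda>s. v s k"] show ?thesis using eqn[OF False] by simp
  qed
  have du: "((\<lambda>s. ?u s k) has_vector_derivative (- \<i> * of_int (k^3) * ?u t k + \<i> * of_int k * (conv (?u t) (?u t) k / 2))) (at t within {0..T})"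
    if t: "t \<in> {0..T}" for t k
  proof -
    have de: "((\<lambda>s. exp (- (\<i> * of_int (k^3) * of_real s))) has_vector_derivative (- (\<i> * of_int (k^3)) * exp (- (\<i> * of_int (k^3) * of_real t)))) (at t within {0..T})"
    proof -
      have "((\<lambda>z. exp (- (\<i> * of_int (k^3) * z))) has_field_derivative (- (\<i> * of_int (k^3)) * exp (- (\<i> * of_int (k^3) * of_real t)))) (at (of_real t))"
        by (rule derivative_eq_intros refl | simp)+
      from has_vector_derivative_real_field[OF this] show ?thesis by (rule has_vector_derivative_at_within)
    qed
    show ?thesis unfolding modulate_def[of v _ k]
      by (rule has_vector_derivative_eq_rhs[OF has_vector_derivative_mult[OF de dv[OF t]]])
        (simp add: kdv_rhs_eq_conv[of v, OF z[OF t]] algebra_simps)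
  qed
  have "curve T B ?u (\<lambda>t k. conv (?u t) (?u t) k / 2)"
    unfolding curve_def
  proof (intro ballI conjI allI)
    fix t k assume t: "t \<in> {0..T}"
    show "?u t (- k) = cnj (?u t k)"
      by (simp add: modulate_def re[OF t] exp_cnj)
  qed (use sq B' z du in auto)
  moreover have "v 0 k = v0 k" if "k \<noteq> 0" for k using eqn[OF that, of 0] T by simp
  ultimately show ?thesis using tight that by blast
qed

section \<open>Sum and difference of two solutions\<close>

text \<open>An arbitrary projection in frequency, so that full sequences, low parts and tails share
  the lemmas on families.\<close>

definition cut :: "(int \<Rightarrow> bool) \<Rightarrow> path \<Rightarrow> path" where
  "cut P p t k = (if P k then p t k else 0)"

lemma cut_True [simp]: "cut (\<lambda>_. True) p = p"
  by (simp add: cut_def fun_eq_iff)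

lemma cut_hi: "cut (\<lambda>k. int n < \<bar>k\<bar>) p t = hi n (p t)"
  by (simp add: cut_def hi_def fun_eq_iff)

lemma cut_lo: "cut (\<lambda>k. \<bar>k\<bar> \<le> int n) p t = lo n (p t)"
  by (simp add: cut_def lo_def fun_eq_iff)

lemma sqs_cut: "sqs (p t) \<Longrightarrow> sqs (cut P p t)" "sqs (p t) \<Longrightarrow> l2n (cut P p t) \<le> l2n (p t)"
  using sqs_mono[of "p t" "cut P p t"] by (auto simp: cut_def)

lemma hi_cut_le: "sqs (p t) \<Longrightarrow> l2n (hi n (cut P p t)) \<le> l2n (hi n (p t))"
  by (rule sqs_mono(2)[OF sqs_hi(1)]) (auto simp: hi_def cut_def)

context kdv_frame
begin

lemma cut_fam:
  assumes p: "curve T M p g"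
    and n: "\<And>t. t \<in> {0..T} \<Longrightarrow> L2_set (\<lambda>k. cmod (cut P p t k)) A \<le> \<sigma>"
    and g: "\<And>t k. t \<in> {0..T} \<Longrightarrow> P k \<Longrightarrow> cmod (g t k) \<le> m * \<sigma>"
  shows "fam (\<lambda>_. \<sigma>) (cut P p) (cut P g)"
  unfolding fam_def
proof (intro ballI conjI)
  fix t k assume t: "t \<in> {0..T}" and k: "k \<in> A"
  have \<sigma>: "0 \<le> \<sigma>" using n[OF t] order_trans[OF L2_set_nonneg] by blast
  show "cmod (cut P g t k) \<le> m * \<sigma>" using g[OF t, of k] \<sigma> m_ge_1 by (simp add: cut_def)
  show "((\<lambda>s. cut P p s k) has_vector_derivative - \<i> * of_int (k^3) * cut P p t k + \<i> * of_int k * cut P g t k) (at t within {0..T})"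
    using curveD(5)[OF p t, of k] by (cases "P k") (simp_all add: cut_def)
qed (use n in auto)

lemma cut_fam2:
  assumes f: "fam (\<lambda>_. \<sigma>) (cut P p) (cut P g)"
    and fs: "fam (\<lambda>_. \<sigma>a) pa Ga" "fam (\<lambda>_. \<sigma>b) pb Gb" "fam (\<lambda>_. \<sigma>c) pc Gc" "fam (\<lambda>_. \<sigma>d) pd Gd"
    and s: "\<sigma>a * \<sigma>b \<le> m * \<sigma>" "\<sigma>c * \<sigma>d \<le> m * \<sigma>"
    and er: "\<And>t k. t \<in> {0..T} \<Longrightarrow> P k \<Longrightarrow> cmod (g t k - (cv A pa pb t k + cv A pc pd t k) / 2) \<le> \<epsilon>"
    and \<epsilon>: "0 \<le> \<epsilon>"
  shows "fam2 \<epsilon> (\<lambda>_. \<sigma>) (cut P p) (cut P g)"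
  unfolding fam2_def
proof (intro conjI f exI)
  show "fam (\<lambda>_. \<sigma>a) pa Ga" "fam (\<lambda>_. \<sigma>b) pb Gb" "fam (\<lambda>_. \<sigma>c) pc Gc" "fam (\<lambda>_. \<sigma>d) pd Gd" by (rule fs)+
  show "\<forall>t\<in>{0..T}. \<sigma>a * \<sigma>b \<le> m * \<sigma> \<and> \<sigma>c * \<sigma>d \<le> m * \<sigma>" using s by simp
  show "\<forall>k. cmod (if P k then 1/2 else (0::complex)) \<le> 1" by simp
  show "\<forall>t\<in>{0..T}. \<forall>k\<in>A. cut P g t k = (if P k then 1/2 else 0) * (cv A pa pb t k + cv A pc pd t k)
     + (if P k then g t k - (cv A pa pb t k + cv A pc pd t k) / 2 else 0)
     \<and> cmod (if P k then g t k - (cv A pa pb t k + cv A pc pd t k) / 2 else 0) \<le> \<epsilon>"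
    using er \<epsilon> by (auto simp: cut_def)
qed

text \<open>Zero paths fill the second product of a forcing that has only one; in the form
  \<open>zero_fam2\<close> they also stand for an absent source.\<close>

lemma zero_fam: "fam (\<lambda>_. 0) (\<lambda>_ _. 0) (\<lambda>_ _. 0)"
  unfolding fam_def by (simp add: L2_set_def)

lemma zero_fam2: "0 \<le> \<epsilon> \<Longrightarrow> fam2 \<epsilon> (\<lambda>_. 0) (\<lambda>_ _. 0) (\<lambda>_ _. 0)"
  using cut_fam2[OF _ zero_fam zero_fam zero_fam zero_fam, of 0 "\<lambda>_. True" "\<lambda>_ _. 0" "\<lambda>_ _. 0" \<epsilon>]
  by (simp add: zero_fam cv_def)

end

text \<open>One bound on the sum of the two norms controls v, w, their sum and their difference at
  once. In the end it is supplied by the initial data, through the mass estimate.\<close>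

locale kdv_pair =
  fixes T M :: real and v w :: path
  assumes T0: "0 \<le> T" and M0: "0 \<le> M"
    and v: "curve T M v (\<lambda>t k. conv (v t) (v t) k / 2)" and w: "curve T M w (\<lambda>t k. conv (w t) (w t) k / 2)"
    and v_tight: "tight T v" and w_tight: "tight T w"
    and norm_sum: "\<And>t. t \<in> {0..T} \<Longrightarrow> l2n (v t) + l2n (w t) \<le> M"
begin

definition y :: path where "y t k = v t k + w t k"
definition z :: path where "z t k = v t k - w t k"
definition gy :: path where "gy t k = (conv (v t) (v t) k + conv (w t) (w t) k) / 2"
definition gz :: path where "gz t k = conv (y t) (z t) k / 2"

lemma y_fun: "y t = (\<lambda>k. v t k + w t k)" and z_fun: "z t = (\<lambda>k. v t k - w t k)"
  by (simp_all add: y_def z_def fun_eq_iff)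

text \<open>The cross terms cancel by commutativity. This makes the equation for the difference
  linear, with the sum of the solutions as coefficient.\<close>

lemma conv_yz:
  assumes t: "t \<in> {0..T}"
  shows "conv (y t) (z t) k = conv (v t) (v t) k - conv (w t) (w t) k"
proof -
  have s: "sqs (v t)" "sqs (w t)" by (rule curveD[OF v t] curveD[OF w t])+
  have sm: "sqs (\<lambda>k. - w t k)" using sqs_mono[OF s(2), of "\<lambda>k. - w t k"] by simp
  have "conv (y t) (z t) k = conv (v t) (z t) k + conv (w t) (z t) k"
    unfolding y_fun using s by (intro conv_add_left) (simp_all add: z_fun sqs_diff)
  also have "conv (v t) (z t) k = conv (v t) (v t) k + conv (v t) (\<lambda>k. - w t k) k"
    using conv_add_right[OF s(1) s(1) sm] by (simp add: z_fun)
  also have "conv (w t) (z t) k = conv (w t) (v t) k + conv (w t) (\<lambda>k. - w t k) k"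
    using conv_add_right[OF s(2) s(1) sm] by (simp add: z_fun)
  also have "conv (v t) (\<lambda>k. - w t k) k = - conv (w t) (v t) k"
    by (subst conv_commute) (rule conv_minus_left)
  also have "conv (w t) (\<lambda>k. - w t k) k = - conv (w t) (w t) k"
    by (subst conv_commute) (rule conv_minus_left)
  finally show ?thesis by simp
qed

lemma y_curve: "curve T M y gy"
  unfolding curve_def
proof (intro ballI conjI allI)
  fix t k assume t: "t \<in> {0..T}"
  note V = curveD[OF v t] and W = curveD[OF w t]
  show "sqs (y t)" unfolding y_fun by (intro sqs_add V W)
  show "l2n (y t) \<le> M" unfolding y_fun using sqs_add(2)[OF V(1) W(1)] norm_sum[OF t] by linarith
  show "y t 0 = 0" using V(3) W(3) by (simp add: y_def)
  show "y t (- k) = cnj (y t k)" using V(4) W(4) by (simp add: y_def)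
  show "((\<lambda>s. y s k) has_vector_derivative - \<i> * of_int (k^3) * y t k + \<i> * of_int k * gy t k) (at t within {0..T})"
    unfolding y_def by (rule has_vector_derivative_eq_rhs[OF has_vector_derivative_add[OF V(5) W(5)]])
      (simp add: gy_def algebra_simps add_divide_distrib)
qed

lemma z_curve: "curve T M z gz"
  unfolding curve_def
proof (intro ballI conjI allI)
  fix t k assume t: "t \<in> {0..T}"
  note V = curveD[OF v t] and W = curveD[OF w t]
  show "sqs (z t)" unfolding z_fun by (intro sqs_diff V W)
  show "l2n (z t) \<le> M" unfolding z_fun using sqs_diff(2)[OF V(1) W(1)] norm_sum[OF t] by linarith
  show "z t 0 = 0" using V(3) W(3) by (simp add: z_def)
  show "z t (- k) = cnj (z t k)" using V(4) W(4) by (simp add: z_def)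
  show "((\<lambda>s. z s k) has_vector_derivative - \<i> * of_int (k^3) * z t k + \<i> * of_int k * gz t k) (at t within {0..T})"
    unfolding z_def by (rule has_vector_derivative_eq_rhs[OF has_vector_derivative_diff[OF V(5) W(5)]])
      (simp add: gz_def conv_yz[OF t] algebra_simps diff_divide_distrib z_def)
qed

lemma common_tail:
  assumes e: "0 < e"
  shows "\<exists>r0. \<forall>r\<ge>r0. \<forall>t\<in>{0..T}. l2n (hi r (v t)) \<le> e \<and> l2n (hi r (w t)) \<le> e \<and> l2n (hi r (y t)) \<le> e \<and> l2n (hi r (z t)) \<le> e"
proof -
  obtain n1 where n1: "\<And>t. t \<in> {0..T} \<Longrightarrow> l2n (hi n1 (v t)) \<le> e / 2"
    using v_tight e unfolding tight_def by (meson half_gt_zero)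
  obtain n2 where n2: "\<And>t. t \<in> {0..T} \<Longrightarrow> l2n (hi n2 (w t)) \<le> e / 2"
    using w_tight e unfolding tight_def by (meson half_gt_zero)
  show ?thesis
  proof (intro exI[of _ "max n1 n2"] allI impI ballI)
    fix r t assume r: "max n1 n2 \<le> r" and t: "t \<in> {0..T}"
    note V = curveD[OF v t] and W = curveD[OF w t]
    have a: "l2n (hi r (v t)) \<le> e / 2"
      using hi_mono[OF V(1), of n1 r] n1[OF t] r by simp
    have b: "l2n (hi r (w t)) \<le> e / 2"
      using hi_mono[OF W(1), of n2 r] n2[OF t] r by simp
    have "hi r (y t) = (\<lambda>k. hi r (v t) k + hi r (w t) k)" "hi r (z t) = (\<lambda>k. hi r (v t) k - hi r (w t) k)"
      by (auto simp: hi_def y_def z_def)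
    then have "l2n (hi r (y t)) \<le> e" "l2n (hi r (z t)) \<le> e"
      using sqs_add(2)[OF sqs_hi(1)[OF V(1)] sqs_hi(1)[OF W(1)], of r r]
        sqs_diff(2)[OF sqs_hi(1)[OF V(1)] sqs_hi(1)[OF W(1)], of r r] a b by simp_all
    then show "l2n (hi r (v t)) \<le> e \<and> l2n (hi r (w t)) \<le> e \<and> l2n (hi r (y t)) \<le> e \<and> l2n (hi r (z t)) \<le> e"
      using a b e by simp
  qed
qed

end

text \<open>Two scales. \<open>r\<close> determines the low modes that are followed and leaves the
  tail \<open>\<tau>\<close>; \<open>N\<close> is the finite frame in which all sums are taken, with
  error \<open>\<epsilon>\<close>. For fixed \<open>r\<close> and \<open>\<tau>\<close>,
  \<open>\<epsilon>\<close> can be made arbitrarily small.\<close>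

locale kdv_pair_trunc = kdv_pair +
  fixes N r :: nat and \<tau> \<epsilon> :: real
  assumes tail_r: "\<And>t. t \<in> {0..T} \<Longrightarrow> l2n (hi r (v t)) \<le> \<tau> \<and> l2n (hi r (w t)) \<le> \<tau> \<and> l2n (hi r (y t)) \<le> \<tau> \<and> l2n (hi r (z t)) \<le> \<tau>"
    and tail_N: "\<And>t. t \<in> {0..T} \<Longrightarrow> l2n (hi N (v t)) \<le> \<epsilon> \<and> l2n (hi N (w t)) \<le> \<epsilon> \<and> l2n (hi N (y t)) \<le> \<epsilon> \<and> l2n (hi N (z t)) \<le> \<epsilon>"

text \<open>The value 2 M + 1 is at least 1 and dominates the constant 2 M of the high-frequency
  bound on convolutions.\<close>

sublocale kdv_pair_trunc \<subseteq> kdv_frame "freqs N" T "2 * M + 1"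
proof -
  interpret freq_set "freqs N" by (rule freq_set_freqs)
  show "kdv_frame (freqs N) T (2 * M + 1)"
    by unfold_locales (use T0 M0 in auto)
qed

context kdv_pair_trunc
begin

abbreviation "A \<equiv> freqs N"
abbreviation "m \<equiv> 2 * M + 1"

lemma \<tau>0: "0 \<le> \<tau>" and \<epsilon>0: "0 \<le> \<epsilon>"
  using tail_r[of 0] tail_N[of 0] T0 order_trans[OF l2n_nonneg] by auto

lemma M_le: "M \<le> m" and MM_le: "M * M \<le> m * M"
  using M0 by (auto intro: mult_right_mono)

lemma curve_L2:
  assumes "curve T M p g" "t \<in> {0..T}"
  shows "L2_set (\<lambda>k. cmod (cut P p t k)) A \<le> M"
proof -
  have "L2_set (\<lambda>k. cmod (cut P p t k)) A \<le> l2n (cut P p t)"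
    by (intro L2_set_le_l2n sqs_cut curveD[OF assms] finite_A)
  also have "\<dots> \<le> l2n (p t)" by (intro sqs_cut curveD[OF assms])
  also have "\<dots> \<le> M" by (rule curveD[OF assms])
  finally show ?thesis .
qed

lemma conv_le_MM:
  assumes "sqs p" "sqs q" "l2n p \<le> M" "l2n q \<le> M"
  shows "cmod (conv p q k) \<le> M * M"
  using assms M0 by (intro order_trans[OF conv_bound mult_mono]) auto

lemma half_sum_le: "cmod a \<le> B \<Longrightarrow> cmod b \<le> B \<Longrightarrow> cmod ((a + b) / 2) \<le> B"
  using norm_triangle_ineq[of a b] by (simp add: norm_divide)

lemma half_le: "cmod a \<le> B \<Longrightarrow> cmod (a / 2) \<le> B"
  by (rule order_trans[of _ "cmod a"]) (simp_all add: norm_divide)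

lemma gy_le: "t \<in> {0..T} \<Longrightarrow> cmod (gy t k) \<le> M * M"
  unfolding gy_def by (intro half_sum_le conv_le_MM) (auto intro: curveD[OF v] curveD[OF w])

lemma gz_le: "t \<in> {0..T} \<Longrightarrow> cmod (gz t k) \<le> M * M"
  unfolding gz_def by (intro half_le conv_le_MM) (auto intro: curveD[OF y_curve] curveD[OF z_curve])

lemma v_fam: "fam (\<lambda>_. M) v (\<lambda>t k. conv (v t) (v t) k / 2)"
proof -
  have "cmod (conv (v t) (v t) k / 2) \<le> m * M" if "t \<in> {0..T}" for t k
    using that by (intro order_trans[OF half_le[OF conv_le_MM] MM_le]) (auto intro: curveD[OF v])
  then show ?thesis using cut_fam[OF v curve_L2[OF v], where P = "\<lambda>_. True"] by simp
qed

lemma w_fam: "fam (\<lambda>_. M) w (\<lambda>t k. conv (w t) (w t) k / 2)"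
proof -
  have "cmod (conv (w t) (w t) k / 2) \<le> m * M" if "t \<in> {0..T}" for t k
    using that by (intro order_trans[OF half_le[OF conv_le_MM] MM_le]) (auto intro: curveD[OF w])
  then show ?thesis using cut_fam[OF w curve_L2[OF w], where P = "\<lambda>_. True"] by simp
qed

lemma y_fam: "fam (\<lambda>_. M) (cut P y) (cut P gy)"
  by (rule cut_fam[OF y_curve curve_L2[OF y_curve]]) (auto intro: order_trans[OF gy_le MM_le])

lemma z_fam: "fam (\<lambda>_. M) (cut P z) (cut P gz)"
  by (rule cut_fam[OF z_curve curve_L2[OF z_curve]]) (auto intro: order_trans[OF gz_le MM_le])

abbreviation "er \<equiv> 2 * M * \<epsilon>"

lemma er0: "0 \<le> er" using M0 \<epsilon>0 by simp

lemma conv_cut_error: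
  assumes p: "curve T M p g" and q: "curve T M q g'" and t: "t \<in> {0..T}"
    and "l2n (hi N (p t)) \<le> \<epsilon>" "l2n (hi N (q t)) \<le> \<epsilon>"
  shows "cmod (conv (cut P p t) (cut Q q t) k - cv A (cut P p) (cut Q q) t k) \<le> er"
proof (rule conv_cv_error)
  show "cut P p t 0 = 0" "cut Q q t 0 = 0" using curveD(3)[OF p t] curveD(3)[OF q t] by (simp_all add: cut_def)
  show "sqs (cut P p t)" "sqs (cut Q q t)" by (intro sqs_cut curveD[OF p t] curveD[OF q t])+
  show "l2n (hi N (cut P p t)) \<le> \<epsilon>" "l2n (hi N (cut Q q t)) \<le> \<epsilon>"
    using hi_cut_le[of p t N P] hi_cut_le[of q t N Q] curveD(1)[OF p t] curveD(1)[OF q t] assms by (auto intro: order_trans)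
  show "l2n (cut P p t) \<le> M" "l2n (cut Q q t) \<le> M"
    using sqs_cut(2)[of p t P] sqs_cut(2)[of q t Q] curveD(1,2)[OF p t] curveD(1,2)[OF q t] by (auto intro: order_trans)
qed

lemma conv_error:
  assumes p: "curve T M p g" and q: "curve T M q g'" and t: "t \<in> {0..T}"
    and "l2n (hi N (p t)) \<le> \<epsilon>" "l2n (hi N (q t)) \<le> \<epsilon>"
  shows "cmod (conv (p t) (q t) k - cv A p q t k) \<le> er"
  using conv_cut_error[OF assms, of "\<lambda>_. True" "\<lambda>_. True"] by simp

text \<open>The sum of two solutions obeys no closed equation: its forcing is the half sum of v * v
  and w * w, two products whose factors are families of their own.\<close>

lemma y_fam2: "fam2 er (\<lambda>_. M) (cut P y) (cut P gy)"
proof (rule cut_fam2[OF y_fam v_fam v_fam w_fam w_fam MM_le MM_le _ er0])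
  fix t k assume t: "t \<in> {0..T}"
  have "gy t k - (cv A v v t k + cv A w w t k) / 2 = ((conv (v t) (v t) k - cv A v v t k) + (conv (w t) (w t) k - cv A w w t k)) / 2"
    by (simp add: gy_def field_simps)
  also have "cmod \<dots> \<le> er"
    using tail_N[OF t] by (intro half_sum_le conv_error[OF v v t] conv_error[OF w w t]) auto
  finally show "cmod (gy t k - (cv A v v t k + cv A w w t k) / 2) \<le> er" .
qed

lemma z_fam2: "fam2 er (\<lambda>_. M) (cut P z) (cut P gz)"
proof (rule cut_fam2[OF z_fam _ _ zero_fam zero_fam MM_le _ _ er0])
  show "fam (\<lambda>_. M) y gy" "fam (\<lambda>_. M) z gz" using y_fam[of "\<lambda>_. True"] z_fam[of "\<lambda>_. True"] by simp_all
  show "(0::real) * 0 \<le> m * M" using M0 by simp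
  fix t k assume t: "t \<in> {0..T}"
  have "gz t k - (cv A y z t k + cv A (\<lambda>_ _. 0) (\<lambda>_ _. 0) t k) / 2 = (conv (y t) (z t) k - cv A y z t k) / 2"
    by (simp add: gz_def cv_def diff_divide_distrib)
  also have "cmod \<dots> \<le> er"
    using tail_N[OF t] by (intro half_le conv_error[OF y_curve z_curve t]) auto
  finally show "cmod (gz t k - (cv A y z t k + cv A (\<lambda>_ _. 0) (\<lambda>_ _. 0) t k) / 2) \<le> er" .
qed

lemma tail_L2:
  assumes p: "curve T M p g" and t: "t \<in> {0..T}" and "l2n (hi r (p t)) \<le> \<tau>" "r \<le> n"
  shows "L2_set (\<lambda>k. cmod (cut (\<lambda>k. int n < \<bar>k\<bar>) p t k)) A \<le> \<tau>"
proof -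
  have "L2_set (\<lambda>k. cmod (cut (\<lambda>k. int n < \<bar>k\<bar>) p t k)) A \<le> l2n (hi n (p t))"
    unfolding cut_hi by (intro L2_set_le_l2n sqs_hi curveD[OF p t] finite_A)
  also have "\<dots> \<le> l2n (hi r (p t))" by (intro hi_mono curveD[OF p t] assms)
  finally show ?thesis using assms(3) by simp
qed

lemma MT_le: "2 * M * \<tau> \<le> m * \<tau>" "M * \<tau> \<le> m * \<tau>" "\<tau> * M \<le> m * \<tau>"
  using M0 \<tau>0 by (auto simp: algebra_simps intro: mult_right_mono add_increasing)

text \<open>A tail is a family of size \<open>\<tau>\<close> only if its forcing is that small too.
  Between r and 2 r the low modes may still interact and produce a forcing of order M * M, hence the
  threshold 2 r.\<close>

lemma y_tail_fam: "fam (\<lambda>_. \<tau>) (cut (\<lambda>k. int (2*r) < \<bar>k\<bar>) y) (cut (\<lambda>k. int (2*r) < \<bar>k\<bar>) gy)"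
proof (rule cut_fam[OF y_curve])
  fix t k assume t: "t \<in> {0..T}"
  show "L2_set (\<lambda>k. cmod (cut (\<lambda>k. int (2*r) < \<bar>k\<bar>) y t k)) A \<le> \<tau>"
    using tail_r[OF t] by (intro tail_L2[OF y_curve t]) auto
  assume k: "int (2*r) < \<bar>k\<bar>"
  have "cmod (gy t k) \<le> 2 * M * \<tau>"
    unfolding gy_def using k tail_r[OF t]
    by (intro half_sum_le conv_high_bound) (auto intro: curveD[OF v t] curveD[OF w t])
  then show "cmod (gy t k) \<le> m * \<tau>" using MT_le(1) by linarith
qed

lemma gz_high: "t \<in> {0..T} \<Longrightarrow> int (2*r) < \<bar>k\<bar> \<Longrightarrow> cmod (gz t k) \<le> m * \<tau>"
proof -
  assume t: "t \<in> {0..T}" and k: "int (2*r) < \<bar>k\<bar>"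
  have "cmod (gz t k) \<le> 2 * M * \<tau>"
    unfolding gz_def using k tail_r[OF t]
    by (intro half_le conv_high_bound) (auto intro: curveD[OF y_curve t] curveD[OF z_curve t])
  then show "cmod (gz t k) \<le> m * \<tau>" using MT_le(1) by linarith
qed

lemma z_tail_fam:
  assumes "2 * r \<le> n"
  shows "fam (\<lambda>_. \<tau>) (cut (\<lambda>k. int n < \<bar>k\<bar>) z) (cut (\<lambda>k. int n < \<bar>k\<bar>) gz)"
proof (rule cut_fam[OF z_curve])
  fix t k assume t: "t \<in> {0..T}"
  show "L2_set (\<lambda>k. cmod (cut (\<lambda>k. int n < \<bar>k\<bar>) z t k)) A \<le> \<tau>"
    using tail_r[OF t] assms by (intro tail_L2[OF z_curve t]) auto
  assume k: "int n < \<bar>k\<bar>"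
  then have "int (2*r) < \<bar>k\<bar>" using assms by simp
  then show "cmod (gz t k) \<le> m * \<tau>" by (rule gz_high[OF t])
qed

abbreviation "high \<equiv> (\<lambda>k. int (4*r) < \<bar>k\<bar>)"
abbreviation "low \<equiv> (\<lambda>k. \<bar>k\<bar> \<le> int (4*r))"

text \<open>Beyond 4 r the forcing splits into the tail of y above 2 r times z, plus the rest of y
  times the tail of z above 2 r. Each product has one factor of size \<open>\<tau>\<close>, and both
  tails are families of that size; this second doubling of the threshold explains 4 r.\<close>

lemma z_tail_fam2: "fam2 er (\<lambda>_. \<tau>) (cut high z) (cut high gz)"
proof (rule cut_fam2[OF z_tail_fam _ _ _ _ _ _ _ er0])
  let ?h = "\<lambda>k. int (2*r) < \<bar>k\<bar>" and ?l = "\<lambda>k. \<bar>k\<bar> \<le> int (2*r)"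
  show "fam (\<lambda>_. \<tau>) (cut ?h y) (cut ?h gy)" by (rule y_tail_fam)
  show "fam (\<lambda>_. M) z gz" using z_fam[of "\<lambda>_. True"] by simp
  show "fam (\<lambda>_. M) (cut ?l y) (cut ?l gy)" by (rule y_fam)
  show "fam (\<lambda>_. \<tau>) (cut ?h z) (cut ?h gz)" by (rule z_tail_fam) simp
  show "\<tau> * M \<le> m * \<tau>" "M * \<tau> \<le> m * \<tau>" by (rule MT_le)+
  fix t k assume t: "t \<in> {0..T}" and k: "high k"
  have "conv (y t) (z t) k = conv (hi (2*r) (y t)) (z t) k + conv (lo (2*r) (y t)) (hi (2*r) (z t)) k"
    using conv_split[OF curveD(1)[OF y_curve t] curveD(1)[OF z_curve t], of k "2*r"]
      conv_lo_lo_eq_0[of "2*r" k "y t" "z t"] k by simp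
  then have eq: "conv (y t) (z t) k = conv (cut ?h y t) (cut (\<lambda>_. True) z t) k + conv (cut ?l y t) (cut ?h z t) k"
    by (simp only: cut_hi cut_lo cut_True)
  have "gz t k - (cv A (cut ?h y) z t k + cv A (cut ?l y) (cut ?h z) t k) / 2
    = ((conv (cut ?h y t) (cut (\<lambda>_. True) z t) k - cv A (cut ?h y) (cut (\<lambda>_. True) z) t k)
      + (conv (cut ?l y t) (cut ?h z t) k - cv A (cut ?l y) (cut ?h z) t k)) / 2"
    unfolding gz_def eq by (simp add: field_simps)
  also have "cmod \<dots> \<le> er"
    using tail_N[OF t] by (intro half_sum_le conv_cut_error[OF y_curve z_curve t]) auto
  finally show "cmod (gz t k - (cv A (cut ?h y) z t k + cv A (cut ?l y) (cut ?h z) t k) / 2) \<le> er" .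
qed simp

end

section \<open>Conservation of mass\<close>

lemma bounded_increment:
  fixes f f' :: "real \<Rightarrow> complex"
  assumes der: "\<And>t. t \<in> {0..T} \<Longrightarrow> (f has_vector_derivative f' t) (at t within {0..T})"
    and bd: "\<And>t. t \<in> {0..T} \<Longrightarrow> cmod (f' t) \<le> D" and t: "t \<in> {0..T}"
  shows "cmod (f t - f 0) \<le> D * T"
proof -
  have D: "0 \<le> D" using bd[OF t] order_trans[OF norm_ge_zero] by blast
  have "cmod (f t - f 0) \<le> D * norm (t - 0)"
  proof (rule differentiable_bound[of "{0..T}" f "\<lambda>t x. x *\<^sub>R f' t"])
    show "(f has_derivative (\<lambda>x. x *\<^sub>R f' s)) (at s within {0..T})" if "s \<in> {0..T}" for s
      using der[OF that] by (simp add: has_vector_derivative_def)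
    show "onorm (\<lambda>x. x *\<^sub>R f' s) \<le> D" if "s \<in> {0..T}" for s
    proof (rule onorm_bound[OF D])
      show "norm (x *\<^sub>R f' s) \<le> D * norm x" for x
        using mult_left_mono[OF bd[OF that], of "\<bar>x\<bar>"] by (simp add: mult.commute)
    qed
  qed (use t in auto)
  also have "\<dots> \<le> D * T" using t D by (intro mult_left_mono) auto
  finally show ?thesis .
qed

context kdv_frame
begin

text \<open>By symmetry the weight c may be replaced by a third of a + b + c, which is zero. This is
  conservation of mass for the truncated nonlinearity.\<close>

lemma cubic_diagonal_eq_0: "cubic A l l l t = 0"
proof -
  define P where "P = (\<lambda>(a,b,c). l t a * l t b * l t c)"
  have c1: "cubic A l l l t = (\<Sum>(a,b,c)\<in>zero_triples A. of_int a * P (a,b,c))"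
    unfolding cubic_def P_def
    by (rule sum.reindex_bij_witness[of _ "\<lambda>(a,b,c). (c,b,a)" "\<lambda>(a,b,c). (c,b,a)"]) (auto simp: zero_triples_def mult_ac)
  have c2: "cubic A l l l t = (\<Sum>(a,b,c)\<in>zero_triples A. of_int b * P (a,b,c))"
    unfolding cubic_def P_def
    by (rule sum.reindex_bij_witness[of _ "\<lambda>(a,b,c). (a,c,b)" "\<lambda>(a,b,c). (a,c,b)"]) (auto simp: zero_triples_def mult_ac)
  have c3: "cubic A l l l t = (\<Sum>(a,b,c)\<in>zero_triples A. of_int c * P (a,b,c))"
    unfolding cubic_def P_def by (intro sum.cong) auto
  have "cubic A l l l t + cubic A l l l t + cubic A l l l t
     = (\<Sum>(a,b,c)\<in>zero_triples A. of_int a * P (a,b,c)) + (\<Sum>(a,b,c)\<in>zero_triples A. of_int b * P (a,b,c))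
       + (\<Sum>(a,b,c)\<in>zero_triples A. of_int c * P (a,b,c))"
    by (simp only: c1[symmetric] c2[symmetric] c3[symmetric])
  also have "\<dots> = (\<Sum>(a,b,c)\<in>zero_triples A. of_int (a + b + c) * P (a,b,c))"
    by (simp add: sum.distrib[symmetric] case_prod_unfold algebra_simps)
  also have "\<dots> = 0" by (rule sum.neutral) (auto simp: zero_triples_def simp del: of_int_add)
  finally show ?thesis by simp
qed

end

lemma double_half_expansion:
  fixes c x y z e w :: complex
  shows "- \<i> * (c * ((x + y + z + e) / 2 * w)) + - \<i> * (c * ((x + y + z + e) / 2 * w))
    = - \<i> * (c * (x * w)) + - \<i> * (c * (y * w)) + - \<i> * (c * (z * w)) + - \<i> * (c * e * w)"
  by (simp add: algebra_simps add_divide_distrib)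

context kdv_pair_trunc
begin

lemma cv_split:
  "cv A z z t k = cv A (cut high z) z t k + cv A (cut low z) (cut high z) t k + cv A (cut low z) (cut low z) t k"
  unfolding cv_def sum.distrib[symmetric]
  by (intro sum.cong refl) (auto simp: cut_def not_less algebra_simps)

text \<open>The self-interaction of the low modes does not change their mass, so each remaining
  cubic sum has a factor in the tail and carries a factor \<open>\<tau>\<close>. With smallness from
  this source the normal form is used with \<open>L\<close> = 1. The constants 100 = 4 * 25 and 530
  = 2 * 265 come from two corrections at two times and from two remainders.\<close>

lemma low_mass_increment:
  assumes yz: "y = z" and t: "t \<in> {0..T}"
  shows "(L2_set (\<lambda>k. cmod (cut low z t k)) A)\<^sup>2 \<le> (L2_set (\<lambda>k. cmod (cut low z 0 k)) A)\<^sup>2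
     + 100 * m * R0\<^sup>2 * (\<tau> * M * M)
     + (530 * m\<^sup>2 * R0\<^sup>2 * (\<tau> * M * M)
        + er * ((2 * real (4*r) + 1) * (2 * R0\<^sup>2 * (2 * \<tau> * M + M * M) + real (4*r) * M))) * T"
proof -
  let ?l = "cut low z" and ?h = "cut high z" and ?n = "4 * r"
  have sl: "?l t k = 0 \<and> cut low gz t k = 0" if "int ?n < \<bar>k\<bar>" for t k using that by (simp add: cut_def)
  have zf: "fam2 er (\<lambda>_. M) z gz" using z_fam2[of "\<lambda>_. True"] by simp
  define B1 where "B1 = 25 * m * R0\<^sup>2 * (\<tau> * M * M)"
  define B2 where "B2 = 265 * m\<^sup>2 * R0\<^sup>2 * (\<tau> * M * M) + er * (2 * real ?n + 1) * R0\<^sup>2 * (\<tau> * M + \<tau> * M + M * M)"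
  have B: "25 * 1 powr (-1/8) * m * R0\<^sup>2 * (\<tau> * M * M) = B1" "25 * 1 powr (-1/8) * m * R0\<^sup>2 * (M * \<tau> * M) = B1"
    "265 * 1 * m\<^sup>2 * R0\<^sup>2 * (\<tau> * M * M) + er * (2 * real ?n + 1) * R0\<^sup>2 * (\<tau> * M + \<tau> * M + M * M) = B2"
    "265 * 1 * m\<^sup>2 * R0\<^sup>2 * (M * \<tau> * M) + er * (2 * real ?n + 1) * R0\<^sup>2 * (M * \<tau> + M * M + \<tau> * M) = B2"
    unfolding B1_def B2_def powr_one_eq_one mult_1_right by (simp_all only: mult_ac add_ac)
  obtain S1 S1' where S1: "\<And>t. t \<in> {0..T} \<Longrightarrow> (S1 has_vector_derivative S1' t) (at t within {0..T})
     \<and> cmod (S1 t) \<le> B1 \<and> cmod (S1' t - cubic A ?h z ?l t) \<le> B2"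
    using cubic_normal_form[where n = ?n and L = 1, OF z_tail_fam2 zf z_fam2[of low] sl order_refl er0, unfolded B] by blast
  obtain S2 S2' where S2: "\<And>t. t \<in> {0..T} \<Longrightarrow> (S2 has_vector_derivative S2' t) (at t within {0..T})
     \<and> cmod (S2 t) \<le> B1 \<and> cmod (S2' t - cubic A ?l ?h ?l t) \<le> B2"
    using cubic_normal_form[where n = ?n and L = 1, OF z_fam2[of low] z_tail_fam2 z_fam2[of low] sl order_refl er0, unfolded B] by blast
  define e where "e t k = conv (z t) (z t) (- k) - cv A z z t (- k)" for t k
  have e_le: "cmod (e t k) \<le> er" if "t \<in> {0..T}" for t k
    unfolding e_def using tail_N[OF that] by (intro conv_error[OF z_curve z_curve that]) auto
  define F where "F t = (\<Sum>k\<in>A. of_int k * e t k * ?l t k)" for t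
  define E where "E t = (\<Sum>k\<in>A. ?l t k * ?l t (- k))" for t
  have E_eq: "E t = of_real ((L2_set (\<lambda>k. cmod (?l t k)) A)\<^sup>2)" if t: "t \<in> {0..T}" for t
  proof -
    have "?l t (- k) = cnj (?l t k)" for k using curveD(4)[OF z_curve t] by (simp add: cut_def)
    then show ?thesis by (simp add: E_def L2_set_power2 complex_norm_square[symmetric])
  qed
  have dl: "((\<lambda>s. ?l s k) has_vector_derivative (- \<i> * of_int (k^3) * ?l t k + \<i> * of_int k * cut low gz t k)) (at t within {0..T})"
    if "t \<in> {0..T}" "k \<in> A" for t k
    using famD(1)[OF z_fam[of low] that] .
  have E_der: "(E has_vector_derivative (- \<i> * (cubic A ?h z ?l t + cubic A ?l ?h ?l t) - \<i> * F t)) (at t within {0..T})" if t: "t \<in> {0..T}" for t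
  proof -
    have "(E has_vector_derivative (\<Sum>k\<in>A. ?l t k * (- \<i> * of_int ((-k)^3) * ?l t (-k) + \<i> * of_int (-k) * cut low gz t (-k))
        + (- \<i> * of_int (k^3) * ?l t k + \<i> * of_int k * cut low gz t k) * ?l t (-k))) (at t within {0..T})"
      unfolding E_def[abs_def]
      by (intro has_vector_derivative_sum has_vector_derivative_mult dl t uminus_A)
    also have "(\<Sum>k\<in>A. ?l t k * (- \<i> * of_int ((-k)^3) * ?l t (-k) + \<i> * of_int (-k) * cut low gz t (-k))
        + (- \<i> * of_int (k^3) * ?l t k + \<i> * of_int k * cut low gz t k) * ?l t (-k))
      = (\<Sum>k\<in>A. - \<i> * (of_int k * (cut low gz t (-k) * ?l t k))) + (\<Sum>k\<in>A. \<i> * (of_int k * (cut low gz t k * ?l t (-k))))"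
      unfolding sum.distrib[symmetric] by (intro sum.cong refl) (simp add: algebra_simps)
    also have "(\<Sum>k\<in>A. \<i> * (of_int k * (cut low gz t k * ?l t (-k)))) = (\<Sum>k\<in>A. - \<i> * (of_int k * (cut low gz t (-k) * ?l t k)))"
      by (rule sum.reindex_bij_witness[of _ uminus uminus]) (auto simp: uminus_A)
    also have "(\<Sum>k\<in>A. - \<i> * (of_int k * (cut low gz t (-k) * ?l t k))) + (\<Sum>k\<in>A. - \<i> * (of_int k * (cut low gz t (-k) * ?l t k)))
      = (\<Sum>k\<in>A. - \<i> * (of_int k * (cv A ?h z t (-k) * ?l t k)) + - \<i> * (of_int k * (cv A ?l ?h t (-k) * ?l t k))
          + - \<i> * (of_int k * (cv A ?l ?l t (-k) * ?l t k)) + - \<i> * (of_int k * e t k * ?l t k))"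
      unfolding sum.distrib[symmetric]
    proof (intro sum.cong refl)
      fix k
      have g: "gz t (- k) = (cv A ?h z t (-k) + cv A ?l ?h t (-k) + cv A ?l ?l t (-k) + e t k) / 2"
        unfolding e_def gz_def yz cv_split by simp
      show "- \<i> * (of_int k * (cut low gz t (-k) * ?l t k)) + - \<i> * (of_int k * (cut low gz t (-k) * ?l t k))
        = - \<i> * (of_int k * (cv A ?h z t (-k) * ?l t k)) + - \<i> * (of_int k * (cv A ?l ?h t (-k) * ?l t k))
          + - \<i> * (of_int k * (cv A ?l ?l t (-k) * ?l t k)) + - \<i> * (of_int k * e t k * ?l t k)"
      proof (cases "low k")
        case True
        then have g': "cut low gz t (- k) = (cv A ?h z t (-k) + cv A ?l ?h t (-k) + cv A ?l ?l t (-k) + e t k) / 2"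
          unfolding g[symmetric] by (simp add: cut_def)
        show ?thesis unfolding g' by (rule double_half_expansion)
      qed (simp add: cut_def)
    qed
    also have "\<dots> = - \<i> * (cubic A ?h z ?l t + cubic A ?l ?h ?l t + cubic A ?l ?l ?l t) - \<i> * F t"
      unfolding cubic_eq_sum_last F_def by (simp only: sum.distrib sum_distrib_left[symmetric]) (simp add: algebra_simps)
    finally show ?thesis by (simp add: cubic_diagonal_eq_0)
  qed
  define f where "f t = E t + \<i> * (S1 t + S2 t)" for t
  define f' where "f' t = - \<i> * (cubic A ?h z ?l t + cubic A ?l ?h ?l t) - \<i> * F t + \<i> * (S1' t + S2' t)" for t
  have F_le: "cmod (F t) \<le> er * (2 * real ?n + 1) * (real ?n * M)" if t: "t \<in> {0..T}" for t
  proof -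
    have "cmod (F t) \<le> (\<Sum>k\<in>A. (er * real ?n) * cmod (?l t k))"
      unfolding F_def
    proof (intro sum_norm_le)
      fix k assume k: "k \<in> A"
      show "cmod (of_int k * e t k * ?l t k) \<le> (er * real ?n) * cmod (?l t k)"
      proof (cases "low k")
        case True
        then have "real_of_int \<bar>k\<bar> \<le> real_of_int (int ?n)" by (subst of_int_le_iff)
        then have "real_of_int \<bar>k\<bar> * cmod (e t k) \<le> real ?n * er"
          using e_le[OF t] by (intro mult_mono) auto
        then have "real_of_int \<bar>k\<bar> * cmod (e t k) * cmod (?l t k) \<le> real ?n * er * cmod (?l t k)"
          by (intro mult_right_mono) auto
        then show ?thesis by (simp add: norm_mult mult_ac)
      qed (simp add: cut_def)
    qed
    also have "\<dots> = (er * real ?n) * (\<Sum>k\<in>A. cmod (?l t k))" by (simp add: sum_distrib_left)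
    also have "\<dots> \<le> (er * real ?n) * ((2 * real ?n + 1) * M)"
    proof (intro mult_left_mono)
      have "(\<Sum>k\<in>A. cmod (?l t k)) \<le> (2 * real ?n + 1) * L2_set (\<lambda>k. cmod (?l t k)) A"
        using sl by (intro sum_low_modes_le) auto
      also have "\<dots> \<le> (2 * real ?n + 1) * M"
        by (intro mult_left_mono curve_L2[OF z_curve t]) auto
      finally show "(\<Sum>k\<in>A. cmod (?l t k)) \<le> (2 * real ?n + 1) * M" .
    qed (rule mult_nonneg_nonneg[OF er0 of_nat_0_le_iff])
    finally show ?thesis by (simp only: mult_ac)
  qed
  define D where "D = B2 + B2 + er * (2 * real ?n + 1) * (real ?n * M)"
  have "cmod (f t - f 0) \<le> D * T"
  proof (rule bounded_increment[of T f f'])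
    fix s assume s: "s \<in> {0..T}"
    show "(f has_vector_derivative f' s) (at s within {0..T})"
      unfolding f_def[abs_def] f'_def using S1[OF s] S2[OF s]
      by (intro has_vector_derivative_add has_vector_derivative_mult_right E_der[OF s]) auto
    have "f' s = \<i> * ((S1' s - cubic A ?h z ?l s) + (S2' s - cubic A ?l ?h ?l s) + - F s)"
      by (simp add: f'_def algebra_simps)
    then have "cmod (f' s) = cmod ((S1' s - cubic A ?h z ?l s) + (S2' s - cubic A ?l ?h ?l s) + - F s)"
      by (simp only: norm_mult norm_ii mult_1_left)
    also have "\<dots> \<le> D" unfolding D_def using S1[OF s] S2[OF s] F_le[OF s]
      by (intro norm_triangle_mono) auto
    finally show "cmod (f' s) \<le> D" .
  qed (rule t)
  moreover have "0 \<in> {0..T}" using T0 by simp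
  moreover have "E t - E 0 = (f t - f 0) + \<i> * (- S1 t) + \<i> * (- S2 t) + \<i> * S1 0 + \<i> * S2 0"
    by (simp add: f_def algebra_simps)
  then have "cmod (E t - E 0) \<le> cmod (f t - f 0) + cmod (S1 t) + cmod (S2 t) + cmod (S1 0) + cmod (S2 0)"
    by (simp only:) (intro norm_triangle_mono; simp add: norm_mult)
  ultimately have "cmod (E t - E 0) \<le> D * T + B1 + B1 + B1 + B1"
    using S1[OF t] S2[OF t] S1[of 0] S2[of 0] by linarith
  moreover have "(L2_set (\<lambda>k. cmod (?l t k)) A)\<^sup>2 - (L2_set (\<lambda>k. cmod (?l 0 k)) A)\<^sup>2 \<le> cmod (E t - E 0)"
  proof -
    have "a - b \<le> cmod (of_real a - of_real b)" for a b :: real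
      by (metis abs_ge_self norm_of_real of_real_diff)
    moreover have "0 \<in> {0..T}" using T0 by simp
    ultimately show ?thesis unfolding E_eq[OF t] by (simp only: E_eq)
  qed
  ultimately have fin: "(L2_set (\<lambda>k. cmod (?l t k)) A)\<^sup>2 \<le> (L2_set (\<lambda>k. cmod (?l 0 k)) A)\<^sup>2 + 4 * B1 + D * T"
    by linarith
  have hB: "4 * B1 = 100 * m * R0\<^sup>2 * (\<tau> * M * M)" by (simp add: B1_def)
  have hD: "D = 530 * m\<^sup>2 * R0\<^sup>2 * (\<tau> * M * M)
        + er * ((2 * real (4*r) + 1) * (2 * R0\<^sup>2 * (2 * \<tau> * M + M * M) + real (4*r) * M))"
    by (simp add: D_def B2_def algebra_simps)
  from fin show ?thesis unfolding hB hD .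
qed

end

text \<open>The solution is paired with the zero solution, so that sum and difference both equal v.
  The bound contained in \<open>is_solution\<close> depends on the solution; only the initial norm
  is controlled by the prescribed constant. \<open>\<tau>\<close> determines r, and
  \<open>\<epsilon>\<close> is chosen afterwards because its coefficient grows with r.\<close>

lemma mass_nonincreasing:
  assumes v: "curve T M v (\<lambda>t k. conv (v t) (v t) k / 2)" and tight: "tight T v" and T: "0 \<le> T" and t: "t \<in> {0..T}"
  shows "l2n (v t) \<le> l2n (v 0)"
proof -
  define w :: path where "w = (\<lambda>_ _. 0)"
  have M0: "0 \<le> M" using curveD(2)[OF v t] order_trans[OF l2n_nonneg] by blast
  have hi0: "hi n (\<lambda>k. 0) = (\<lambda>k. 0)" for n by (simp add: hi_def fun_eq_iff)
  interpret kdv_pair T M v w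
  proof
    show "curve T M w (\<lambda>t k. conv (w t) (w t) k / 2)"
      using M0 by (simp add: curve_def w_def sqs_zero conv_def)
    show "tight T w" unfolding tight_def w_def by (auto simp: hi0 sqs_zero)
    show "l2n (v t) + l2n (w t) \<le> M" if "t \<in> {0..T}" for t
      using curveD(2)[OF v that] by (simp add: w_def sqs_zero)
  qed (rule T M0 v tight)+
  have yz: "y = v" "z = v"
    by (intro ext; simp only: y_def z_def; simp add: w_def)+
  have t0: "0 \<in> {0..T}" using T by simp
  have key: "l2n (v t) \<le> l2n (v 0) + (\<eta> + \<eta>)" if \<eta>: "0 < \<eta>" for \<eta>
  proof -
    let ?m = "2 * M + 1"
    define K1 where "K1 = 100 * ?m * R0\<^sup>2 * (M * M) + 530 * ?m\<^sup>2 * R0\<^sup>2 * (M * M) * T"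
    have K1: "0 \<le> K1" using M0 T by (simp add: K1_def)
    \<comment> \<open>Small enough that the discarded tail costs at most \<open>\<eta>\<close> and
      the flux through it at most half of the square of \<open>\<eta>\<close>.\<close>
    define \<tau> where "\<tau> = min \<eta> (\<eta>\<^sup>2 / (2 * (K1 + 1)))"
    have \<tau>: "0 < \<tau>" "\<tau> \<le> \<eta>" using \<eta> K1 by (auto simp: \<tau>_def)
    have K1\<tau>: "K1 * \<tau> \<le> \<eta>\<^sup>2 / 2"
    proof -
      have "K1 * \<tau> \<le> (K1 + 1) * (\<eta>\<^sup>2 / (2 * (K1 + 1)))"
        using K1 \<tau> by (intro mult_mono) (auto simp: \<tau>_def)
      also have "\<dots> = \<eta>\<^sup>2 / 2" using K1 by (simp add: field_simps)
      finally show ?thesis .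
    qed
    obtain r where r: "\<forall>s\<ge>r. \<forall>t\<in>{0..T}. l2n (hi s (v t)) \<le> \<tau> \<and> l2n (hi s (w t)) \<le> \<tau> \<and> l2n (hi s (y t)) \<le> \<tau> \<and> l2n (hi s (z t)) \<le> \<tau>"
      using common_tail[OF \<tau>(1)] by blast
    define K2 where "K2 = 2 * M * ((2 * real (4*r) + 1) * (2 * R0\<^sup>2 * (2 * \<tau> * M + M * M) + real (4*r) * M)) * T"
    have K2: "0 \<le> K2" using M0 T \<tau> by (simp add: K2_def)
    define \<epsilon> where "\<epsilon> = \<eta>\<^sup>2 / (2 * (K2 + 1))"
    have \<epsilon>: "0 < \<epsilon>" using \<eta> K2 by (simp add: \<epsilon>_def)
    have K2\<epsilon>: "K2 * \<epsilon> \<le> \<eta>\<^sup>2 / 2"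
    proof -
      have "K2 * \<epsilon> \<le> (K2 + 1) * (\<eta>\<^sup>2 / (2 * (K2 + 1)))"
        using K2 \<epsilon> by (intro mult_mono) (auto simp: \<epsilon>_def)
      also have "\<dots> = \<eta>\<^sup>2 / 2" using K2 by (simp add: field_simps)
      finally show ?thesis .
    qed
    obtain N0 where N0: "\<forall>s\<ge>N0. \<forall>t\<in>{0..T}. l2n (hi s (v t)) \<le> \<epsilon> \<and> l2n (hi s (w t)) \<le> \<epsilon> \<and> l2n (hi s (y t)) \<le> \<epsilon> \<and> l2n (hi s (z t)) \<le> \<epsilon>"
      using common_tail[OF \<epsilon>] by blast
    define N where "N = max N0 (4 * r)"
    interpret tr: kdv_pair_trunc T M v w N r \<tau> \<epsilon>
      by unfold_locales (use r N0 in \<open>auto simp: N_def\<close>)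
    define E where "E t = L2_set (\<lambda>k. cmod (cut (\<lambda>k. \<bar>k\<bar> \<le> int (4*r)) v t k)) (freqs N)" for t
    have "(E t)\<^sup>2 \<le> (E 0)\<^sup>2 + 100 * ?m * R0\<^sup>2 * (\<tau> * M * M)
     + (530 * ?m\<^sup>2 * R0\<^sup>2 * (\<tau> * M * M)
        + 2 * M * \<epsilon> * ((2 * real (4*r) + 1) * (2 * R0\<^sup>2 * (2 * \<tau> * M + M * M) + real (4*r) * M))) * T"
      using tr.low_mass_increment[OF _ t] by (simp only: yz E_def)
    also have "\<dots> = (E 0)\<^sup>2 + K1 * \<tau> + K2 * \<epsilon>" by (simp add: K1_def K2_def algebra_simps)
    also have "\<dots> \<le> (E 0)\<^sup>2 + \<eta>\<^sup>2" using K1\<tau> K2\<epsilon> by linarith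
    finally have "E t \<le> sqrt ((E 0)\<^sup>2 + \<eta>\<^sup>2)" by (simp add: real_le_rsqrt)
    also have "\<dots> \<le> E 0 + \<eta>"
      using sqrt_add_le_add_sqrt[of "(E 0)\<^sup>2" "\<eta>\<^sup>2"] \<eta> by (simp add: E_def)
    also have "E 0 \<le> l2n (v 0)"
    proof -
      have "E 0 \<le> l2n (cut (\<lambda>k. \<bar>k\<bar> \<le> int (4*r)) v 0)"
        unfolding E_def by (intro L2_set_le_l2n sqs_cut curveD[OF v t0]) (simp add: freqs_def)
      then show ?thesis using sqs_cut(2)[of v 0, OF curveD(1)[OF v t0]] order_trans by blast
    qed
    finally have Et: "E t \<le> l2n (v 0) + \<eta>" by simp
    have lo_le: "l2n (lo (4*r) (v t)) \<le> E t"
    proof (rule sqs_l2n_boundI(2))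
      fix F :: "int set" assume F: "finite F"
      have "(\<Sum>k\<in>F. (cmod (lo (4*r) (v t) k))\<^sup>2) \<le> (\<Sum>k\<in>F \<union> freqs N. (cmod (lo (4*r) (v t) k))\<^sup>2)"
        using F by (intro sum_mono2) (auto simp: freqs_def)
      also have "\<dots> = (\<Sum>k\<in>freqs N. (cmod (lo (4*r) (v t) k))\<^sup>2)"
        using F curveD(3)[OF v t] by (intro sum.mono_neutral_right) (auto simp: freqs_def lo_def N_def)
      also have "\<dots> = (E t)\<^sup>2" by (simp add: E_def L2_set_power2 lo_def cut_def)
      finally show "L2_set (\<lambda>k. cmod (lo (4*r) (v t) k)) F \<le> E t"
        by (intro L2_set_le_if_sum_le) (auto simp: E_def)
    qed
    have "l2n (v t) \<le> l2n (hi (4*r) (v t)) + l2n (lo (4*r) (v t))"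
      using sqs_add(2)[OF sqs_hi(1)[OF curveD(1)[OF v t]] sqs_lo(1)[OF curveD(1)[OF v t]], of "4*r" "4*r"] by (simp flip: hi_lo)
    also have "l2n (hi (4*r) (v t)) \<le> \<eta>"
    proof -
      have "r \<le> 4 * r" by simp
      then have "l2n (hi (4*r) (v t)) \<le> \<tau>" using r t by blast
      then show ?thesis using \<tau>(2) by linarith
    qed
    finally show ?thesis using Et lo_le by linarith
  qed
  show ?thesis
  proof (rule field_le_epsilon)
    fix e :: real assume "0 < e"
    then show "l2n (v t) \<le> l2n (v 0) + e" using key[of "e / 2"] by simp
  qed
qed

section \<open>Linear ordinary differential equations\<close>

lemma integral_exp_le:
  fixes c t :: real
  assumes "0 < c" "0 \<le> t"
  shows "integral {0..t} (\<lambda>s. exp (c * s)) \<le> exp (c * t) / c"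
proof -
  have "((\<lambda>s. exp (c * s)) has_integral (exp (c * t) / c - exp (c * 0) / c)) {0..t}"
  proof (rule fundamental_theorem_of_calculus[OF assms(2)])
    fix x
    have "((\<lambda>s. exp (c * s) / c) has_real_derivative exp (c * x)) (at x within {0..t})"
      using assms by (auto intro!: derivative_eq_intros)
    then show "((\<lambda>s. exp (c * s) / c) has_vector_derivative exp (c * x)) (at x within {0..t})"
      by (simp add: has_real_derivative_iff_has_vector_derivative)
  qed
  then show ?thesis using assms by (simp add: integral_unique)
qed

text \<open>Picard iteration, measured against exp (2 c t) with c at least the entry bound times the
  dimension. In this weight every step halves the distance, so the iteration converges on the whole
  interval at once.\<close>

lemma linear_ode_exists:
  fixes a :: "real \<Rightarrow> 'i \<Rightarrow> 'i \<Rightarrow> complex" and b :: "'i \<Rightarrow> complex"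
  assumes fin: "finite B" and T: "0 \<le> T"
    and cont: "\<And>k j. k \<in> B \<Longrightarrow> j \<in> B \<Longrightarrow> continuous_on {0..T} (\<lambda>t. a t k j)"
  obtains x where "\<And>k. k \<in> B \<Longrightarrow> x 0 k = b k"
    "\<And>t k. t \<in> {0..T} \<Longrightarrow> k \<in> B \<Longrightarrow>
       ((\<lambda>s. x s k) has_vector_derivative (\<Sum>j\<in>B. a t k j * x t j)) (at t within {0..T})"
proof -
  have "\<exists>C. \<forall>t\<in>{0..T}. cmod (a t k j) \<le> C" if "k \<in> B" "j \<in> B" for k j
  proof -
    have "bounded ((\<lambda>t. a t k j) ` {0..T})"
      by (intro compact_imp_bounded compact_continuous_image cont that) simp
    then show ?thesis unfolding bounded_iff by blast
  qed
  then obtain C where C: "\<And>k j t. k \<in> B \<Longrightarrow> j \<in> B \<Longrightarrow> t \<in> {0..T} \<Longrightarrow> cmod (a t k j) \<le> C k j" by metis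
  define \<Lambda> where "\<Lambda> = (\<Sum>k\<in>B. \<Sum>j\<in>B. \<bar>C k j\<bar>)"
  have \<Lambda>0: "0 \<le> \<Lambda>" unfolding \<Lambda>_def by (intro sum_nonneg) auto
  have a_le: "cmod (a t k j) \<le> \<Lambda>" if "k \<in> B" "j \<in> B" "t \<in> {0..T}" for t k j
  proof -
    have "cmod (a t k j) \<le> \<bar>C k j\<bar>" using C[OF that] by linarith
    also have "\<dots> \<le> (\<Sum>j\<in>B. \<bar>C k j\<bar>)" using fin that by (intro member_le_sum) auto
    also have "\<dots> \<le> \<Lambda>" unfolding \<Lambda>_def using fin that by (intro member_le_sum sum_nonneg) auto
    finally show ?thesis .
  qed
  \<comment> \<open>The summand 1 keeps \<open>c\<close> positive when the matrix vanishes or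
    \<open>B\<close> is empty.\<close>
  define c where "c = \<Lambda> * real (card B) + 1"
  have c: "0 < c" "\<Lambda> * real (card B) \<le> c" using \<Lambda>0 by (auto simp: c_def intro: add_nonneg_pos)
  define F where "F = (\<lambda>Y :: real \<Rightarrow> 'i \<Rightarrow> complex. \<lambda>t k. b k + integral {0..t} (\<lambda>s. \<Sum>j\<in>B. a s k j * Y s j))"
  define X where "X n = (F ^^ n) (\<lambda>t k. b k)" for n
  have X0: "X 0 t k = b k" for t k by (simp add: X_def)
  have XS: "X (Suc n) t k = b k + integral {0..t} (\<lambda>s. \<Sum>j\<in>B. a s k j * X n s j)" for n t k
    by (simp add: X_def F_def)
  have contF: "continuous_on {0..T} (\<lambda>s. \<Sum>j\<in>B. a s k j * Y s j)"
    if "k \<in> B" "\<And>j. j \<in> B \<Longrightarrow> continuous_on {0..T} (\<lambda>s. Y s j)" for Y :: "real \<Rightarrow> 'i \<Rightarrow> complex" and k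
    using that by (intro continuous_intros cont) auto
  have contX: "continuous_on {0..T} (\<lambda>s. X n s k)" if "k \<in> B" for n k
    using that
  proof (induction n arbitrary: k)
    case 0
    then show ?case by (simp add: X_def)
  next
    case (Suc n)
    show ?case unfolding XS
      by (intro continuous_intros indefinite_integral_continuous_1 integrable_continuous_real contF Suc)
  qed
  have intg: "(\<lambda>s. \<Sum>j\<in>B. a s k j * Y s j) integrable_on {0..t}"
    if "k \<in> B" "\<And>j. j \<in> B \<Longrightarrow> continuous_on {0..T} (\<lambda>s. Y s j)" "t \<in> {0..T}" for Y :: "real \<Rightarrow> 'i \<Rightarrow> complex" and k t
    by (rule integrable_continuous_real[OF continuous_on_subset[OF contF[OF that(1,2)]]]) (use that in auto)
  define D where "D n t = (\<Sum>k\<in>B. cmod (X (Suc n) t k - X n t k))" for n t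
  have contD: "continuous_on {0..T} (D n)" for n
    unfolding D_def[abs_def] by (intro continuous_intros contX) auto
  obtain K where K: "\<And>t. t \<in> {0..T} \<Longrightarrow> D 0 t \<le> K"
  proof -
    have "bounded (D 0 ` {0..T})" by (intro compact_imp_bounded compact_continuous_image contD) simp
    then show ?thesis using that unfolding bounded_iff by (metis imageI norm_ge_zero real_norm_def abs_ge_self order_trans)
  qed
  have D0: "0 \<le> D n t" for n t by (simp add: D_def sum_nonneg)
  have K0: "0 \<le> K" using K[of 0] D0[of 0 0] T by simp
  have D_le: "D n t \<le> K * (1/2)^n * exp (2 * c * t)" if "t \<in> {0..T}" for n t
    using that
  proof (induction n arbitrary: t)
    case 0
    have "K * 1 \<le> K * exp (2 * c * t)" using 0 K0 c by (intro mult_left_mono) auto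
    then show ?case using K[OF 0] by simp
  next
    case (Suc n)
    let ?I = "integral {0..t} (\<lambda>s. \<Lambda> * D n s)"
    have sub: "{0..t} \<subseteq> {0..T}" using Suc.prems by auto
    have intD: "D n integrable_on {0..t}"
      by (rule integrable_continuous_real[OF continuous_on_subset[OF contD sub]])
    have each: "cmod (X (Suc (Suc n)) t k - X (Suc n) t k) \<le> ?I" if k: "k \<in> B" for k
    proof -
      have "X (Suc (Suc n)) t k - X (Suc n) t k
         = integral {0..t} (\<lambda>s. (\<Sum>j\<in>B. a s k j * X (Suc n) s j) - (\<Sum>j\<in>B. a s k j * X n s j))"
        unfolding XS[of "Suc n" t k] XS[of n t k]
        by (subst integral_diff) (auto intro!: intg[OF k _ Suc.prems] contX)
      also have "\<dots> = integral {0..t} (\<lambda>s. \<Sum>j\<in>B. a s k j * (X (Suc n) s j - X n s j))"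
        by (simp add: sum_subtractf right_diff_distrib)
      also have "cmod \<dots> \<le> ?I"
      proof (rule integral_norm_bound_integral)
        show "(\<lambda>s. \<Sum>j\<in>B. a s k j * (X (Suc n) s j - X n s j)) integrable_on {0..t}"
          by (rule intg[OF k _ Suc.prems]) (intro continuous_intros contX)
        show "(\<lambda>s. \<Lambda> * D n s) integrable_on {0..t}" by (intro integrable_on_mult_right intD)
        fix s assume "s \<in> {0..t}"
        then have s: "s \<in> {0..T}" using sub by auto
        have "cmod (\<Sum>j\<in>B. a s k j * (X (Suc n) s j - X n s j)) \<le> (\<Sum>j\<in>B. \<Lambda> * cmod (X (Suc n) s j - X n s j))"
          by (intro sum_norm_le) (auto simp: norm_mult intro!: mult_right_mono a_le k s)
        then show "cmod (\<Sum>j\<in>B. a s k j * (X (Suc n) s j - X n s j)) \<le> \<Lambda> * D n s"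
          by (simp add: D_def sum_distrib_left)
      qed
      finally show ?thesis .
    qed
    have I_le: "?I \<le> \<Lambda> * (K * (1/2)^n) * (exp (2 * c * t) / (2 * c))"
    proof -
      have "?I \<le> integral {0..t} (\<lambda>s. \<Lambda> * (K * (1/2)^n) * exp (2 * c * s))"
      proof (rule integral_le)
        show "(\<lambda>s. \<Lambda> * (K * (1/2)^n) * exp (2 * c * s)) integrable_on {0..t}"
          by (intro integrable_continuous_real continuous_intros)
        fix s assume "s \<in> {0..t}"
        then have "D n s \<le> K * (1/2)^n * exp (2 * c * s)" using sub by (intro Suc.IH) auto
        from mult_left_mono[OF this \<Lambda>0] show "\<Lambda> * D n s \<le> \<Lambda> * (K * (1/2)^n) * exp (2 * c * s)"
          by (simp add: mult_ac)
      qed (intro integrable_on_mult_right intD)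
      also have "\<dots> = \<Lambda> * (K * (1/2)^n) * integral {0..t} (\<lambda>s. exp (2 * c * s))" by simp
      also have "\<dots> \<le> \<Lambda> * (K * (1/2)^n) * (exp (2 * c * t) / (2 * c))"
        using integral_exp_le[of "2 * c" t] c \<Lambda>0 K0 Suc.prems by (intro mult_left_mono) auto
      finally show ?thesis .
    qed
    have "D (Suc n) t = (\<Sum>k\<in>B. cmod (X (Suc (Suc n)) t k - X (Suc n) t k))" by (simp only: D_def)
    also have "\<dots> \<le> real (card B) * ?I" by (rule sum_bounded_above) (rule each)
    also have "\<dots> \<le> real (card B) * (\<Lambda> * (K * (1/2)^n) * (exp (2 * c * t) / (2 * c)))"
      by (intro mult_left_mono I_le) auto
    \<comment> \<open>Integrating exp (2 c s) yields 1 / (2 c): the 2 gives the halving, and c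
      compensates the size of the matrix.\<close>
    also have "\<dots> = (\<Lambda> * real (card B) / c) * (K * (1/2)^Suc n * exp (2 * c * t))" using c by (simp add: field_simps)
    also have "\<dots> \<le> 1 * (K * (1/2)^Suc n * exp (2 * c * t))"
      using c K0 \<Lambda>0 by (intro mult_right_mono) auto
    finally show ?case by simp
  qed
  define x where "x t k = b k + (\<Sum>n. X (Suc n) t k - X n t k)" for t k
  have ul: "uniform_limit {0..T} (\<lambda>n t. X n t k) (\<lambda>t. x t k) sequentially" if k: "k \<in> B" for k
  proof -
    have "uniform_limit {0..T} (\<lambda>n t. \<Sum>i<n. X (Suc i) t k - X i t k) (\<lambda>t. \<Sum>i. X (Suc i) t k - X i t k) sequentially"
    proof (rule Weierstrass_m_test)
      show "summable (\<lambda>n. K * (1/2)^n * exp (2 * c * T))"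
        by (intro summable_mult summable_mult2 summable_geometric) simp
      fix n t assume t: "t \<in> {0..T}"
      have "cmod (X (Suc n) t k - X n t k) \<le> D n t"
        unfolding D_def by (rule member_le_sum[OF k _ fin]) simp
      also have "\<dots> \<le> K * (1/2)^n * exp (2 * c * t)" by (rule D_le[OF t])
      also have "\<dots> \<le> K * (1/2)^n * exp (2 * c * T)" using t K0 c by (intro mult_left_mono) auto
      finally show "cmod (X (Suc n) t k - X n t k) \<le> K * (1/2)^n * exp (2 * c * T)" .
    qed
    then have "uniform_limit {0..T} (\<lambda>n t. b k + (\<Sum>i<n. X (Suc i) t k - X i t k)) (\<lambda>t. x t k) sequentially"
      unfolding x_def by (intro uniform_limit_intros)
    moreover have "b k + (\<Sum>i<n. X (Suc i) t k - X i t k) = X n t k" for n t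
      using sum_lessThan_telescope[of "\<lambda>i. X i t k" n] by (simp add: X0)
    ultimately show ?thesis by simp
  qed
  have contx: "continuous_on {0..T} (\<lambda>t. x t k)" if "k \<in> B" for k
    by (rule uniform_limit_theorem[OF _ ul[OF that]]) (auto intro!: always_eventually contX that)
  have eq: "x t k = b k + integral {0..t} (\<lambda>s. \<Sum>j\<in>B. a s k j * x s j)" if k: "k \<in> B" and t: "t \<in> {0..T}" for t k
  proof -
    define \<rho> where "\<rho> = x t k - (b k + integral {0..t} (\<lambda>s. \<Sum>j\<in>B. a s k j * x s j))"
    have small: "cmod \<rho> \<le> e * (1 + \<Lambda> * real (card B) * T)" if e: "0 < e" for e
    proof -
      have "\<forall>\<^sub>F n in sequentially. \<forall>j\<in>B. \<forall>s\<in>{0..T}. dist (X n s j) (x s j) < e"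
        using fin uniform_limitD[OF ul e] by (simp add: eventually_ball_finite_distrib)
      then obtain N where N: "\<And>n j s. N \<le> n \<Longrightarrow> j \<in> B \<Longrightarrow> s \<in> {0..T} \<Longrightarrow> cmod (X n s j - x s j) < e"
        unfolding eventually_sequentially dist_norm by blast
      have "\<rho> = - (X (Suc N) t k - x t k) + integral {0..t} (\<lambda>s. \<Sum>j\<in>B. a s k j * (X N s j - x s j))"
      proof -
        have "integral {0..t} (\<lambda>s. \<Sum>j\<in>B. a s k j * (X N s j - x s j))
          = integral {0..t} (\<lambda>s. \<Sum>j\<in>B. a s k j * X N s j) - integral {0..t} (\<lambda>s. \<Sum>j\<in>B. a s k j * x s j)"
          by (subst integral_diff[symmetric]) (auto intro!: intg[OF k _ t] contX contx simp: sum_subtractf right_diff_distrib)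
        then show ?thesis by (simp add: \<rho>_def XS)
      qed
      also have "cmod \<dots> \<le> e + \<Lambda> * real (card B) * e * T"
      proof (intro norm_triangle_le add_mono)
        show "cmod (- (X (Suc N) t k - x t k)) \<le> e" unfolding norm_minus_cancel using N[of "Suc N" k t] k t by simp
        have "cmod (integral {0..t} (\<lambda>s. \<Sum>j\<in>B. a s k j * (X N s j - x s j))) \<le> integral {0..t} (\<lambda>s. \<Lambda> * real (card B) * e)"
        proof (rule integral_norm_bound_integral)
          show "(\<lambda>s. \<Sum>j\<in>B. a s k j * (X N s j - x s j)) integrable_on {0..t}"
            by (rule intg[OF k _ t]) (intro continuous_intros contX contx)
          fix s assume "s \<in> {0..t}"
          then have s: "s \<in> {0..T}" using t by auto
          have "cmod (\<Sum>j\<in>B. a s k j * (X N s j - x s j)) \<le> (\<Sum>j\<in>B. \<Lambda> * e)"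
          proof (intro sum_norm_le)
            fix j assume j: "j \<in> B"
            show "cmod (a s k j * (X N s j - x s j)) \<le> \<Lambda> * e"
              unfolding norm_mult using a_le[OF k j s] N[OF order_refl j s] \<Lambda>0 by (intro mult_mono) auto
          qed
          then show "cmod (\<Sum>j\<in>B. a s k j * (X N s j - x s j)) \<le> \<Lambda> * real (card B) * e" by (simp add: mult_ac)
        qed (rule integrable_const_ivl)
        also have "\<dots> = \<Lambda> * real (card B) * e * t" using t by simp
        also have "\<dots> \<le> \<Lambda> * real (card B) * e * T" using t \<Lambda>0 e by (intro mult_left_mono) auto
        finally show "cmod (integral {0..t} (\<lambda>s. \<Sum>j\<in>B. a s k j * (X N s j - x s j))) \<le> \<Lambda> * real (card B) * e * T" .
      qed
      finally show ?thesis by (simp add: algebra_simps)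
    qed
    have "cmod \<rho> \<le> 0"
    proof (rule field_le_epsilon)
      fix e :: real assume e: "0 < e"
      have p: "0 < 1 + \<Lambda> * real (card B) * T" using \<Lambda>0 T by (intro add_pos_nonneg) auto
      show "cmod \<rho> \<le> 0 + e" using small[of "e / (1 + \<Lambda> * real (card B) * T)"] e p by simp
    qed
    then show ?thesis by (simp add: \<rho>_def)
  qed
  show ?thesis
  proof (rule that[of x])
    show "x 0 k = b k" if "k \<in> B" for k using eq[OF that, of 0] T by simp
    fix t k assume t: "t \<in> {0..T}" and k: "k \<in> B"
    have "((\<lambda>s. b k + integral {0..s} (\<lambda>s. \<Sum>j\<in>B. a s k j * x s j)) has_vector_derivative (0 + (\<Sum>j\<in>B. a t k j * x t j))) (at t within {0..T})"
      by (intro has_vector_derivative_add has_vector_derivative_const integral_has_vector_derivative contF contx k t)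
    from has_vector_derivative_transform[OF t eq[OF k] this]
    show "((\<lambda>s. x s k) has_vector_derivative (\<Sum>j\<in>B. a t k j * x t j)) (at t within {0..T})" by simp
  qed
qed

text \<open>Time reversal of the initial value problem with the negated matrix; it provides the
  backward solutions needed for duality.\<close>

lemma linear_ode_exists_terminal:
  fixes a :: "real \<Rightarrow> 'i \<Rightarrow> 'i \<Rightarrow> complex" and b :: "'i \<Rightarrow> complex"
  assumes fin: "finite B" and T: "0 \<le> T"
    and cont: "\<And>k j. k \<in> B \<Longrightarrow> j \<in> B \<Longrightarrow> continuous_on {0..T} (\<lambda>t. a t k j)"
  obtains x where "\<And>k. k \<in> B \<Longrightarrow> x T k = b k"
    "\<And>t k. t \<in> {0..T} \<Longrightarrow> k \<in> B \<Longrightarrow>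
       ((\<lambda>s. x s k) has_vector_derivative (\<Sum>j\<in>B. a t k j * x t j)) (at t within {0..T})"
proof -
  have im: "(\<lambda>s. T - s) ` {0..T} = {0..T}" by (auto simp: image_iff intro: bexI[of _ "T - _"])
  obtain z where z0: "\<And>k. k \<in> B \<Longrightarrow> z 0 k = b k"
    and z: "\<And>t k. t \<in> {0..T} \<Longrightarrow> k \<in> B \<Longrightarrow>
       ((\<lambda>s. z s k) has_vector_derivative (\<Sum>j\<in>B. - a (T - t) k j * z t j)) (at t within {0..T})"
  proof (rule linear_ode_exists[OF fin T, of "\<lambda>t k j. - a (T - t) k j" b])
    fix k j assume "k \<in> B" "j \<in> B"
    then have "continuous_on {0..T} (\<lambda>t. a (T - t) k j)"
      by (intro continuous_on_compose2[OF cont, of k j]) (auto intro!: continuous_intros)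
    then show "continuous_on {0..T} (\<lambda>t. - a (T - t) k j)"
      by (rule continuous_on_minus)
  qed blast
  show ?thesis
  proof (rule that[of "\<lambda>t. z (T - t)"])
    show "z (T - T) k = b k" if "k \<in> B" for k using z0[OF that] by simp
    fix t k assume t: "t \<in> {0..T}" and k: "k \<in> B"
    have "((\<lambda>s. z s k) has_vector_derivative (\<Sum>j\<in>B. - a t k j * z (T - t) j)) (at (T - t) within (\<lambda>s. T - s) ` {0..T})"
      unfolding im using z[of "T - t" k] t k by simp
    moreover have "((\<lambda>s. T - s) has_vector_derivative -1) (at t within {0..T})"
      by (auto intro!: derivative_eq_intros)
    ultimately have "(((\<lambda>s. z s k) \<circ> (\<lambda>s. T - s)) has_vector_derivative (-1) *\<^sub>R (\<Sum>j\<in>B. - a t k j * z (T - t) j)) (at t within {0..T})"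
      by (intro vector_diff_chain_within)
    then show "((\<lambda>s. z (T - s) k) has_vector_derivative (\<Sum>j\<in>B. a t k j * z (T - t) j)) (at t within {0..T})"
      by (simp add: o_def sum_negf)
  qed
qed

section \<open>Galerkin approximation\<close>

text \<open>Lets the truncation error q tend to 0 from the right. The restriction q <= qmax reflects
  the smallness condition of the energy estimate.\<close>

lemma le_of_small_errors:
  fixes X c X0 K qmax a :: real
  assumes "\<And>q. 0 < q \<Longrightarrow> q \<le> qmax \<Longrightarrow> X \<le> c * (X0 + (a + q)\<^sup>2 + K * q)" "0 < qmax"
  shows "X \<le> c * (X0 + a\<^sup>2)"
proof -
  have "((\<lambda>q. c * (X0 + (a + q)\<^sup>2 + K * q)) \<longlongrightarrow> c * (X0 + (a + 0)\<^sup>2 + K * 0)) (at_right 0)"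
    by (intro tendsto_intros)
  moreover have "\<forall>\<^sub>F q in at_right 0. X \<le> c * (X0 + (a + q)\<^sup>2 + K * q)"
    unfolding eventually_at_right_field using assms by (intro exI[of _ qmax]) auto
  ultimately have "X \<le> c * (X0 + (a + 0)\<^sup>2 + K * 0)" by (intro tendsto_lowerbound) auto
  then show ?thesis by simp
qed

lemma finite_freqs [simp]: "finite (freqs n)" by (simp add: freqs_def)

lemma L2_set_freqs_support:
  assumes "\<And>k. k \<notin> freqs n \<Longrightarrow> p k = 0" "n \<le> N"
  shows "L2_set (\<lambda>k. cmod (p k)) (freqs N) = L2_set (\<lambda>k. cmod (p k)) (freqs n)"
proof -
  have "(\<Sum>k\<in>freqs N. (cmod (p k))\<^sup>2) = (\<Sum>k\<in>freqs n. (cmod (p k))\<^sup>2)"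
    using assms by (intro sum.mono_neutral_right) (auto simp: freqs_iff)
  then show ?thesis by (simp add: L2_set_def)
qed

context kdv_pair
begin

text \<open>The coefficient y is not truncated; its frequencies up to 2 n enter. Conjugate symmetry
  of x is not imposed, so the solutions form a complex vector space and superposition
  applies.\<close>

definition galerkin :: "nat \<Rightarrow> path \<Rightarrow> bool" where
  "galerkin n x \<longleftrightarrow> (\<forall>t k. k \<notin> freqs n \<longrightarrow> x t k = 0) \<and>
     (\<forall>t\<in>{0..T}. \<forall>k\<in>freqs n. ((\<lambda>s. x s k) has_vector_derivative
        (- \<i> * of_int (k^3) * x t k + \<i> * of_int k * ((\<Sum>j\<in>freqs n. y t (k - j) * x t j) / 2))) (at t within {0..T}))"

definition galerkin_matrix :: "real \<Rightarrow> int \<Rightarrow> int \<Rightarrow> complex" where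
  "galerkin_matrix t k j = (if k = j then - \<i> * of_int (k^3) else 0) + \<i> * of_int k * y t (k - j) / 2"

lemma galerkin_matrix_cont: "continuous_on {0..T} (\<lambda>t. galerkin_matrix t k j)"
proof -
  have "continuous_on {0..T} (\<lambda>t. y t l)" for l
    by (rule continuous_on_vector_derivative) (rule curveD(5)[OF y_curve])
  then show ?thesis unfolding galerkin_matrix_def by (intro continuous_intros) auto
qed

lemma galerkin_of_ode:
  assumes x: "\<And>t k. t \<in> {0..T} \<Longrightarrow> k \<in> freqs n \<Longrightarrow>
       ((\<lambda>s. x s k) has_vector_derivative (\<Sum>j\<in>freqs n. galerkin_matrix t k j * x t j)) (at t within {0..T})"
  shows "galerkin n (\<lambda>t k. if k \<in> freqs n then x t k else 0)"
  unfolding galerkin_def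
proof (intro conjI allI impI ballI)
  fix t k assume t: "t \<in> {0..T}" and k: "k \<in> freqs n"
  have "(\<Sum>j\<in>freqs n. galerkin_matrix t k j * x t j)
    = (\<Sum>j\<in>freqs n. (if k = j then - \<i> * of_int (k^3) * x t j else 0) + \<i> * of_int k / 2 * (y t (k - j) * x t j))"
    by (intro sum.cong) (auto simp: galerkin_matrix_def algebra_simps)
  also have "\<dots> = - \<i> * of_int (k^3) * x t k + \<i> * of_int k * ((\<Sum>j\<in>freqs n. y t (k - j) * x t j) / 2)"
    unfolding sum.distrib sum_distrib_left[symmetric] using k by simp
  finally have eq: "(\<Sum>j\<in>freqs n. galerkin_matrix t k j * x t j) = \<dots>" .
  show "((\<lambda>s. if k \<in> freqs n then x s k else 0) has_vector_derivative
        (- \<i> * of_int (k^3) * (if k \<in> freqs n then x t k else 0)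
         + \<i> * of_int k * ((\<Sum>j\<in>freqs n. y t (k - j) * (if j \<in> freqs n then x t j else 0)) / 2))) (at t within {0..T})"
    using x[OF t k] k unfolding eq by simp
qed auto

lemma galerkin_initial: obtains x where "galerkin n x" "\<And>k. k \<in> freqs n \<Longrightarrow> x 0 k = b k"
proof -
  obtain x where x: "\<And>k. k \<in> freqs n \<Longrightarrow> x 0 k = b k"
    "\<And>t k. t \<in> {0..T} \<Longrightarrow> k \<in> freqs n \<Longrightarrow>
       ((\<lambda>s. x s k) has_vector_derivative (\<Sum>j\<in>freqs n. galerkin_matrix t k j * x t j)) (at t within {0..T})"
    using linear_ode_exists[of "freqs n" T galerkin_matrix b, OF finite_freqs T0 galerkin_matrix_cont] by blast
  show ?thesis by (rule that[OF galerkin_of_ode[OF x(2)]]) (simp_all add: x(1))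
qed

lemma galerkin_terminal: obtains x where "galerkin n x" "\<And>k. k \<in> freqs n \<Longrightarrow> x T k = b k"
proof -
  obtain x where x: "\<And>k. k \<in> freqs n \<Longrightarrow> x T k = b k"
    "\<And>t k. t \<in> {0..T} \<Longrightarrow> k \<in> freqs n \<Longrightarrow>
       ((\<lambda>s. x s k) has_vector_derivative (\<Sum>j\<in>freqs n. galerkin_matrix t k j * x t j)) (at t within {0..T})"
    using linear_ode_exists_terminal[of "freqs n" T galerkin_matrix b, OF finite_freqs T0 galerkin_matrix_cont] by blast
  show ?thesis by (rule that[OF galerkin_of_ode[OF x(2)]]) (simp_all add: x(1))
qed

lemma galerkin_sum:
  assumes X: "\<And>j. j \<in> freqs n \<Longrightarrow> galerkin n (X j)"
  shows "galerkin n (\<lambda>t k. \<Sum>j\<in>freqs n. a j * X j t k)"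
  unfolding galerkin_def
proof (intro conjI allI impI ballI)
  fix t k assume "k \<notin> freqs n"
  then show "(\<Sum>j\<in>freqs n. a j * X j t k) = 0" using X by (intro sum.neutral) (auto simp: galerkin_def)
next
  fix t k assume t: "t \<in> {0..T}" and k: "k \<in> freqs n"
  have "((\<lambda>s. \<Sum>j\<in>freqs n. a j * X j s k) has_vector_derivative
     (\<Sum>j\<in>freqs n. a j * (- \<i> * of_int (k^3) * X j t k + \<i> * of_int k * ((\<Sum>l\<in>freqs n. y t (k - l) * X j t l) / 2)))) (at t within {0..T})"
    using X t k by (intro has_vector_derivative_sum has_vector_derivative_mult_right) (auto simp: galerkin_def)
  also have "(\<Sum>j\<in>freqs n. a j * (- \<i> * of_int (k^3) * X j t k + \<i> * of_int k * ((\<Sum>l\<in>freqs n. y t (k - l) * X j t l) / 2)))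
    = - \<i> * of_int (k^3) * (\<Sum>j\<in>freqs n. a j * X j t k)
      + \<i> * of_int k * ((\<Sum>j\<in>freqs n. \<Sum>l\<in>freqs n. y t (k - l) * (a j * X j t l)) / 2)"
  proof -
    have "a j * (- \<i> * of_int (k^3) * X j t k + \<i> * of_int k * ((\<Sum>l\<in>freqs n. y t (k - l) * X j t l) / 2))
      = (- \<i> * of_int (k^3)) * (a j * X j t k) + (\<i> * of_int k / 2) * (\<Sum>l\<in>freqs n. y t (k - l) * (a j * X j t l))" for j
    proof -
      have "(\<Sum>l\<in>freqs n. y t (k - l) * (a j * X j t l)) = a j * (\<Sum>l\<in>freqs n. y t (k - l) * X j t l)"
        by (simp add: sum_distrib_left mult_ac)
      then show ?thesis by (simp add: algebra_simps)
    qed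
    then show ?thesis by (simp only: sum.distrib sum_distrib_left[symmetric]) simp
  qed
  also have "(\<Sum>j\<in>freqs n. \<Sum>l\<in>freqs n. y t (k - l) * (a j * X j t l)) = (\<Sum>l\<in>freqs n. y t (k - l) * (\<Sum>j\<in>freqs n. a j * X j t l))"
    by (subst sum.swap) (simp add: sum_distrib_left)
  finally show "((\<lambda>s. \<Sum>j\<in>freqs n. a j * X j s k) has_vector_derivative
     (- \<i> * of_int (k^3) * (\<Sum>j\<in>freqs n. a j * X j t k)
      + \<i> * of_int k * ((\<Sum>l\<in>freqs n. y t (k - l) * (\<Sum>j\<in>freqs n. a j * X j t l)) / 2))) (at t within {0..T})" .
qed

lemma uminus_freqs_iff [simp]: "- k \<in> freqs n \<longleftrightarrow> k \<in> freqs n"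
  by (auto simp: freqs_iff)

text \<open>The conjugate symmetry of y makes the equation invariant under conjugate reflection.
  This supplies the companion path \<open>dd\<close> of the energy estimate.\<close>

lemma galerkin_reflect:
  assumes x: "galerkin n x"
  shows "galerkin n (\<lambda>t k. cnj (x t (- k)))"
  unfolding galerkin_def
proof (intro conjI allI impI ballI)
  fix t k assume t: "t \<in> {0..T}" and k: "k \<in> freqs n"
  have "((\<lambda>s. x s (- k)) has_vector_derivative
        (- \<i> * of_int ((-k)^3) * x t (-k) + \<i> * of_int (-k) * ((\<Sum>j\<in>freqs n. y t (- k - j) * x t j) / 2))) (at t within {0..T})"
    using x t k unfolding galerkin_def by (metis uminus_freqs_iff)
  from bounded_linear.has_vector_derivative[OF bounded_linear_cnj this]
  have "((\<lambda>s. cnj (x s (- k))) has_vector_derivative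
     cnj (- \<i> * of_int ((-k)^3) * x t (-k) + \<i> * of_int (-k) * ((\<Sum>j\<in>freqs n. y t (- k - j) * x t j) / 2))) (at t within {0..T})" .
  also have "cnj (- \<i> * of_int ((-k)^3) * x t (-k) + \<i> * of_int (-k) * ((\<Sum>j\<in>freqs n. y t (- k - j) * x t j) / 2))
     = - \<i> * of_int (k^3) * cnj (x t (-k)) + \<i> * of_int k * ((\<Sum>j\<in>freqs n. cnj (y t (- k - j)) * cnj (x t j)) / 2)"
    by (simp add: cnj_sum)
  also have "(\<Sum>j\<in>freqs n. cnj (y t (- k - j)) * cnj (x t j)) = (\<Sum>j\<in>freqs n. y t (k - j) * cnj (x t (- j)))"
  proof (rule sum.reindex_bij_witness[of _ uminus uminus])
    fix j assume "j \<in> freqs n"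
    have "y t (- (k + j)) = cnj (y t (k + j))" by (rule curveD(4)[OF y_curve t])
    then have "cnj (y t (- k - j)) = y t (k + j)" by simp
    then show "y t (k - (- j)) * cnj (x t (- (- j))) = cnj (y t (- k - j)) * cnj (x t j)" by simp
  qed auto
  finally show "((\<lambda>s. cnj (x s (- k))) has_vector_derivative
     (- \<i> * of_int (k^3) * cnj (x t (-k)) + \<i> * of_int k * ((\<Sum>j\<in>freqs n. y t (k - j) * cnj (x t (- j))) / 2))) (at t within {0..T})" .
qed (use x in \<open>auto simp: galerkin_def\<close>)

text \<open>With 2 n <= N every needed frequency of y lies in the frame, so truncation costs nothing
  here. The diagonal term j = k drops out because \<open>y t 0 = 0\<close>.\<close>

lemma cv_galerkin:
  assumes x0: "\<And>k. k \<notin> freqs n \<Longrightarrow> x t k = 0" and N: "2 * n \<le> N" and t: "t \<in> {0..T}" and k: "k \<in> freqs n"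
  shows "cv (freqs N) y x t k = (\<Sum>j\<in>freqs n. y t (k - j) * x t j)"
proof -
  have y0: "y t 0 = 0" by (rule curveD(3)[OF y_curve t])
  have "cv (freqs N) y x t k = (\<Sum>l\<in>{l\<in>freqs N. k - l \<in> freqs n}. y t l * x t (k - l))"
    unfolding cv_def using x0 N
    by (intro sum.mono_neutral_right) (auto simp: freqs_iff intro: finite_subset[of _ "freqs N"])
  also have "\<dots> = (\<Sum>j\<in>freqs n - {k}. y t (k - j) * x t j)"
    using N k by (intro sum.reindex_bij_witness[of _ "\<lambda>j. k - j" "\<lambda>l. k - l"]) (auto simp: freqs_iff)
  also have "\<dots> = (\<Sum>j\<in>freqs n. y t (k - j) * x t j)"
    using y0 by (intro sum.mono_neutral_left) auto
  finally show ?thesis .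
qed

lemma trunc_exists:
  assumes q: "0 < q" and r: "\<And>t. t \<in> {0..T} \<Longrightarrow> l2n (hi r (v t)) \<le> \<tau> \<and> l2n (hi r (w t)) \<le> \<tau> \<and> l2n (hi r (y t)) \<le> \<tau> \<and> l2n (hi r (z t)) \<le> \<tau>"
  obtains N \<epsilon> where "n \<le> N" "kdv_pair_trunc T M v w N r \<tau> \<epsilon>" "0 \<le> 2 * M * \<epsilon>" "2 * M * \<epsilon> \<le> q"
proof -
  define \<epsilon> where "\<epsilon> = q / (2 * M + 1)"
  have \<epsilon>: "0 < \<epsilon>" using q M0 by (simp add: \<epsilon>_def)
  have "2 * M * \<epsilon> = (2 * M / (2 * M + 1)) * q" by (simp add: \<epsilon>_def)
  also have "\<dots> \<le> 1 * q" using M0 q by (intro mult_right_mono) auto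
  finally have le: "2 * M * \<epsilon> \<le> q" by simp
  obtain N0 where N0: "\<forall>s\<ge>N0. \<forall>t\<in>{0..T}. l2n (hi s (v t)) \<le> \<epsilon> \<and> l2n (hi s (w t)) \<le> \<epsilon> \<and> l2n (hi s (y t)) \<le> \<epsilon> \<and> l2n (hi s (z t)) \<le> \<epsilon>"
    using common_tail[OF \<epsilon>] by blast
  have "kdv_pair_trunc T M v w (max N0 n) r \<tau> \<epsilon>"
    by unfold_locales (use r N0 in auto)
  then show ?thesis using that[of "max N0 n" \<epsilon>] le M0 \<epsilon> by simp
qed

text \<open>The energy estimate without source and without forcing error of its own. The remaining
  error comes from the forcing of y and disappears as N grows with n fixed. No tail of z enters, so
  the frame is opened with r = 0 and the trivial tail bound M.\<close>

lemma galerkin_L2_bound: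
  assumes x: "galerkin n x" and t: "t0 \<in> {0..T}" "t \<in> {0..T}"
  shows "(L2_set (\<lambda>k. cmod (x t k)) (freqs n))\<^sup>2
     \<le> 4 * exp (growth_rate (2 * M + 1) * \<bar>t - t0\<bar>) * (L2_set (\<lambda>k. cmod (x t0 k)) (freqs n))\<^sup>2"
proof -
  define c where "c = 4 * exp (growth_rate (2 * M + 1) * \<bar>t - t0\<bar>)"
  define K where "K = 4 * (2 * real n + 1)\<^sup>2 * R0\<^sup>2"
  have K: "0 < K" using R0_ge_1 by (simp add: K_def)
  have M: "l2n (hi 0 (v t)) \<le> M \<and> l2n (hi 0 (w t)) \<le> M \<and> l2n (hi 0 (y t)) \<le> M \<and> l2n (hi 0 (z t)) \<le> M" if "t \<in> {0..T}" for t
    using sqs_hi(2)[OF curveD(1)[OF v that], of 0] sqs_hi(2)[OF curveD(1)[OF w that], of 0] sqs_hi(2)[OF curveD(1)[OF y_curve that], of 0]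
      sqs_hi(2)[OF curveD(1)[OF z_curve that], of 0] curveD(2)[OF v that] curveD(2)[OF w that] curveD(2)[OF y_curve that] curveD(2)[OF z_curve that]
    by linarith
  have "(L2_set (\<lambda>k. cmod (x t k)) (freqs n))\<^sup>2 \<le> c * ((L2_set (\<lambda>k. cmod (x t0 k)) (freqs n))\<^sup>2 + 0\<^sup>2)"
  proof (rule le_of_small_errors[where qmax = "1 / K" and K = "K * (M\<^sup>2 + 1)"])
    fix q :: real assume q: "0 < q" "q \<le> 1 / K"
    obtain N \<epsilon> where N: "2 * n \<le> N" "kdv_pair_trunc T M v w N 0 M \<epsilon>" "0 \<le> 2 * M * \<epsilon>" "2 * M * \<epsilon> \<le> q"
      using trunc_exists[OF q(1) M, of "2 * n"] by blast
    interpret tr: kdv_pair_trunc T M v w N 0 M \<epsilon> by (rule N)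
    have er: "tr.er * K \<le> 1"
    proof -
      have "tr.er * K \<le> q * K" using N K by (intro mult_right_mono) auto
      also have "\<dots> \<le> 1" using q K by (simp add: field_simps)
      finally show ?thesis .
    qed
    let ?G = "\<lambda>x t k. if \<bar>k\<bar> \<le> int n then (cv (freqs N) y x t k + cv (freqs N) y (\<lambda>_ _. 0) t k) / 2 + 0 else 0"
    have der: "((\<lambda>s. x s k) has_vector_derivative (- \<i> * of_int (k^3) * x t k + \<i> * of_int k * ?G x t k)) (at t within {0..T})"
      if x: "galerkin n x" and t: "t \<in> {0..T}" and k: "k \<in> freqs N" for x t k
    proof (cases "k \<in> freqs n")
      case True
      have "cv (freqs N) y x t k = (\<Sum>j\<in>freqs n. y t (k - j) * x t j)"
        using x by (intro cv_galerkin N t True) (auto simp: galerkin_def)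
      then show ?thesis using x t True by (simp add: galerkin_def cv_def freqs_iff)
    next
      case False
      then have "\<not> \<bar>k\<bar> \<le> int n" using k by (auto simp: freqs_iff)
      moreover have "x s k = 0" for s using x False by (simp add: galerkin_def)
      ultimately show ?thesis by simp
    qed
    have supp: "x t k = 0" if "galerkin n x" "int n < \<bar>k\<bar>" for x t k
      using that by (simp add: galerkin_def freqs_iff)
    have yf: "tr.fam2 tr.er (\<lambda>_. M) y gy" using tr.y_fam2[of "\<lambda>_. True"] by simp
    have est: "(L2_set (\<lambda>k. cmod (x t k)) (freqs N))\<^sup>2 \<le> 4 * exp (growth_rate (2 * M + 1) * \<bar>t - t0\<bar>) *
      ((L2_set (\<lambda>k. cmod (x t0 k)) (freqs N))\<^sup>2 + (0 + tr.er)\<^sup>2 + 4 * tr.er * (2 * real n + 1)\<^sup>2 * R0\<^sup>2 * (M\<^sup>2 + 1))"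
    proof (rule tr.energy_estimate[where G = "?G x" and f = "\<lambda>_ _. 0" and G' = "?G (\<lambda>t k. cnj (x t (- k)))" and f' = "\<lambda>_ _. 0"
          and dd = "\<lambda>t k. cnj (x t (- k))", OF yf tr.zero_fam2 tr.M_le tr.er0 M0 order_refl])
      show "4 * tr.er * (2 * real n + 1)\<^sup>2 * R0\<^sup>2 \<le> 1" using er by (simp add: K_def mult_ac)
      show "((\<lambda>s. x s k) has_vector_derivative (- \<i> * of_int (k^3) * x t k + \<i> * of_int k * ?G x t k)) (at t within {0..T})"
        if "t \<in> {0..T}" "k \<in> freqs N" for t k by (rule der[OF x that])
      show "((\<lambda>s. cnj (x s (- k))) has_vector_derivative (- \<i> * of_int (k^3) * cnj (x t (- k)) + \<i> * of_int k * ?G (\<lambda>t k. cnj (x t (- k))) t k)) (at t within {0..T})"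
        if "t \<in> {0..T}" "k \<in> freqs N" for t k by (rule der[OF galerkin_reflect[OF x] that])
      show "x t k = 0" if "int n < \<bar>k\<bar>" for t k by (rule supp[OF x that])
    qed (use tr.er0 t in simp_all)
    have LN: "L2_set (\<lambda>k. cmod (x t k)) (freqs N) = L2_set (\<lambda>k. cmod (x t k)) (freqs n)" for t
      using x N by (intro L2_set_freqs_support) (auto simp: galerkin_def)
    have "(L2_set (\<lambda>k. cmod (x t k)) (freqs n))\<^sup>2 \<le> c * ((L2_set (\<lambda>k. cmod (x t0 k)) (freqs n))\<^sup>2 + tr.er\<^sup>2 + K * (M\<^sup>2 + 1) * tr.er)"
      using est unfolding LN c_def K_def by (simp add: mult_ac)
    also have "\<dots> \<le> c * ((L2_set (\<lambda>k. cmod (x t0 k)) (freqs n))\<^sup>2 + (0 + q)\<^sup>2 + K * (M\<^sup>2 + 1) * q)"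
      using N K by (intro mult_left_mono add_mono order_refl) (auto simp: c_def intro: power_mono)
    finally show "(L2_set (\<lambda>k. cmod (x t k)) (freqs n))\<^sup>2 \<le> \<dots>" .
  qed (use K in simp)
  then show ?thesis by (simp add: c_def)
qed

text \<open>The low part of z solves the Galerkin equation up to the action of y on the high part of
  z, a source of size \<open>\<tau>\<close>, and up to the truncation error. The difference starts
  from zero, so only \<open>\<tau>\<close> survives when N tends to infinity.\<close>

lemma galerkin_converges:
  assumes x: "galerkin (4*r) x" and x0: "\<And>k. k \<in> freqs (4*r) \<Longrightarrow> x 0 k = z 0 k"
    and r: "\<And>t. t \<in> {0..T} \<Longrightarrow> l2n (hi r (v t)) \<le> \<tau> \<and> l2n (hi r (w t)) \<le> \<tau> \<and> l2n (hi r (y t)) \<le> \<tau> \<and> l2n (hi r (z t)) \<le> \<tau>"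
    and t: "t \<in> {0..T}"
  shows "(L2_set (\<lambda>k. cmod (z t k - x t k)) (freqs (4*r)))\<^sup>2 \<le> 4 * exp (growth_rate (2 * M + 1) * t) * \<tau>\<^sup>2"
proof -
  let ?n = "4 * r"
  define c where "c = 4 * exp (growth_rate (2 * M + 1) * t)"
  define K where "K = 4 * (2 * real ?n + 1)\<^sup>2 * R0\<^sup>2"
  have K: "0 < K" using R0_ge_1 by (simp add: K_def)
  define d where "d = (\<lambda>t k. cut (\<lambda>k. \<bar>k\<bar> \<le> int ?n) z t k - x t k)"
  have t0: "0 \<in> {0..T}" using T0 by simp
  have z0: "z t 0 = 0" if "t \<in> {0..T}" for t by (rule curveD(3)[OF z_curve that])
  have x00: "x t 0 = 0" for t using x by (simp add: galerkin_def freqs_iff)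
  have "(L2_set (\<lambda>k. cmod (d t k)) (freqs ?n))\<^sup>2 \<le> c * (0 + \<tau>\<^sup>2)"
  proof (rule le_of_small_errors[where qmax = "1 / K" and K = "K * (M\<^sup>2 + 1)"])
    fix q :: real assume q: "0 < q" "q \<le> 1 / K"
    obtain N \<epsilon> where N: "2 * ?n \<le> N" "kdv_pair_trunc T M v w N r \<tau> \<epsilon>" "0 \<le> 2 * M * \<epsilon>" "2 * M * \<epsilon> \<le> q"
      using trunc_exists[OF q(1) r, of "2 * ?n"] by blast
    interpret tr: kdv_pair_trunc T M v w N r \<tau> \<epsilon> by (rule N)
    have er: "tr.er * K \<le> 1"
    proof -
      have "tr.er * K \<le> q * K" using N K by (intro mult_right_mono) auto
      also have "\<dots> \<le> 1" using q K by (simp add: field_simps)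
      finally show ?thesis .
    qed
    let ?h = "cut (\<lambda>k. int ?n < \<bar>k\<bar>) z" and ?l = "cut (\<lambda>k. \<bar>k\<bar> \<le> int ?n) z"
    define f where "f t k = (conv (y t) (z t) k - cv (freqs N) y z t k) / 2" for t k
    have f_le: "cmod (f t k) \<le> tr.er" if "t \<in> {0..T}" for t k
      unfolding f_def using tr.tail_N[OF that] by (intro tr.half_le tr.conv_error[OF y_curve z_curve that]) auto
    let ?G = "\<lambda>d t k. if \<bar>k\<bar> \<le> int ?n then (cv (freqs N) y d t k + cv (freqs N) y ?h t k) / 2 + f t k else 0"
    have der: "((\<lambda>s. ?l s k - x s k) has_vector_derivative (- \<i> * of_int (k^3) * (?l t k - x t k) + \<i> * of_int k * ?G (\<lambda>t k. ?l t k - x t k) t k)) (at t within {0..T})"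
      if x: "galerkin ?n x" and t: "t \<in> {0..T}" and k: "k \<in> freqs N" for x t k
    proof (cases "k \<in> freqs ?n")
      case True
      then have low: "\<bar>k\<bar> \<le> int ?n" by (simp add: freqs_iff)
      have cvx: "cv (freqs N) y x t k = (\<Sum>j\<in>freqs ?n. y t (k - j) * x t j)"
        using x by (intro cv_galerkin N t True) (auto simp: galerkin_def)
      have "cv (freqs N) y z t k = cv (freqs N) y ?h t k + cv (freqs N) y x t k + cv (freqs N) y (\<lambda>t k. ?l t k - x t k) t k"
        unfolding cv_def sum.distrib[symmetric] by (intro sum.cong refl) (auto simp: cut_def algebra_simps)
      then have G: "gz t k - cv (freqs N) y x t k / 2 = ?G (\<lambda>t k. ?l t k - x t k) t k"
        unfolding gz_def f_def using low by (simp add: diff_divide_distrib add_divide_distrib)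
      have dz: "((\<lambda>s. ?l s k) has_vector_derivative (- \<i> * of_int (k^3) * ?l t k + \<i> * of_int k * gz t k)) (at t within {0..T})"
        using curveD(5)[OF z_curve t, of k] low by (simp add: cut_def)
      have dx: "((\<lambda>s. x s k) has_vector_derivative (- \<i> * of_int (k^3) * x t k + \<i> * of_int k * (cv (freqs N) y x t k / 2))) (at t within {0..T})"
        using x t True unfolding cvx galerkin_def by blast
      show ?thesis unfolding G[symmetric]
        by (rule has_vector_derivative_eq_rhs[OF has_vector_derivative_diff[OF dz dx]]) (simp add: algebra_simps)
    next
      case False
      then have hk: "\<not> \<bar>k\<bar> \<le> int ?n" using k by (auto simp: freqs_iff)
      moreover have "x s k = 0" for s using x False by (simp add: galerkin_def)
      ultimately show ?thesis by (simp add: cut_def)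
    qed
    have supp: "d t k = 0" if "int ?n < \<bar>k\<bar>" for t k
      using that x by (simp add: galerkin_def freqs_iff d_def cut_def)
    have yf: "tr.fam2 tr.er (\<lambda>_. M) y gy" using tr.y_fam2[of "\<lambda>_. True"] by simp
    define x' where "x' = (\<lambda>t k. cnj (x t (- k)))"
    have gx': "galerkin ?n x'" unfolding x'_def by (rule galerkin_reflect[OF x])
    have est: "(L2_set (\<lambda>k. cmod (d t k)) (freqs N))\<^sup>2 \<le> 4 * exp (growth_rate (2 * M + 1) * \<bar>t - 0\<bar>) *
      ((L2_set (\<lambda>k. cmod (d 0 k)) (freqs N))\<^sup>2 + (\<tau> + tr.er)\<^sup>2 + 4 * tr.er * (2 * real ?n + 1)\<^sup>2 * R0\<^sup>2 * (M\<^sup>2 + 1))"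
    proof (rule tr.energy_estimate[where G = "?G d" and f = f and G' = "?G (\<lambda>t k. ?l t k - x' t k)" and f' = f
          and dd = "\<lambda>t k. cnj (d t (- k))", OF yf tr.z_tail_fam2 tr.M_le tr.er0 M0 tr.\<tau>0])
      show "4 * tr.er * (2 * real ?n + 1)\<^sup>2 * R0\<^sup>2 \<le> 1" using er by (simp add: K_def mult_ac)
      show "((\<lambda>s. d s k) has_vector_derivative (- \<i> * of_int (k^3) * d t k + \<i> * of_int k * ?G d t k)) (at t within {0..T})"
        if "t \<in> {0..T}" "k \<in> freqs N" for t k using der[OF x that] unfolding d_def .
      \<comment> \<open>\<open>z\<close> is conjugate-symmetric only on the time interval, so the
        identity holds there only and derivatives are transferred within the interval.\<close>
      have rfl: "cnj (d t (- k)) = ?l t k - x' t k" if "t \<in> {0..T}" for t k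
        using curveD(4)[OF z_curve that, of k] by (simp add: d_def x'_def cut_def)
      show "((\<lambda>s. cnj (d s (- k))) has_vector_derivative (- \<i> * of_int (k^3) * cnj (d t (- k)) + \<i> * of_int k * ?G (\<lambda>t k. ?l t k - x' t k) t k)) (at t within {0..T})"
        if "t \<in> {0..T}" "k \<in> freqs N" for t k
        unfolding rfl[OF that(1)]
        by (rule has_vector_derivative_transform[OF that(1) _ der[OF gx' that]]) (rule rfl)
      have cvr: "cv (freqs N) y (\<lambda>t k. ?l t k - x' t k) t k = cv (freqs N) y (\<lambda>t k. cnj (d t (- k))) t k" if "t \<in> {0..T}" for t k
        unfolding cv_def by (simp only: rfl[OF that])
      show "?G (\<lambda>t k. ?l t k - x' t k) t k = ?G (\<lambda>t k. cnj (d t (- k))) t k" if "t \<in> {0..T}" "k \<in> freqs N" for t k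
        using cvr[OF that(1)] by simp
      show "d t k = 0" if "int ?n < \<bar>k\<bar>" for t k by (rule supp[OF that])
    qed (use f_le t t0 in auto)
    have LN: "L2_set (\<lambda>k. cmod (d t k)) (freqs N) = L2_set (\<lambda>k. cmod (d t k)) (freqs ?n)" if "t \<in> {0..T}" for t
      using N supp x00 z0[OF that] by (intro L2_set_freqs_support) (auto simp: freqs_iff d_def cut_def)
    have d0: "L2_set (\<lambda>k. cmod (d 0 k)) (freqs ?n) = 0"
      using x0 by (simp add: L2_set_def d_def cut_def freqs_iff)
    have "(L2_set (\<lambda>k. cmod (d t k)) (freqs ?n))\<^sup>2 \<le> c * (0 + (\<tau> + tr.er)\<^sup>2 + K * (M\<^sup>2 + 1) * tr.er)"
      using est t unfolding LN[OF t] LN[OF t0] d0 c_def K_def by (simp add: mult_ac)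
    also have "\<dots> \<le> c * (0 + (\<tau> + q)\<^sup>2 + K * (M\<^sup>2 + 1) * q)"
      using N K tr.\<tau>0 by (intro mult_left_mono add_mono order_refl power_mono) (auto simp: c_def)
    finally show "(L2_set (\<lambda>k. cmod (d t k)) (freqs ?n))\<^sup>2 \<le> \<dots>" .
  qed (use K in simp)
  moreover have "L2_set (\<lambda>k. cmod (d t k)) (freqs ?n) = L2_set (\<lambda>k. cmod (z t k - x t k)) (freqs ?n)"
    by (intro L2_set_cong) (auto simp: d_def cut_def freqs_iff)
  ultimately show ?thesis by (simp add: c_def)
qed

end

section \<open>Duality and interpolation\<close>

text \<open>The two geometric series of \<open>scale_weight_sum_upper\<close>: scales up to q with
  ratio \<open>4 powr (1 - s)\<close>, larger scales with ratio \<open>4 powr (- s)\<close>. The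
  first ratio exceeds 1 and the second is below 1 exactly for 0 < s < 1.\<close>

definition interp_const :: "real \<Rightarrow> real" where
  "interp_const s = 4 powr (1 - s) / (4 powr (1 - s) - 1) + 1 / (1 - 4 powr (- s))"

text \<open>At \<open>s = 0\<close> the geometric series behind \<open>interp_const\<close> diverges, but there the \<open>L^2\<close> bound needs
  no interpolation.\<close>

definition stab_const :: "real \<Rightarrow> real" where
  "stab_const s = (if s = 0 then 4 else 40 * interp_const s)"

text \<open>\<open>q powr (- s)\<close> is comparable to the sum over \<open>i\<close> of these weights, a discrete form of the
  \<open>K\<close>-method: \<open>l / (q + l) * x^2\<close> is the minimum of \<open>b^2 + l / q * c^2\<close> over \<open>b + c = x\<close>.\<close>

definition scale_weight :: "real \<Rightarrow> real \<Rightarrow> nat \<Rightarrow> real" where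
  "scale_weight s q i = (4 ^ i) powr (- s) * (4 ^ i / (q + 4 ^ i))"

lemma scale_weight_nonneg: "0 < q \<Longrightarrow> 0 \<le> scale_weight s q i"
  by (simp add: scale_weight_def)

lemma interp_const_nonneg:
  assumes "0 < s" "s < 1"
  shows "0 \<le> interp_const s"
proof -
  have "(4::real) powr 0 < 4 powr (1 - s)" using assms by (intro powr_less_mono) auto
  moreover have "(4::real) powr (- s) < 4 powr 0" using assms by (intro powr_less_mono) auto
  ultimately show ?thesis unfolding interp_const_def by (intro add_nonneg_nonneg divide_nonneg_nonneg) auto
qed

lemma power4_powr: "(4 ^ i) powr a = (4 powr a) ^ i" for a :: real
  by (simp add: powr_realpow[symmetric] powr_powr mult.commute)

text \<open>A single term suffices: at the dyadic scale next to q the fraction is at least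
  1/5.\<close>

lemma scale_weight_sum_lower:
  assumes q: "0 < q" and i: "4 ^ i \<le> q" "q < 4 ^ Suc i" and s: "0 < s" and J: "i \<le> J"
  shows "q powr (- s) / 5 \<le> (\<Sum>i\<le>J. scale_weight s q i)"
proof -
  have "q powr (- s) * (1 / 5) \<le> (4 ^ i) powr (- s) * (4 ^ i / (q + 4 ^ i))"
  proof (rule mult_mono)
    show "q powr (- s) \<le> (4 ^ i) powr (- s)" using i s by (intro powr_mono2') auto
    have "q + 4 ^ i \<le> 5 * 4 ^ i" using i by simp
    then show "1 / 5 \<le> 4 ^ i / (q + 4 ^ i)" using q by (simp add: field_simps add_pos_pos)
  qed auto
  also have "\<dots> \<le> (\<Sum>i\<le>J. scale_weight s q i)"
    unfolding scale_weight_def[symmetric] using J q by (intro member_le_sum scale_weight_nonneg) auto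
  finally show ?thesis by simp
qed

text \<open>Scales up to q form an increasing geometric sum governed by its last term, larger scales
  a decreasing one governed by its first; both are comparable to
  \<open>q powr (- s)\<close>.\<close>

lemma scale_weight_sum_upper:
  assumes q: "0 < q" and i: "4 ^ i0 \<le> q" "q < 4 ^ Suc i0" and s: "0 < s" "s < 1"
  shows "(\<Sum>i\<le>J. scale_weight s q i) \<le> interp_const s * q powr (- s)"
proof -
  define \<rho> where "\<rho> = (4::real) powr (1 - s)"
  define \<kappa> where "\<kappa> = (4::real) powr (- s)"
  have "(4::real) powr 0 < \<rho>" unfolding \<rho>_def using s by (intro powr_less_mono) auto
  then have \<rho>: "1 < \<rho>" by simp
  have "\<kappa> < (4::real) powr 0" unfolding \<kappa>_def using s by (intro powr_less_mono) auto
  then have \<kappa>: "0 < \<kappa>" "\<kappa> < 1" by (auto simp: \<kappa>_def)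
  have "(\<Sum>i\<le>J. scale_weight s q i) \<le> (\<Sum>i\<in>{..i0} \<union> {Suc i0..J}. scale_weight s q i)"
    using q by (intro sum_mono2 scale_weight_nonneg) auto
  also have "\<dots> = (\<Sum>i\<le>i0. scale_weight s q i) + (\<Sum>i=Suc i0..J. scale_weight s q i)"
    by (intro sum.union_disjoint) auto
  also have "(\<Sum>i\<le>i0. scale_weight s q i) \<le> \<rho> / (\<rho> - 1) * q powr (- s)"
  proof -
    have "(\<Sum>i\<le>i0. scale_weight s q i) \<le> (\<Sum>i\<le>i0. \<rho> ^ i / q)"
    proof (intro sum_mono)
      fix i
      have "scale_weight s q i \<le> (4 ^ i) powr (- s) * (4 ^ i / q)"
        unfolding scale_weight_def using q by (intro mult_left_mono divide_left_mono mult_pos_pos add_pos_pos) auto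
      also have "\<dots> = \<rho> ^ i / q"
        unfolding \<rho>_def power4_powr[symmetric] by (simp add: powr_diff powr_minus_divide)
      finally show "scale_weight s q i \<le> \<rho> ^ i / q" .
    qed
    also have "\<dots> = (\<Sum>i<Suc i0. \<rho> ^ i) / q" by (simp add: sum_divide_distrib lessThan_Suc_atMost)
    also have "(\<Sum>i<Suc i0. \<rho> ^ i) = (\<rho> ^ Suc i0 - 1) / (\<rho> - 1)" using \<rho> by (intro geometric_sum) auto
    also have "(\<rho> ^ Suc i0 - 1) / (\<rho> - 1) / q \<le> (\<rho> * q powr (1 - s)) / (\<rho> - 1) / q"
    proof (intro divide_right_mono)
      have "\<rho> ^ i0 \<le> q powr (1 - s)"
        unfolding \<rho>_def power4_powr[symmetric] using i s by (intro powr_mono2) auto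
      then have "\<rho> * \<rho> ^ i0 \<le> \<rho> * q powr (1 - s)" using \<rho> by (intro mult_left_mono) auto
      then show "\<rho> ^ Suc i0 - 1 \<le> \<rho> * q powr (1 - s)" by simp
    qed (use \<rho> q in auto)
    also have "\<dots> = \<rho> / (\<rho> - 1) * q powr (- s)"
      using q by (simp add: powr_diff powr_minus_divide)
    finally show ?thesis .
  qed
  also have "(\<Sum>i=Suc i0..J. scale_weight s q i) \<le> 1 / (1 - \<kappa>) * q powr (- s)"
  proof -
    have "(\<Sum>i=Suc i0..J. scale_weight s q i) \<le> (\<Sum>i=Suc i0..J. \<kappa> ^ i)"
    proof (intro sum_mono)
      fix i
      have "scale_weight s q i \<le> (4 ^ i) powr (- s) * 1"
        unfolding scale_weight_def using q by (intro mult_left_mono) (auto simp: add_pos_pos)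
      then show "scale_weight s q i \<le> \<kappa> ^ i" by (simp add: \<kappa>_def power4_powr)
    qed
    also have "\<dots> \<le> \<kappa> ^ Suc i0 / (1 - \<kappa>)"
    proof (cases "J < Suc i0")
      case True
      then show ?thesis using \<kappa> by simp
    next
      case False
      then have "(\<Sum>i=Suc i0..J. \<kappa> ^ i) = (\<kappa> ^ Suc i0 - \<kappa> ^ Suc J) / (1 - \<kappa>)"
        using \<kappa> by (simp add: sum_gp)
      also have "\<dots> \<le> \<kappa> ^ Suc i0 / (1 - \<kappa>)" using \<kappa> by (intro divide_right_mono) auto
      finally show ?thesis .
    qed
    also have "\<kappa> ^ Suc i0 \<le> q powr (- s)"
      unfolding \<kappa>_def power4_powr[symmetric] using q i s by (intro powr_mono2') auto
    finally show ?thesis using \<kappa> by (simp add: divide_right_mono)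
  qed
  finally show ?thesis by (simp add: interp_const_def \<rho>_def \<kappa>_def distrib_right)
qed

text \<open>Real interpolation in its quadratic form. At level l the data are split optimally as b +
  c; b is estimated by \<open>U0\<close>, c by \<open>U1\<close>, and the two costs recombine to l /
  (k^2 + l) times the squared data. Summing the levels 4^i with weights
  \<open>(4 ^ i) powr (- s)\<close> recovers the intermediate norm. The constant is 10 = 2 * 5:
  squaring a sum, and the lower bound for the weights.\<close>

lemma weighted_interpolation:
  fixes B :: "int set" and U :: "int \<Rightarrow> int \<Rightarrow> complex" and a :: "int \<Rightarrow> complex" and C s :: real
  defines "lin \<equiv> \<lambda>a k. \<Sum>j\<in>B. U k j * a j"
  assumes fin: "finite B" and nz: "\<And>k. k \<in> B \<Longrightarrow> k \<noteq> 0" and C: "0 \<le> C"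
    and U0: "\<And>a. (\<Sum>k\<in>B. (cmod (lin a k))\<^sup>2) \<le> C * (\<Sum>k\<in>B. (cmod (a k))\<^sup>2)"
    and U1: "\<And>a. (\<Sum>k\<in>B. (cmod (lin a k))\<^sup>2 / (real_of_int k)\<^sup>2) \<le> C * (\<Sum>k\<in>B. (cmod (a k))\<^sup>2 / (real_of_int k)\<^sup>2)"
    and s: "0 < s" "s < 1"
  shows "(\<Sum>k\<in>B. real_of_int \<bar>k\<bar> powr (- 2 * s) * (cmod (lin a k))\<^sup>2)
     \<le> 10 * C * interp_const s * (\<Sum>k\<in>B. real_of_int \<bar>k\<bar> powr (- 2 * s) * (cmod (a k))\<^sup>2)"
proof -
  have one: "(\<Sum>k\<in>B. l / ((real_of_int k)\<^sup>2 + l) * (cmod (lin a k))\<^sup>2) \<le> 2 * C * (\<Sum>k\<in>B. l / ((real_of_int k)\<^sup>2 + l) * (cmod (a k))\<^sup>2)"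
    if l: "0 < l" for l :: real
  proof -
    define b where "b k = of_real (l / ((real_of_int k)\<^sup>2 + l)) * a k" for k
    define c where "c k = of_real ((real_of_int k)\<^sup>2 / ((real_of_int k)\<^sup>2 + l)) * a k" for k
    have den: "0 < (real_of_int k)\<^sup>2 + l" for k using l by (simp add: add_nonneg_pos)
    have bc: "b k + c k = a k" for k
    proof -
      have "l / ((real_of_int k)\<^sup>2 + l) + (real_of_int k)\<^sup>2 / ((real_of_int k)\<^sup>2 + l) = 1"
        using den[of k] by (simp add: add_divide_distrib[symmetric] add.commute)
      then show ?thesis unfolding b_def c_def distrib_right[symmetric] of_real_add[symmetric] by simp
    qed
    have lin: "lin a k = lin b k + lin c k" for k
      unfolding lin_def sum.distrib[symmetric] distrib_left[symmetric] bc ..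
    have "(\<Sum>k\<in>B. l / ((real_of_int k)\<^sup>2 + l) * (cmod (lin a k))\<^sup>2)
      \<le> (\<Sum>k\<in>B. 2 * (cmod (lin b k))\<^sup>2 + 2 * l * ((cmod (lin c k))\<^sup>2 / (real_of_int k)\<^sup>2))"
    proof (intro sum_mono)
      fix k assume k: "k \<in> B"
      define \<omega> where "\<omega> = l / ((real_of_int k)\<^sup>2 + l)"
      have k2: "0 < (real_of_int k)\<^sup>2" using nz[OF k] by simp
      \<comment> \<open>The bound 1 serves the part of \<open>lin\<close> coming from b, the bound l
        / k^2 the part coming from c.\<close>
      have \<omega>: "0 \<le> \<omega>" "\<omega> \<le> 1" "\<omega> \<le> l / (real_of_int k)\<^sup>2"
        using l k2 den[of k] by (auto simp: \<omega>_def intro: divide_left_mono)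
      have "(cmod (lin a k))\<^sup>2 \<le> (cmod (lin b k) + cmod (lin c k))\<^sup>2"
        unfolding lin by (intro power_mono norm_triangle_ineq) auto
      also have "\<dots> \<le> 2 * (cmod (lin b k))\<^sup>2 + 2 * (cmod (lin c k))\<^sup>2"
        using zero_le_power2[of "cmod (lin b k) - cmod (lin c k)"] by (simp add: power2_eq_square algebra_simps)
      finally have "\<omega> * (cmod (lin a k))\<^sup>2 \<le> \<omega> * (2 * (cmod (lin b k))\<^sup>2 + 2 * (cmod (lin c k))\<^sup>2)"
        using \<omega> by (intro mult_left_mono) auto
      also have "\<dots> = \<omega> * (2 * (cmod (lin b k))\<^sup>2) + \<omega> * (2 * (cmod (lin c k))\<^sup>2)" by (simp add: distrib_left)
      also have "\<dots> \<le> 1 * (2 * (cmod (lin b k))\<^sup>2) + l / (real_of_int k)\<^sup>2 * (2 * (cmod (lin c k))\<^sup>2)"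
        using \<omega> by (intro add_mono mult_right_mono) auto
      finally show "l / ((real_of_int k)\<^sup>2 + l) * (cmod (lin a k))\<^sup>2 \<le> 2 * (cmod (lin b k))\<^sup>2 + 2 * l * ((cmod (lin c k))\<^sup>2 / (real_of_int k)\<^sup>2)"
        by (simp add: \<omega>_def mult_ac)
    qed
    also have "\<dots> = 2 * (\<Sum>k\<in>B. (cmod (lin b k))\<^sup>2) + 2 * l * (\<Sum>k\<in>B. (cmod (lin c k))\<^sup>2 / (real_of_int k)\<^sup>2)"
      by (simp add: sum.distrib sum_distrib_left)
    also have "\<dots> \<le> 2 * (C * (\<Sum>k\<in>B. (cmod (b k))\<^sup>2)) + 2 * l * (C * (\<Sum>k\<in>B. (cmod (c k))\<^sup>2 / (real_of_int k)\<^sup>2))"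
      using l by (intro add_mono mult_left_mono U0 U1) auto
    also have "\<dots> = 2 * C * (\<Sum>k\<in>B. (cmod (b k))\<^sup>2 + l * ((cmod (c k))\<^sup>2 / (real_of_int k)\<^sup>2))"
      by (simp add: sum.distrib sum_distrib_left algebra_simps)
    also have "(\<Sum>k\<in>B. (cmod (b k))\<^sup>2 + l * ((cmod (c k))\<^sup>2 / (real_of_int k)\<^sup>2)) = (\<Sum>k\<in>B. l / ((real_of_int k)\<^sup>2 + l) * (cmod (a k))\<^sup>2)"
    proof (intro sum.cong refl)
      fix k assume k: "k \<in> B"
      define Q where "Q = (real_of_int k)\<^sup>2"
      have Q: "0 < Q" "0 < Q + l" using nz[OF k] den[of k] by (auto simp: Q_def)
      have "(cmod (b k))\<^sup>2 = (l / (Q + l))\<^sup>2 * (cmod (a k))\<^sup>2"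
        unfolding b_def Q_def norm_mult power_mult_distrib norm_of_real power2_abs ..
      moreover have "(cmod (c k))\<^sup>2 = (Q / (Q + l))\<^sup>2 * (cmod (a k))\<^sup>2"
        unfolding c_def Q_def norm_mult power_mult_distrib norm_of_real power2_abs ..
      moreover have "(l / (Q + l))\<^sup>2 + l * ((Q / (Q + l))\<^sup>2 / Q) = l / (Q + l)"
      proof -
        define D where "D = Q + l"
        have D: "0 < D" "l + Q = D" using Q by (auto simp: D_def)
        have "(Q / D)\<^sup>2 / Q = Q / D\<^sup>2" using Q D by (simp add: power2_eq_square)
        then have "(l / D)\<^sup>2 + l * ((Q / D)\<^sup>2 / Q) = l * (l + Q) / D\<^sup>2"
          by (simp add: power_divide add_divide_distrib distrib_left power2_eq_square[of l])
        also have "\<dots> = l / D" unfolding D(2) using D by (simp add: power2_eq_square)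
        finally show ?thesis unfolding D_def .
      qed
      ultimately show "(cmod (b k))\<^sup>2 + l * ((cmod (c k))\<^sup>2 / (real_of_int k)\<^sup>2) = l / ((real_of_int k)\<^sup>2 + l) * (cmod (a k))\<^sup>2"
        unfolding Q_def[symmetric] by (metis (no_types, lifting) distrib_right mult.assoc times_divide_eq_left)
    qed
    finally show ?thesis .
  qed
  have pw: "real_of_int \<bar>k\<bar> powr (- 2 * s) = ((real_of_int k)\<^sup>2) powr (- s)" if "k \<in> B" for k
  proof -
    have e: "(real_of_int k)\<^sup>2 = real_of_int \<bar>k\<bar> powr 2" using nz[OF that] by (simp add: powr_numeral)
    show ?thesis unfolding e powr_powr by (rule arg_cong) simp
  qed
  have ex: "\<exists>i. 4 ^ i \<le> (real_of_int k)\<^sup>2 \<and> (real_of_int k)\<^sup>2 < 4 ^ Suc i" if "k \<in> B" for k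
  proof -
    have "1 \<le> nat (k\<^sup>2)" using nz[OF that] by (simp add: int_one_le_iff_zero_less nat_le_iff Suc_le_eq)
    then obtain i where i: "4 ^ i \<le> nat (k\<^sup>2)" "nat (k\<^sup>2) < 4 ^ (i + 1)" using ex_power_ivl1[of 4 "nat (k\<^sup>2)"] by auto
    have e: "real (nat (k\<^sup>2)) = (real_of_int k)\<^sup>2" by simp
    have "real (4 ^ i) \<le> real (nat (k\<^sup>2))" "real (nat (k\<^sup>2)) < real (4 ^ (i + 1))" using i by (simp_all only: of_nat_le_iff of_nat_less_iff)
    then show ?thesis unfolding e by (intro exI[of _ i]) simp
  qed
  then obtain \<iota> where \<iota>: "\<And>k. k \<in> B \<Longrightarrow> 4 ^ \<iota> k \<le> (real_of_int k)\<^sup>2 \<and> (real_of_int k)\<^sup>2 < 4 ^ Suc (\<iota> k)" by metis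
  define J where "J = Max (insert 0 (\<iota> ` B))"
  have J: "\<iota> k \<le> J" if "k \<in> B" for k unfolding J_def using fin that by (intro Max_ge) auto
  have q: "0 < (real_of_int k)\<^sup>2" if "k \<in> B" for k using nz[OF that] by simp
  have "(\<Sum>k\<in>B. real_of_int \<bar>k\<bar> powr (- 2 * s) * (cmod (lin a k))\<^sup>2)
     \<le> (\<Sum>k\<in>B. 5 * (\<Sum>i\<le>J. scale_weight s ((real_of_int k)\<^sup>2) i) * (cmod (lin a k))\<^sup>2)"
  proof (intro sum_mono mult_right_mono)
    fix k assume k: "k \<in> B"
    have "((real_of_int k)\<^sup>2) powr (- s) / 5 \<le> (\<Sum>i\<le>J. scale_weight s ((real_of_int k)\<^sup>2) i)"
      using \<iota>[OF k] J[OF k] s by (intro scale_weight_sum_lower[OF q[OF k], of "\<iota> k"]) auto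
    then show "real_of_int \<bar>k\<bar> powr (- 2 * s) \<le> 5 * (\<Sum>i\<le>J. scale_weight s ((real_of_int k)\<^sup>2) i)"
      unfolding pw[OF k] by simp
  qed auto
  also have "\<dots> = 5 * (\<Sum>i\<le>J. (4 ^ i) powr (- s) * (\<Sum>k\<in>B. 4 ^ i / ((real_of_int k)\<^sup>2 + 4 ^ i) * (cmod (lin a k))\<^sup>2))"
    unfolding scale_weight_def sum_distrib_left sum_distrib_right
    by (subst sum.swap) (simp add: mult.assoc)
  also have "\<dots> \<le> 5 * (\<Sum>i\<le>J. (4 ^ i) powr (- s) * (2 * C * (\<Sum>k\<in>B. 4 ^ i / ((real_of_int k)\<^sup>2 + 4 ^ i) * (cmod (a k))\<^sup>2)))"
    by (intro mult_left_mono sum_mono one) auto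
  also have "\<dots> = 10 * C * (\<Sum>i\<le>J. (4 ^ i) powr (- s) * (\<Sum>k\<in>B. 4 ^ i / ((real_of_int k)\<^sup>2 + 4 ^ i) * (cmod (a k))\<^sup>2))"
    by (simp add: sum_distrib_left mult_ac)
  also have "(\<Sum>i\<le>J. (4 ^ i) powr (- s) * (\<Sum>k\<in>B. 4 ^ i / ((real_of_int k)\<^sup>2 + 4 ^ i) * (cmod (a k))\<^sup>2))
     = (\<Sum>k\<in>B. (\<Sum>i\<le>J. scale_weight s ((real_of_int k)\<^sup>2) i) * (cmod (a k))\<^sup>2)"
    unfolding scale_weight_def sum_distrib_left sum_distrib_right
    by (subst sum.swap) (simp add: mult.assoc)
  also have "10 * C * (\<Sum>k\<in>B. (\<Sum>i\<le>J. scale_weight s ((real_of_int k)\<^sup>2) i) * (cmod (a k))\<^sup>2)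
     \<le> 10 * C * (\<Sum>k\<in>B. interp_const s * (real_of_int \<bar>k\<bar> powr (- 2 * s)) * (cmod (a k))\<^sup>2)"
  proof (intro mult_left_mono sum_mono mult_right_mono)
    fix k assume k: "k \<in> B"
    show "(\<Sum>i\<le>J. scale_weight s ((real_of_int k)\<^sup>2) i) \<le> interp_const s * real_of_int \<bar>k\<bar> powr (- 2 * s)"
      unfolding pw[OF k] using \<iota>[OF k] by (intro scale_weight_sum_upper[OF q[OF k]] s) auto
  qed (use C in auto)
  finally show ?thesis by (simp add: sum_distrib_left mult_ac)
qed

context kdv_pair
begin

text \<open>The dispersive terms cancel since k^3 is odd, the factor k of the nonlinearity cancels
  1/k, and what remains vanishes because the kernel y (k - j) is unchanged under replacing (k, j) by
  (-j, -k). The form is the symplectic form of the Hamiltonian structure with operator d/dx.\<close>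

lemma galerkin_symplectic:
  assumes x: "galerkin n x" and p: "galerkin n p" and t: "t \<in> {0..T}"
  shows "(\<Sum>k\<in>freqs n. 1 / of_int k * (x t k * p t (- k))) = (\<Sum>k\<in>freqs n. 1 / of_int k * (x 0 k * p 0 (- k)))"
proof -
  define f where "f t = (\<Sum>k\<in>freqs n. 1 / of_int k * (x t k * p t (- k)))" for t
  let ?S = "\<lambda>x t k. \<Sum>j\<in>freqs n. y t (k - j) * x t j"
  have der: "(f has_vector_derivative 0) (at t within {0..T})" if t: "t \<in> {0..T}" for t
  proof -
    have dx: "((\<lambda>s. x s k) has_vector_derivative (- \<i> * of_int (k^3) * x t k + \<i> * of_int k * (?S x t k / 2))) (at t within {0..T})"
      if "k \<in> freqs n" for k using x t that by (simp add: galerkin_def)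
    have dp: "((\<lambda>s. p s (- k)) has_vector_derivative (- \<i> * of_int ((-k)^3) * p t (-k) + \<i> * of_int (-k) * (?S p t (-k) / 2))) (at t within {0..T})"
      if "k \<in> freqs n" for k
    proof -
      have "- k \<in> freqs n" using that by simp
      then show ?thesis using p t by (simp only: galerkin_def)
    qed
    have "(f has_vector_derivative (\<Sum>k\<in>freqs n. 1 / of_int k *
        (x t k * (- \<i> * of_int ((-k)^3) * p t (-k) + \<i> * of_int (-k) * (?S p t (-k) / 2))
         + (- \<i> * of_int (k^3) * x t k + \<i> * of_int k * (?S x t k / 2)) * p t (-k)))) (at t within {0..T})"
      (is "(_ has_vector_derivative ?D) _") unfolding f_def[abs_def]
      by (rule has_vector_derivative_sum, rule has_vector_derivative_mult_right,
          rule has_vector_derivative_mult, erule dx, erule dp)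
    moreover have "?D = 0"
    proof -
      have gen: "1 / \<kappa> * (X * (- \<i> * - c * P + \<i> * - \<kappa> * (Sp / 2)) + (- \<i> * c * X + \<i> * \<kappa> * (Sx / 2)) * P)
         = \<i> / 2 * (Sx * P - X * Sp)" if "\<kappa> \<noteq> 0" for \<kappa> X c P Sp Sx :: complex
      proof -
        have "X * (- \<i> * - c * P + \<i> * - \<kappa> * (Sp / 2)) + (- \<i> * c * X + \<i> * \<kappa> * (Sx / 2)) * P
          = \<kappa> * (\<i> / 2 * (Sx * P - X * Sp))" by (simp add: algebra_simps)
        then show ?thesis using that by simp
      qed
      have e: "complex_of_int ((- k) ^ 3) = - of_int (k^3)" "complex_of_int (- k) = - of_int k" for k by simp_all
      have "?D = (\<Sum>k\<in>freqs n. \<i> / 2 * (?S x t k * p t (-k) - x t k * ?S p t (-k)))"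
        unfolding e by (intro sum.cong refl gen) (simp add: freqs_iff)
      moreover have "(\<Sum>k\<in>freqs n. x t k * ?S p t (-k)) = (\<Sum>k\<in>freqs n. ?S x t k * p t (-k))"
      proof -
        have "?S p t (-k) = (\<Sum>j\<in>freqs n. y t (- k - (- j)) * p t (- j))" for k
          by (rule sum.reindex_bij_witness[of _ uminus uminus]) auto
        then have r: "?S p t (-k) = (\<Sum>j\<in>freqs n. y t (j - k) * p t (- j))" for k by simp
        show ?thesis unfolding r sum_distrib_left sum_distrib_right
          by (subst sum.swap) (simp add: mult_ac)
      qed
      ultimately show ?thesis by (simp only: sum_distrib_left[symmetric] sum_subtractf) simp
    qed
    ultimately show ?thesis by (simp only:)
  qed
  have "cmod (f t - f 0) \<le> 0 * T"
    by (rule bounded_increment[OF der _ t]) simp_all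
  then show ?thesis by (simp add: f_def)
qed

text \<open>With W and W0 the weighted sums at times T and 0, the conserved pairing and
  Cauchy-Schwarz bound the square of W by W0 times the squared l2 norm of p at time 0. Backward l2
  stability bounds that norm by a constant times its value W at time T, and one factor W is divided
  out.\<close>

lemma galerkin_dual_bound:
  assumes x: "galerkin n x"
  shows "(\<Sum>k\<in>freqs n. (cmod (x T k))\<^sup>2 / (real_of_int k)\<^sup>2)
    \<le> 4 * exp (growth_rate (2 * M + 1) * T) * (\<Sum>k\<in>freqs n. (cmod (x 0 k))\<^sup>2 / (real_of_int k)\<^sup>2)"
proof -
  define c where "c = 4 * exp (growth_rate (2 * M + 1) * T)"
  define W where "W = (\<Sum>k\<in>freqs n. (cmod (x T k))\<^sup>2 / (real_of_int k)\<^sup>2)"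
  define W0 where "W0 = (\<Sum>k\<in>freqs n. (cmod (x 0 k))\<^sup>2 / (real_of_int k)\<^sup>2)"
  have W: "0 \<le> W" "0 \<le> W0" by (auto simp: W_def W0_def intro!: sum_nonneg)
  have T: "T \<in> {0..T}" "0 \<in> {0..T}" using T0 by auto
  \<comment> \<open>The terminal value is chosen so that its pairing with x at time T and its own
    squared l2 norm both equal \<open>W\<close>.\<close>
  obtain p where p: "galerkin n p" and pT: "\<And>k. k \<in> freqs n \<Longrightarrow> p T k = cnj (x T (- k)) / of_int (- k)"
    using galerkin_terminal[of n "\<lambda>k. cnj (x T (- k)) / of_int (- k)"] by blast
  have L2p: "(L2_set (\<lambda>k. cmod (p T k)) (freqs n))\<^sup>2 = W"
  proof -
    have "(\<Sum>k\<in>freqs n. (cmod (p T k))\<^sup>2) = (\<Sum>k\<in>freqs n. (cmod (x T (- k)))\<^sup>2 / (real_of_int k)\<^sup>2)"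
      by (intro sum.cong refl) (simp add: pT norm_divide power_divide)
    also have "\<dots> = W" unfolding W_def
      by (rule sum.reindex_bij_witness[of _ uminus uminus]) auto
    finally show ?thesis by (simp add: L2_set_power2)
  qed
  have "complex_of_real W = (\<Sum>k\<in>freqs n. 1 / of_int k * (x T k * p T (- k)))"
    unfolding W_def of_real_sum
  proof (intro sum.cong refl)
    fix k assume k: "k \<in> freqs n"
    then have "p T (- k) = cnj (x T k) / of_int k" using pT[of "- k"] by simp
    then show "complex_of_real ((cmod (x T k))\<^sup>2 / (real_of_int k)\<^sup>2) = 1 / of_int k * (x T k * p T (- k))"
      unfolding of_real_divide complex_norm_square by (simp add: power2_eq_square)
  qed
  also have "\<dots> = (\<Sum>k\<in>freqs n. 1 / of_int k * (x 0 k * p 0 (- k)))"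
    by (rule galerkin_symplectic[OF x p T(1)])
  finally have "W = cmod (\<Sum>k\<in>freqs n. 1 / of_int k * (x 0 k * p 0 (- k)))"
    using W by (metis norm_of_real abs_of_nonneg)
  also have "\<dots> \<le> (\<Sum>k\<in>freqs n. (cmod (x 0 k) / real_of_int \<bar>k\<bar>) * cmod (p 0 (- k)))"
    by (intro sum_norm_le) (simp add: norm_mult norm_divide)
  also have "\<dots> \<le> L2_set (\<lambda>k. cmod (x 0 k) / real_of_int \<bar>k\<bar>) (freqs n) * L2_set (\<lambda>k. cmod (p 0 (- k))) (freqs n)"
    by (rule sum_mult_le_L2_set)
  finally have "W\<^sup>2 \<le> (L2_set (\<lambda>k. cmod (x 0 k) / real_of_int \<bar>k\<bar>) (freqs n) * L2_set (\<lambda>k. cmod (p 0 (- k))) (freqs n))\<^sup>2"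
    using W by (intro power_mono) auto
  also have "\<dots> = W0 * (L2_set (\<lambda>k. cmod (p 0 k)) (freqs n))\<^sup>2"
  proof -
    interpret freq_set "freqs n" by (rule freq_set_freqs)
    have "L2_set (\<lambda>k. cmod (p 0 (- k))) (freqs n) = L2_set (\<lambda>k. cmod (p 0 k)) (freqs n)"
      by (rule L2_set_reflect[OF sym_A, of "\<lambda>k. cmod (p 0 k)"])
    moreover have "(L2_set (\<lambda>k. cmod (x 0 k) / real_of_int \<bar>k\<bar>) (freqs n))\<^sup>2 = W0"
      by (simp add: L2_set_power2 W0_def power_divide)
    ultimately show ?thesis by (simp add: power_mult_distrib)
  qed
  also have "\<dots> \<le> W0 * (c * W)"
    using galerkin_L2_bound[OF p T(1) T(2)] W T0 unfolding L2p c_def by (intro mult_left_mono) auto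
  finally have "W * W \<le> (c * W0) * W" by (simp add: power2_eq_square mult_ac)
  then have "W \<le> c * W0"
  proof (cases "W = 0")
    case True
    then show ?thesis using W by (simp add: c_def)
  next
    case False
    then show ?thesis using W \<open>W * W \<le> (c * W0) * W\<close> by simp
  qed
  then show ?thesis by (simp add: W_def W0_def c_def)
qed

text \<open>Interpolation requires one matrix obeying both endpoint bounds for all data. Its columns
  are the final values of solutions started from single modes. The constant 40 in
  \<open>stab_const\<close> is 10 times the 4 of the endpoint bounds.\<close>

lemma galerkin_weighted_bound:
  assumes s: "0 \<le> s" "s < 1"
  obtains x where "galerkin n x" "\<And>k. k \<in> freqs n \<Longrightarrow> x 0 k = a k"
    "(\<Sum>k\<in>freqs n. real_of_int \<bar>k\<bar> powr (- 2 * s) * (cmod (x T k))\<^sup>2)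
      \<le> stab_const s * exp (growth_rate (2 * M + 1) * T) * (\<Sum>k\<in>freqs n. real_of_int \<bar>k\<bar> powr (- 2 * s) * (cmod (a k))\<^sup>2)"
proof -
  have T: "T \<in> {0..T}" "0 \<in> {0..T}" using T0 by auto
  have "\<exists>x. galerkin n x \<and> (\<forall>k\<in>freqs n. x 0 k = (if k = j then 1 else 0))" for j
  proof (rule galerkin_initial)
    fix x assume "galerkin n x" "\<And>k. k \<in> freqs n \<Longrightarrow> x 0 k = (if k = j then 1 else 0)"
    then show ?thesis by auto
  qed
  then have "\<forall>j. \<exists>x. galerkin n x \<and> (\<forall>k\<in>freqs n. x 0 k = (if k = j then 1 else 0))" by (rule allI)
  from choice[OF this] obtain X where "\<forall>j. galerkin n (X j) \<and> (\<forall>k\<in>freqs n. X j 0 k = (if k = j then 1 else 0))" ..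
  then have X: "galerkin n (X j)" "k \<in> freqs n \<Longrightarrow> X j 0 k = (if k = j then 1 else 0)" for j k by simp_all
  define flow where "flow a = (\<lambda>t k. \<Sum>j\<in>freqs n. a j * X j t k)" for a :: "int \<Rightarrow> complex"
  have flow: "galerkin n (flow a)" for a unfolding flow_def by (rule galerkin_sum) (rule X)
  have flow0: "flow a 0 k = a k" if "k \<in> freqs n" for a k
  proof -
    have "flow a 0 k = (\<Sum>j\<in>freqs n. if k = j then a j else 0)"
      unfolding flow_def X(2)[OF that] by (intro sum.cong) auto
    then show ?thesis using that by (simp add: freqs_def)
  qed
  have sum0: "(\<Sum>k\<in>freqs n. g k (flow a 0 k)) = (\<Sum>k\<in>freqs n. g k (a k))" for a and g :: "int \<Rightarrow> complex \<Rightarrow> real"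
    by (intro sum.cong refl) (simp only: flow0)
  define C where "C = 4 * exp (growth_rate (2 * M + 1) * T)"
  define U where "U k j = X j T k" for k j
  have lin: "(\<Sum>j\<in>freqs n. U k j * a j) = flow a T k" for k a
    unfolding U_def flow_def by (simp only: mult.commute)
  have b0: "(\<Sum>k\<in>freqs n. (cmod (flow a T k))\<^sup>2) \<le> C * (\<Sum>k\<in>freqs n. (cmod (a k))\<^sup>2)" for a
  proof -
    have e: "\<bar>T - 0\<bar> = T" using T0 by simp
    show ?thesis using galerkin_L2_bound[OF flow[of a] T(2) T(1), unfolded e]
      unfolding L2_set_power2 C_def sum0[of "\<lambda>k p. (cmod p)\<^sup>2" a] .
  qed
  have b1: "(\<Sum>k\<in>freqs n. (cmod (flow a T k))\<^sup>2 / (real_of_int k)\<^sup>2) \<le> C * (\<Sum>k\<in>freqs n. (cmod (a k))\<^sup>2 / (real_of_int k)\<^sup>2)" for a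
    using galerkin_dual_bound[OF flow[of a]]
    unfolding C_def sum0[of "\<lambda>k p. (cmod p)\<^sup>2 / (real_of_int k)\<^sup>2" a] .
  have "(\<Sum>k\<in>freqs n. real_of_int \<bar>k\<bar> powr (- 2 * s) * (cmod (flow a T k))\<^sup>2)
      \<le> stab_const s * exp (growth_rate (2 * M + 1) * T) * (\<Sum>k\<in>freqs n. real_of_int \<bar>k\<bar> powr (- 2 * s) * (cmod (a k))\<^sup>2)"
  proof (cases "s = 0")
    case True
    have "(\<Sum>k\<in>freqs n. real_of_int \<bar>k\<bar> powr (- 2 * s) * (cmod (p k))\<^sup>2) = (\<Sum>k\<in>freqs n. (cmod (p k))\<^sup>2)" for p :: "int \<Rightarrow> complex"
      using True by (intro sum.cong) (auto simp: freqs_iff)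
    then show ?thesis using b0[of a] True by (simp add: stab_const_def C_def)
  next
    case False
    then have s': "0 < s" using s by simp
    have "(\<Sum>k\<in>freqs n. real_of_int \<bar>k\<bar> powr (- 2 * s) * (cmod (flow a T k))\<^sup>2)
      \<le> 10 * C * interp_const s * (\<Sum>k\<in>freqs n. real_of_int \<bar>k\<bar> powr (- 2 * s) * (cmod (a k))\<^sup>2)"
      by (rule weighted_interpolation[of "freqs n" C U s a, unfolded lin])
        (use b0 b1 s' s in \<open>simp_all add: freqs_iff C_def\<close>)
    also have "10 * C * interp_const s = stab_const s * exp (growth_rate (2 * M + 1) * T)"
      using False by (simp add: stab_const_def C_def)
    finally show ?thesis .
  qed
  from that[OF flow flow0 this] show thesis .
qed

end

section \<open>The stability estimate\<close>

context kdv_pair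
begin

text \<open>The Galerkin solution depends on the accuracy e, but its weighted bound does not. All
  weights are at most 1 for s >= 0, so closeness in l2 transfers to the weighted norm; a finite F
  fits below the cutoff once r is large.\<close>

lemma difference_bound_finite:
  assumes s: "0 \<le> s" "s < 1" and F: "finite F" "0 \<notin> F"
    and H: "\<And>n. (\<Sum>k\<in>freqs n. real_of_int \<bar>k\<bar> powr (- 2 * s) * (cmod (z 0 k))\<^sup>2) \<le> H"
  shows "(\<Sum>k\<in>F. real_of_int \<bar>k\<bar> powr (- 2 * s) * (cmod (z T k))\<^sup>2)
     \<le> stab_const s * exp (growth_rate (2 * M + 1) * T) * H"
proof -
  define E where "E = exp (growth_rate (2 * M + 1) * T)"
  define \<omega> where "\<omega> k = real_of_int \<bar>k\<bar> powr (- s)" for k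
  have E: "0 < E" by (simp add: E_def)
  have stab: "0 \<le> stab_const s" using interp_const_nonneg s by (simp add: stab_const_def)
  have \<omega>2: "(\<omega> k)\<^sup>2 = real_of_int \<bar>k\<bar> powr (- 2 * s)" for k
    unfolding \<omega>_def by (simp add: power2_eq_square powr_add[symmetric])
  have \<omega>1: "0 \<le> \<omega> k" "\<omega> k \<le> 1" if "k \<noteq> 0" for k
  proof -
    have "\<omega> k \<le> 1 powr (- s)" unfolding \<omega>_def using that s by (intro powr_mono2') auto
    then show "0 \<le> \<omega> k" "\<omega> k \<le> 1" by (auto simp: \<omega>_def)
  qed
  define m where "m = (\<Sum>k\<in>F. nat \<bar>k\<bar>)"
  have m: "\<bar>k\<bar> \<le> int m" if "k \<in> F" for k
  proof -
    have "nat \<bar>k\<bar> \<le> m" unfolding m_def using that F by (intro member_le_sum) auto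
    then show ?thesis by simp
  qed
  have "L2_set (\<lambda>k. \<omega> k * cmod (z T k)) F \<le> sqrt (stab_const s * E * H)"
  proof (rule field_le_epsilon)
    fix e :: real assume e: "0 < e"
    \<comment> \<open>Chosen so that the convergence bound 4 E \<tau>^2 equals e^2.\<close>
    define \<tau> where "\<tau> = e / (2 * sqrt E)"
    have \<tau>: "0 < \<tau>" "4 * E * \<tau>\<^sup>2 = e\<^sup>2" using e E by (auto simp: \<tau>_def power_divide power_mult_distrib)
    obtain r0 where r0: "\<And>r t. r0 \<le> r \<Longrightarrow> t \<in> {0..T} \<Longrightarrow>
        l2n (hi r (v t)) \<le> \<tau> \<and> l2n (hi r (w t)) \<le> \<tau> \<and> l2n (hi r (y t)) \<le> \<tau> \<and> l2n (hi r (z t)) \<le> \<tau>"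
      using common_tail[OF \<tau>(1)] by blast
    define r where "r = max r0 m"
    have Fr: "F \<subseteq> freqs (4 * r)"
    proof
      fix k assume "k \<in> F"
      then have "k \<noteq> 0" "\<bar>k\<bar> \<le> int m" using F m by auto
      then show "k \<in> freqs (4 * r)" by (simp add: freqs_iff r_def)
    qed
    obtain x where x: "galerkin (4 * r) x" "\<And>k. k \<in> freqs (4 * r) \<Longrightarrow> x 0 k = z 0 k"
      and xT: "(\<Sum>k\<in>freqs (4 * r). real_of_int \<bar>k\<bar> powr (- 2 * s) * (cmod (x T k))\<^sup>2)
        \<le> stab_const s * E * (\<Sum>k\<in>freqs (4 * r). real_of_int \<bar>k\<bar> powr (- 2 * s) * (cmod (z 0 k))\<^sup>2)"
      unfolding E_def by (rule galerkin_weighted_bound[OF s, of "4 * r" "z 0"]) (blast intro: that)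
    have "(L2_set (\<lambda>k. cmod (z T k - x T k)) (freqs (4 * r)))\<^sup>2 \<le> e\<^sup>2"
      unfolding \<tau>(2)[symmetric] E_def
      by (rule galerkin_converges[OF x]) (use r0[of r] T0 in \<open>auto simp: r_def\<close>)
    then have near: "L2_set (\<lambda>k. cmod (z T k - x T k)) (freqs (4 * r)) \<le> e"
      by (rule power2_le_imp_le) (use e in simp)
    have "(L2_set (\<lambda>k. \<omega> k * cmod (x T k)) (freqs (4 * r)))\<^sup>2 \<le> stab_const s * E * H"
    proof -
      have "(L2_set (\<lambda>k. \<omega> k * cmod (x T k)) (freqs (4 * r)))\<^sup>2
          = (\<Sum>k\<in>freqs (4 * r). real_of_int \<bar>k\<bar> powr (- 2 * s) * (cmod (x T k))\<^sup>2)"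
        unfolding L2_set_power2 power_mult_distrib \<omega>2 ..
      also note xT
      also have "stab_const s * E * (\<Sum>k\<in>freqs (4 * r). real_of_int \<bar>k\<bar> powr (- 2 * s) * (cmod (z 0 k))\<^sup>2)
          \<le> stab_const s * E * H"
        using stab E by (intro mult_left_mono H) auto
      finally show ?thesis .
    qed
    then have far: "L2_set (\<lambda>k. \<omega> k * cmod (x T k)) (freqs (4 * r)) \<le> sqrt (stab_const s * E * H)"
      by (rule real_le_rsqrt)
    have "L2_set (\<lambda>k. \<omega> k * cmod (z T k)) F \<le> L2_set (\<lambda>k. \<omega> k * cmod (z T k)) (freqs (4 * r))"
      unfolding L2_set_def using Fr by (intro real_sqrt_le_mono sum_mono2) (auto simp: freqs_def)
    also have "\<dots> \<le> L2_set (\<lambda>k. \<omega> k * cmod (x T k) + cmod (z T k - x T k)) (freqs (4 * r))"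
    proof (rule L2_set_mono)
      fix k assume "k \<in> freqs (4 * r)"
      then have \<omega>k: "0 \<le> \<omega> k" "\<omega> k \<le> 1" using \<omega>1 by (auto simp: freqs_iff)
      have "cmod (z T k) \<le> cmod (x T k) + cmod (z T k - x T k)"
        using norm_triangle_ineq[of "x T k" "z T k - x T k"] by simp
      then have "\<omega> k * cmod (z T k) \<le> \<omega> k * (cmod (x T k) + cmod (z T k - x T k))"
        using \<omega>k by (intro mult_left_mono)
      also have "\<dots> \<le> \<omega> k * cmod (x T k) + cmod (z T k - x T k)"
        unfolding distrib_left using mult_right_mono[OF \<omega>k(2), of "cmod (z T k - x T k)"] by simp
      finally show "\<omega> k * cmod (z T k) \<le> \<omega> k * cmod (x T k) + cmod (z T k - x T k)" .
      show "0 \<le> \<omega> k * cmod (z T k)" using \<omega>k by simp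
    qed
    also have "\<dots> \<le> L2_set (\<lambda>k. \<omega> k * cmod (x T k)) (freqs (4 * r)) + L2_set (\<lambda>k. cmod (z T k - x T k)) (freqs (4 * r))"
      by (rule L2_set_triangle_ineq)
    also have "\<dots> \<le> sqrt (stab_const s * E * H) + e" by (rule add_mono[OF far near])
    finally show "L2_set (\<lambda>k. \<omega> k * cmod (z T k)) F \<le> sqrt (stab_const s * E * H) + e" .
  qed
  moreover have "0 \<le> stab_const s * E * H"
  proof -
    have "0 \<le> H" using H[of 0] by (simp add: freqs_def)
    then show ?thesis using stab E by simp
  qed
  ultimately have "(L2_set (\<lambda>k. \<omega> k * cmod (z T k)) F)\<^sup>2 \<le> stab_const s * E * H"
    using power_mono[OF _ L2_set_nonneg, of "\<lambda>k. \<omega> k * cmod (z T k)" F _ 2] by fastforce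
  then show ?thesis unfolding L2_set_power2 power_mult_distrib \<omega>2 E_def .
qed

end

section \<open>Passage between finite sums and Sobolev norms\<close>

lemma hnorm2_leI:
  assumes "\<And>F. finite F \<Longrightarrow> 0 \<notin> F \<Longrightarrow> (\<Sum>k\<in>F. real_of_int \<bar>k\<bar> powr (2 * \<theta>) * (cmod (p k))\<^sup>2) \<le> B"
  shows "hnorm2 \<theta> p \<le> B"
proof -
  have b: "(\<Sum>k\<in>F. real_of_int \<bar>k\<bar> powr (2 * \<theta>) * (cmod (p k))\<^sup>2) \<le> B" if "finite F" "F \<subseteq> Z0" for F
    using assms[of F] that by (auto simp: Z0_def)
  have "(\<lambda>k. real_of_int \<bar>k\<bar> powr (2 * \<theta>) * (cmod (p k))\<^sup>2) summable_on Z0"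
  proof (rule nonneg_bdd_above_summable_on)
    show "bdd_above (sum (\<lambda>k. real_of_int \<bar>k\<bar> powr (2 * \<theta>) * (cmod (p k))\<^sup>2) ` {F. F \<subseteq> Z0 \<and> finite F})"
      by (rule bdd_aboveI2[of _ _ B]) (use b in blast)
  qed simp
  then show ?thesis unfolding hnorm2_def by (rule infsum_le_finite_sums) (rule b)
qed

text \<open>Summability must be established first, since \<open>infsum\<close> of a non-summable
  family is 0 by default. It holds because nonpositive powers of a nonzero integer are at most
  1.\<close>

lemma finite_sum_le_hnorm2:
  assumes p: "sqs p" and \<theta>: "\<theta> \<le> 0" and F: "finite F" "0 \<notin> F"
  shows "(\<Sum>k\<in>F. real_of_int \<bar>k\<bar> powr (2 * \<theta>) * (cmod (p k))\<^sup>2) \<le> hnorm2 \<theta> p"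
proof -
  have "(\<lambda>k. (cmod (p k))\<^sup>2) summable_on Z0"
    using p unfolding sqs_def by (rule summable_on_subset_banach) simp
  then have "(\<lambda>k. real_of_int \<bar>k\<bar> powr (2 * \<theta>) * (cmod (p k))\<^sup>2) summable_on Z0"
  proof (rule summable_on_comparison_test)
    fix k assume "k \<in> Z0"
    then have "real_of_int \<bar>k\<bar> powr (2 * \<theta>) \<le> 1 powr (2 * \<theta>)"
      using \<theta> by (intro powr_mono2') (auto simp: Z0_def)
    then show "real_of_int \<bar>k\<bar> powr (2 * \<theta>) * (cmod (p k))\<^sup>2 \<le> (cmod (p k))\<^sup>2"
      using mult_right_mono[of _ 1 "(cmod (p k))\<^sup>2"] by simp
  qed auto
  then show ?thesis unfolding hnorm2_def
    using F by (intro finite_sum_le_infsum) (auto simp: Z0_def)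
qed

lemma curve_restrict:
  assumes "curve T B p g" "t \<le> T" shows "curve t B p g"
  using assms unfolding curve_def
  by (meson atLeastAtMost_iff atLeastatMost_subset_iff has_vector_derivative_within_subset order_refl order_trans)

lemma tight_restrict:
  assumes "tight T p" "t \<le> T" shows "tight t p"
  using assms unfolding tight_def by (meson atLeastAtMost_iff order_trans)

lemma curve_bound:
  assumes "curve T B p g" "\<And>t. t \<in> {0..T} \<Longrightarrow> l2n (p t) \<le> B'" shows "curve T B' p g"
  using assms unfolding curve_def by blast

lemma solution_mass:
  assumes sol: "is_solution T v0 v" and v0: "in_Hdot 0 v0" and t: "t \<in> {0..T}"
  shows "l2n (modulate v t) \<le> hnorm 0 v0"
proof -
  have T: "0 \<le> T" using t by simp
  obtain B where B: "curve T B (modulate v) (\<lambda>t k. conv (modulate v t) (modulate v t) k / 2)" "tight T (modulate v)"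
    and init: "\<And>k. k \<noteq> 0 \<Longrightarrow> v 0 k = v0 k"
    by (rule solution_curve[OF sol T]) (blast intro: that)
  have "v 0 0 = 0" using curveD(3)[OF B(1), of 0] T by simp
  then have "v 0 k = v0 k" for k using init in_Hdot_0D(2)[OF v0] by (cases "k = 0") auto
  then have "v 0 = v0" ..
  then show ?thesis
    using mass_nonincreasing[OF B T t] hnorm_0_eq[of v0, OF in_Hdot_0D(2)[OF v0]] by simp
qed

theorem theorem6p7:
  fixes \<theta> M :: real
  assumes "-1 < \<theta>" and "\<theta> \<le> 0" and "M > 0"
  shows "\<exists>C' CM. C' > 0 \<and> CM > 0 \<and>
    (\<forall>T v0 w0 v w. T > 0 \<longrightarrow> in_Hdot 0 v0 \<longrightarrow> in_Hdot 0 w0 \<longrightarrow>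
        hnorm 0 v0 + hnorm 0 w0 \<le> M \<longrightarrow>
        is_solution T v0 v \<longrightarrow> is_solution T w0 w \<longrightarrow>
        (\<forall>t\<in>{0..T}. hnorm \<theta> (v t - w t) \<le> C' * CM powr T * hnorm \<theta> (v0 - w0)))"
proof -
  define \<Lambda> where "\<Lambda> = growth_rate (2 * M + 1)"
  \<comment> \<open>The summand 1 makes the constant strictly positive.\<close>
  define c where "c = stab_const (- \<theta>) + 1"
  have s: "0 \<le> - \<theta>" "- \<theta> < 1" using assms by auto
  have stab: "0 \<le> stab_const (- \<theta>)" using interp_const_nonneg[of "- \<theta>"] s by (simp add: stab_const_def)
  have c: "0 < c" using stab by (simp add: c_def)
  have \<Lambda>: "0 \<le> \<Lambda>"
    using assms cutoff_scale_ge_1[of "2 * M + 1"] unfolding \<Lambda>_def growth_rate_def by simp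
  have "hnorm \<theta> (v t - w t) \<le> sqrt c * exp (\<Lambda> / 2) powr T * hnorm \<theta> (v0 - w0)"
    if v0: "in_Hdot 0 v0" and w0: "in_Hdot 0 w0" and norms: "hnorm 0 v0 + hnorm 0 w0 \<le> M"
      and v: "is_solution T v0 v" and w: "is_solution T w0 w" and t: "t \<in> {0..T}" for T v0 w0 v w t
  proof -
    have T: "0 \<le> T" using t by simp
    obtain B where B: "curve T B (modulate v) (\<lambda>t k. conv (modulate v t) (modulate v t) k / 2)" "tight T (modulate v)"
      and v_init: "\<And>k. k \<noteq> 0 \<Longrightarrow> v 0 k = v0 k"
      by (rule solution_curve[OF v T]) (blast intro: that)
    obtain B' where B': "curve T B' (modulate w) (\<lambda>t k. conv (modulate w t) (modulate w t) k / 2)" "tight T (modulate w)"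
      and w_init: "\<And>k. k \<noteq> 0 \<Longrightarrow> w 0 k = w0 k"
      by (rule solution_curve[OF w T]) (blast intro: that)
    have mass: "l2n (modulate v t') + l2n (modulate w t') \<le> M" if "t' \<in> {0..t}" for t'
      using solution_mass[OF v v0, of t'] solution_mass[OF w w0, of t'] norms that t by simp
    have massv: "l2n (modulate v t') \<le> M" and massw: "l2n (modulate w t') \<le> M" if "t' \<in> {0..t}" for t'
      using mass[OF that] l2n_nonneg[of "modulate v t'"] l2n_nonneg[of "modulate w t'"] by linarith+
    have tT: "t \<le> T" "0 \<le> t" using t by auto
    \<comment> \<open>The pair is restricted to the interval from 0 to \<open>t\<close>, because the
      weighted bound is stated at the final time. The common bound \<open>M\<close> comes from the
      mass estimate, not from the solutions.\<close>
    interpret kdv_pair t M "modulate v" "modulate w"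
    proof
      show "curve t M (modulate v) (\<lambda>t k. conv (modulate v t) (modulate v t) k / 2)"
        by (rule curve_bound[OF curve_restrict[OF B(1) tT(1)] massv])
      show "curve t M (modulate w) (\<lambda>t k. conv (modulate w t) (modulate w t) k / 2)"
        by (rule curve_bound[OF curve_restrict[OF B'(1) tT(1)] massw])
      show "tight t (modulate v)" "tight t (modulate w)"
        using B(2) B'(2) tT(1) by (auto intro: tight_restrict)
    qed (use tT assms mass in auto)
    have z: "cmod (z t' k) = cmod (v t' k - w t' k)" for t' k
      unfolding z_def modulate_def right_diff_distrib[symmetric] by (simp add: norm_mult)
    have "sqs (\<lambda>k. v0 k - w0 k)"
      by (rule sqs_diff(1)[OF in_Hdot_0D(1)[OF v0] in_Hdot_0D(1)[OF w0]])
    then have sq: "sqs (v0 - w0)" by (simp add: fun_diff_def)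
    define H where "H = hnorm2 \<theta> (v0 - w0)"
    have "hnorm2 \<theta> (v t - w t) \<le> stab_const (- \<theta>) * exp (\<Lambda> * t) * H"
    proof (rule hnorm2_leI)
      fix F :: "int set" assume F: "finite F" "0 \<notin> F"
      have init: "(\<Sum>k\<in>freqs n. real_of_int \<bar>k\<bar> powr (- 2 * (- \<theta>)) * (cmod (z 0 k))\<^sup>2) \<le> H" for n
      proof -
        have "(\<Sum>k\<in>freqs n. real_of_int \<bar>k\<bar> powr (- 2 * (- \<theta>)) * (cmod (z 0 k))\<^sup>2)
          = (\<Sum>k\<in>freqs n. real_of_int \<bar>k\<bar> powr (2 * \<theta>) * (cmod ((v0 - w0) k))\<^sup>2)"
          by (intro sum.cong) (simp_all add: z freqs_iff v_init w_init)
        also have "\<dots> \<le> H"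
          unfolding H_def by (rule finite_sum_le_hnorm2[OF sq assms(2)]) (auto simp: freqs_def)
        finally show ?thesis .
      qed
      show "(\<Sum>k\<in>F. real_of_int \<bar>k\<bar> powr (2 * \<theta>) * (cmod ((v t - w t) k))\<^sup>2)
        \<le> stab_const (- \<theta>) * exp (\<Lambda> * t) * H"
        using difference_bound_finite[OF s F init] unfolding z \<Lambda>_def by simp
    qed
    also have "\<dots> \<le> c * exp (\<Lambda> * T) * H"
    proof -
      have "0 \<le> H" unfolding H_def hnorm2_def by (intro infsum_nonneg) auto
      then show ?thesis using stab \<Lambda> tT by (intro mult_mono) (auto simp: c_def intro: mult_left_mono)
    qed
    finally have "hnorm \<theta> (v t - w t) \<le> sqrt (c * exp (\<Lambda> * T) * H)"
      unfolding hnorm_def by (rule real_sqrt_le_mono)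
    also have "\<dots> = sqrt c * exp (\<Lambda> / 2) powr T * hnorm \<theta> (v0 - w0)"
    proof -
      \<comment> \<open>The estimate is for squared norms; taking the square root halves the rate,
        hence the base \<open>exp (\<Lambda> / 2)\<close>.\<close>
      have "exp (\<Lambda> * T) = (exp (\<Lambda> / 2) powr T)\<^sup>2"
        by (simp add: powr_def power2_eq_square exp_add[symmetric])
      then show ?thesis by (simp add: real_sqrt_mult hnorm_def H_def)
    qed
    finally show ?thesis .
  qed
  then show ?thesis
    using c by (intro exI[of _ "sqrt c"] exI[of _ "exp (\<Lambda> / 2)"]) auto
qed

end
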